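(* For any $\epsilon>0$, there is a polynomial time two-sided adaptive algorithm for $\epsilon$-testing $s$-Term Monotone DNF with respect to the uniform distribution that makes $\tilde O(s/\epsilon)$ queries.
   Context: Boolean functions $f:\{0,1\}^n\to\{0,1\}$ are accessed through a membership-query oracle that returns $f(x)$ for a queried $x$. $f$ is $\epsilon$-far from a class $C$ (with respect to the uniform distribution) if $\Pr_{x}[f(x)\neq g(x)]\ge\epsilon$ for every $g\in C$, with $x$ uniform on $\{0,1\}^n$. A two-sided adaptive algorithm for $\epsilon$-testing $C$ is a randomized algorithm that, given $\epsilon$ and membership-query access to an arbitrary $f$ (and able to draw uniform random strings), chooses queries possibly adaptively, accepts with probability at least $2/3$ if $f\in C$, and rejects with probability at least $2/3$ if $f$ is $\epsilon$-far from every function in $C$. $\tilde O(T)$ means $O(T\cdot\mathrm{poly}(\log T))$. $s$-Term Monotone DNF is the class of disjunctions of at most $s$ terms, each a conjunction of unnegated variables. *)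

theory Defs
  imports "HOL-Probability.Probability"
begin

section \<open>Distance and monotone DNF\<close>

text \<open>
  A Boolean function on $n$ variables is a function on \<^typ>\<open>bool list\<close> of which only the values
  on lists of length \<open>n\<close> matter.
\<close>

definition cube :: "nat \<Rightarrow> bool list set" where
  "cube n = {x. length x = n}"

definition eps_far :: "nat \<Rightarrow> real \<Rightarrow> (bool list \<Rightarrow> bool) \<Rightarrow> (bool list \<Rightarrow> bool) set \<Rightarrow> bool" where
  "eps_far n \<epsilon> f C \<longleftrightarrow>
     (\<forall>g\<in>C. measure_pmf.prob (pmf_of_set (cube n)) {x. f x \<noteq> g x} \<ge> \<epsilon>)"

text \<open>
  A monotone term is given by the set of its variables, a monotone DNF by the set of its terms.
  The empty term is the constant true and the empty disjunction the constant false.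
\<close>

definition dnf_val :: "nat set set \<Rightarrow> bool list \<Rightarrow> bool" where
  "dnf_val D x \<longleftrightarrow> (\<exists>T\<in>D. \<forall>i\<in>T. x ! i)"

definition monotone_dnf :: "nat \<Rightarrow> nat \<Rightarrow> (bool list \<Rightarrow> bool) set" where
  "monotone_dnf n s =
     {f. \<exists>D. finite D \<and> card D \<le> s \<and> (\<forall>T\<in>D. T \<subseteq> {..<n}) \<and> (\<forall>x\<in>cube n. f x = dnf_val D x)}"

section \<open>Randomized oracle programs\<close>

text \<open>
  Algorithms are programs of a structured random access machine with fair coin flips and a
  membership oracle. The memory consists of named arrays of natural numbers; all but finitely many
  cells are initially zero.

  Every elementary step costs one unit of time, except that a query of an \<open>n\<close>-bit string costs
  \<open>n + 1\<close>. Multiplication is deliberately not a primitive: with addition, truncated subtraction,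
  division and remainder, a single step lengthens the largest number by only a constant number of
  bits (depending on the program), so that polynomially many steps amount to polynomial time on a
  Turing machine. Repeated squaring at unit cost would break this.
\<close>

datatype aexp =
    Num nat
  | Cell string aexp
  | Plus aexp aexp
  | Minus aexp aexp
  | Div aexp aexp
  | Mod aexp aexp

datatype bexp =
    Less aexp aexp
  | BNot bexp
  | BAnd bexp bexp

datatype com =
    Skip
  | Assign string aexp aexp
  | Flip string aexp
  | Query string aexp string
  | Seq com com
  | Cond bexp com com
  | While bexp com

type_synonym memory = "string \<Rightarrow> nat \<Rightarrow> nat"

fun aval :: "memory \<Rightarrow> aexp \<Rightarrow> nat" where
  "aval m (Num k) = k"
| "aval m (Cell x i) = m x (aval m i)"
| "aval m (Plus a b) = aval m a + aval m b"
| "aval m (Minus a b) = aval m a - aval m b"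
| "aval m (Div a b) = aval m a div aval m b"
| "aval m (Mod a b) = aval m a mod aval m b"

fun bval :: "memory \<Rightarrow> bexp \<Rightarrow> bool" where
  "bval m (Less a b) \<longleftrightarrow> aval m a < aval m b"
| "bval m (BNot b) \<longleftrightarrow> \<not> bval m b"
| "bval m (BAnd b c) \<longleftrightarrow> bval m b \<and> bval m c"

record state =
  mem :: memory
  steps :: nat
  queries :: nat

definition tick :: "nat \<Rightarrow> state \<Rightarrow> state" where
  "tick t \<sigma> = \<sigma>\<lparr>steps := steps \<sigma> + t\<rparr>"

definition count_query :: "state \<Rightarrow> state" where
  "count_query \<sigma> = \<sigma>\<lparr>queries := queries \<sigma> + 1\<rparr>"

definition store :: "string \<Rightarrow> aexp \<Rightarrow> nat \<Rightarrow> state \<Rightarrow> state" where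
  "store x i v \<sigma> = \<sigma>\<lparr>mem := (mem \<sigma>)(x := (mem \<sigma> x)(aval (mem \<sigma>) i := v))\<rparr>"

definition read_bits :: "nat \<Rightarrow> string \<Rightarrow> state \<Rightarrow> bool list" where
  "read_bits n y \<sigma> = map (\<lambda>j. mem \<sigma> y j \<noteq> 0) [0..<n]"

text \<open>
  \<open>exec n f c \<sigma> \<mu>\<close>: started in \<open>\<sigma>\<close> with the oracle \<open>f\<close> for a function of \<open>n\<close> variables, the program
  \<open>c\<close> halts for all outcomes of its coin flips, and \<open>\<mu>\<close> is the distribution of its final state.
  In the rules for sequences and loops, \<open>K\<close> maps each intermediate state to the distribution of
  the final states reached from there.
\<close>

inductive exec :: "nat \<Rightarrow> (bool list \<Rightarrow> bool) \<Rightarrow> com \<Rightarrow> state \<Rightarrow> state pmf \<Rightarrow> bool"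
  for n :: nat and f :: "bool list \<Rightarrow> bool" where
  Skip: "exec n f Skip \<sigma> (return_pmf (tick 1 \<sigma>))"
| Assign: "exec n f (Assign x i a) \<sigma> (return_pmf (tick 1 (store x i (aval (mem \<sigma>) a) \<sigma>)))"
| Flip: "exec n f (Flip x i) \<sigma>
           (map_pmf (\<lambda>b. tick 1 (store x i (of_bool b) \<sigma>)) (bernoulli_pmf (1/2)))"
| Query: "exec n f (Query x i y) \<sigma>
            (return_pmf (count_query (tick (n + 1) (store x i (of_bool (f (read_bits n y \<sigma>))) \<sigma>))))"
| Seq: "exec n f c \<sigma> \<mu> \<Longrightarrow> (\<And>\<sigma>'. \<sigma>' \<in> set_pmf \<mu> \<Longrightarrow> exec n f d \<sigma>' (K \<sigma>')) \<Longrightarrow>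
        exec n f (Seq c d) \<sigma> (bind_pmf \<mu> K)"
| CondTrue: "bval (mem \<sigma>) b \<Longrightarrow> exec n f c (tick 1 \<sigma>) \<mu> \<Longrightarrow> exec n f (Cond b c d) \<sigma> \<mu>"
| CondFalse: "\<not> bval (mem \<sigma>) b \<Longrightarrow> exec n f d (tick 1 \<sigma>) \<mu> \<Longrightarrow> exec n f (Cond b c d) \<sigma> \<mu>"
| WhileFalse: "\<not> bval (mem \<sigma>) b \<Longrightarrow> exec n f (While b c) \<sigma> (return_pmf (tick 1 \<sigma>))"
| WhileTrue: "bval (mem \<sigma>) b \<Longrightarrow> exec n f c (tick 1 \<sigma>) \<mu> \<Longrightarrow>
              (\<And>\<sigma>'. \<sigma>' \<in> set_pmf \<mu> \<Longrightarrow> exec n f (While b c) \<sigma>' (K \<sigma>')) \<Longrightarrow>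
              exec n f (While b c) \<sigma> (bind_pmf \<mu> K)"

inductive_cases SkipE: "exec n f Skip \<sigma> \<nu>"
inductive_cases AssignE: "exec n f (Assign x i a) \<sigma> \<nu>"
inductive_cases FlipE: "exec n f (Flip x i) \<sigma> \<nu>"
inductive_cases QueryE: "exec n f (Query x i y) \<sigma> \<nu>"
inductive_cases SeqE: "exec n f (Seq c d) \<sigma> \<nu>"
inductive_cases CondE: "exec n f (Cond b c d) \<sigma> \<nu>"
inductive_cases WhileE: "exec n f (While b c) \<sigma> \<nu>"

lemma exec_deterministic: "exec n f c \<sigma> \<mu> \<Longrightarrow> exec n f c \<sigma> \<nu> \<Longrightarrow> \<mu> = \<nu>"
proof (induction arbitrary: \<nu> rule: exec.induct)
  case (Seq c \<sigma> \<mu> d K)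
  from Seq.prems obtain \<mu>' K' where \<nu>: "\<nu> = bind_pmf \<mu>' K'" and c: "exec n f c \<sigma> \<mu>'"
    and d: "\<And>\<sigma>'. \<sigma>' \<in> set_pmf \<mu>' \<Longrightarrow> exec n f d \<sigma>' (K' \<sigma>')"
    by (elim SeqE) (rule that; blast)
  have eq: "\<mu> = \<mu>'"
    by (rule Seq.IH(1)[OF c])
  have "K \<sigma>' = K' \<sigma>'" if "\<sigma>' \<in> set_pmf \<mu>'" for \<sigma>'
    by (rule Seq.IH(2)[OF that[folded eq] d[OF that]])
  then show ?case
    unfolding \<nu> by (rule bind_pmf_cong[OF eq])
next
  case (WhileTrue \<sigma> b c \<mu> K)
  from WhileTrue.prems obtain \<mu>' K' where \<nu>: "\<nu> = bind_pmf \<mu>' K'"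
    and c: "exec n f c (tick 1 \<sigma>) \<mu>'"
    and d: "\<And>\<sigma>'. \<sigma>' \<in> set_pmf \<mu>' \<Longrightarrow> exec n f (While b c) \<sigma>' (K' \<sigma>')"
  proof (rule WhileE)
    assume "\<not> bval (mem \<sigma>) b"
    with WhileTrue.hyps(1) show thesis by contradiction
  next
    fix \<mu>' K'
    assume "\<nu> = bind_pmf \<mu>' K'" and "exec n f c (tick (Suc 0) \<sigma>) \<mu>'"
      and "\<And>\<sigma>'. \<sigma>' \<in> set_pmf \<mu>' \<Longrightarrow> exec n f (While b c) \<sigma>' (K' \<sigma>')"
    then show thesis by (rule that[unfolded One_nat_def])
  qed
  have eq: "\<mu> = \<mu>'"
    by (rule WhileTrue.IH(1)[OF c])
  have "K \<sigma>' = K' \<sigma>'" if "\<sigma>' \<in> set_pmf \<mu>'" for \<sigma>'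
    by (rule WhileTrue.IH(2)[OF that[folded eq] d[OF that]])
  then show ?case
    unfolding \<nu> by (rule bind_pmf_cong[OF eq])
next
  case (Skip \<sigma>)
  then show ?case by (rule SkipE) simp
next
  case (Assign x i a \<sigma>)
  then show ?case by (rule AssignE) simp
next
  case (Flip x i \<sigma>)
  then show ?case by (rule FlipE) simp
next
  case (Query x i y \<sigma>)
  then show ?case by (rule QueryE) simp
next
  case (CondTrue \<sigma> b c \<mu> d)
  from CondTrue.prems have "exec n f c (tick 1 \<sigma>) \<nu>"
    by (rule CondE) (use CondTrue.hyps(1) in simp_all)
  then show ?case by (rule CondTrue.IH)
next
  case (CondFalse \<sigma> b d \<mu> c)
  from CondFalse.prems have "exec n f d (tick 1 \<sigma>) \<nu>"
    by (rule CondE) (use CondFalse.hyps(1) in simp_all)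
  then show ?case by (rule CondFalse.IH)
next
  case (WhileFalse \<sigma> b c)
  from WhileFalse.prems show ?case
    by (rule WhileE) (use WhileFalse.hyps in simp_all)
qed

section \<open>Testers\<close>

text \<open>
  The program receives \<open>n\<close>, \<open>s\<close> and, in place of the real number \<open>\<epsilon>\<close>, the natural number
  $\lceil 1/\epsilon \rceil$, which fixes \<open>\<epsilon>\<close> up to a factor of two if \<open>\<epsilon> < 1\<close>, and which a program given
  a rational \<open>\<epsilon>\<close> could compute. It accepts by leaving a nonzero number in the cell 0 of \<open>out\<close>.
\<close>

definition init :: "nat \<Rightarrow> nat \<Rightarrow> real \<Rightarrow> state" where
  "init n s \<epsilon> = \<lparr>mem = (\<lambda>_ _. 0)(''n'' := (\<lambda>_. 0)(0 := n),
                                 ''s'' := (\<lambda>_. 0)(0 := s),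
                                 ''inv_eps'' := (\<lambda>_. 0)(0 := nat \<lceil>1 / \<epsilon>\<rceil>)),
                 steps = 0, queries = 0\<rparr>"

definition accepting :: "state set" where
  "accepting = {\<sigma>. mem \<sigma> ''out'' 0 \<noteq> 0}"

text \<open>The bounds \<open>t\<close> and \<open>q\<close> hold for every oracle and all outcomes of the coin flips.\<close>

definition two_sided_tester ::
  "com \<Rightarrow> nat \<Rightarrow> nat \<Rightarrow> real \<Rightarrow> (bool list \<Rightarrow> bool) set \<Rightarrow> real \<Rightarrow> real \<Rightarrow> bool" where
  "two_sided_tester P n s \<epsilon> C t q \<longleftrightarrow>
     (\<forall>f. \<exists>\<mu>. exec n f P (init n s \<epsilon>) \<mu> \<and>
        (f \<in> C \<longrightarrow> measure_pmf.prob \<mu> accepting \<ge> 2/3) \<and>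
        (eps_far n \<epsilon> f C \<longrightarrow> measure_pmf.prob \<mu> (- accepting) \<ge> 2/3) \<and>
        (\<forall>\<sigma>\<in>set_pmf \<mu>. real (steps \<sigma>) \<le> t \<and> real (queries \<sigma>) \<le> q))"

end

theory Submission
  imports Defs
begin

text \<open>
  The variables are hashed into a number of blocks polynomial in \<open>s / \<epsilon>\<close>, so that the variables of
  the short terms of a monotone DNF \<open>f\<close> land in different blocks and the number of queries does not
  depend on \<open>n\<close>. The terms, as sets of blocks, are learned from uniformly random assignments to the
  blocks: a satisfying assignment that satisfies no known term is shrunk to a new minimal one by
  binary search.

  For a learned term \<open>T\<close> and a block \<open>j \<in> T\<close>, setting the other blocks as in \<open>T\<close> leaves a function
  \<open>\<phi>\<close> of block \<open>j\<close>, which is a variable if \<open>f\<close> is in the class. It is enough to test with constant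
  accuracy that \<open>\<phi>\<close> is a variable: then self-correction decodes \<open>\<phi>\<close> to a variable everywhere, and a
  point \<open>x\<close> at which \<open>\<phi>\<close> differs from it fails most linearity tests. So if \<open>f\<close> passes, it agrees
  at random points with a monotone DNF in the decoded variables.

  All coins are flipped in advance, so that the rest of the program is deterministic and the
  probabilities concern a function of the coins.
\<close>

section \<open>Structured programs\<close>

text \<open>Testing each of the up to \<open>s * L\<close> literals to accuracy of order \<epsilon>
  / s would cost about s / \<epsilon> queries apiece. Instead, the values of the literals are
  certified only at the random points x where they are used. A wrong value there survives
  \<open>K\<close> fresh linearity checks with probability at most 50^-K, so a logarithmic
  \<open>K\<close> beats the union bound over all literals. A row then costs s times a
  polylogarithm, and O(1 / \<epsilon>) rows suffice.

  Soundness takes the learned sets as arbitrary: at most \<open>s\<close> sets of at most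
  \<open>L\<close> blocks each. Completeness must cope with what learning misses. Terms of more than
  \<open>L\<close> variables are given up, since random points rarely satisfy them, and the short
  terms that stay unlearned carry little weight among random block assignments. This weight carries
  over to uniform inputs: a hash that is injective on the relevant variables gives them independent
  uniform values too. The failure probabilities are 1/12 for the hash, 1/6 for learning and 1/12 for
  testing, 1/3 in all. For \<epsilon> \<ge> 1 no query is made, as no function is that far from both
  constants.\<close>

datatype prog =
    Nop
  | Set string aexp aexp
  | Ask string aexp string
  | Then prog prog (infixr ";;" 60)
  | If bexp prog prog
  | For string string prog

abbreviation V :: "string \<Rightarrow> aexp" where
  "V x \<equiv> Cell x (Num 0)"

primrec compile :: "prog \<Rightarrow> com" where
  "compile Nop = Skip"
| "compile (Set x i a) = Assign x i a"
| "compile (Ask x i y) = Query x i y"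
| "compile (p ;; q) = Seq (compile p) (compile q)"
| "compile (If b p q) = Cond b (compile p) (compile q)"
| "compile (For x v p) =
     Seq (Assign x (Num 0) (Num 0))
       (While (Less (V x) (V v)) (Seq (compile p) (Assign x (Num 0) (Plus (V x) (Num 1)))))"

definition put :: "memory \<Rightarrow> string \<Rightarrow> nat \<Rightarrow> nat \<Rightarrow> memory" where
  "put m x i v = m(x := (m x)(i := v))"

lemma put_apply: "put m x i v y j = (if y = x \<and> j = i then v else m y j)"
  by (simp add: put_def)

lemma put_row: "y \<noteq> x \<Longrightarrow> put m x i v y = m y"
  by (simp add: put_def)

text \<open>The counter \<open>x\<close> is set anew before each iteration, whatever \<open>F\<close> did to it.\<close>

primrec loop :: "(memory \<Rightarrow> memory) \<Rightarrow> string \<Rightarrow> memory \<Rightarrow> nat \<Rightarrow> memory" where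
  "loop F x m 0 = m"
| "loop F x m (Suc i) = F (put (loop F x m i) x 0 i)"

text \<open>No coin is flipped and the number of iterations of a loop is fixed on entry, so the
  meaning of a program is a total function of the memory and termination needs no separate
  argument.\<close>

primrec ev :: "nat \<Rightarrow> (bool list \<Rightarrow> bool) \<Rightarrow> prog \<Rightarrow> memory \<Rightarrow> memory" where
  "ev n f Nop m = m"
| "ev n f (Set x i a) m = put m x (aval m i) (aval m a)"
| "ev n f (Ask x i y) m = put m x (aval m i) (of_bool (f (map (\<lambda>j. m y j \<noteq> 0) [0..<n])))"
| "ev n f (p ;; q) m = ev n f q (ev n f p m)"
| "ev n f (If b p q) m = (if bval m b then ev n f p m else ev n f q m)"
| "ev n f (For x v p) m = put (loop (ev n f p) x m (m v 0)) x 0 (m v 0)"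

primrec qc :: "nat \<Rightarrow> (bool list \<Rightarrow> bool) \<Rightarrow> prog \<Rightarrow> memory \<Rightarrow> nat" where
  "qc n f Nop m = 0"
| "qc n f (Set x i a) m = 0"
| "qc n f (Ask x i y) m = 1"
| "qc n f (p ;; q) m = qc n f p m + qc n f q (ev n f p m)"
| "qc n f (If b p q) m = (if bval m b then qc n f p m else qc n f q m)"
| "qc n f (For x v p) m = (\<Sum>i<m v 0. qc n f p (put (loop (ev n f p) x m i) x 0 i))"

primrec mods :: "prog \<Rightarrow> string set" where
  "mods Nop = {}"
| "mods (Set x i a) = {x}"
| "mods (Ask x i y) = {x}"
| "mods (p ;; q) = mods p \<union> mods q"
| "mods (If b p q) = mods p \<union> mods q"
| "mods (For x v p) = insert x (mods p)"

primrec bounds :: "prog \<Rightarrow> string set" where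
  "bounds Nop = {}"
| "bounds (Set x i a) = {}"
| "bounds (Ask x i y) = {}"
| "bounds (p ;; q) = bounds p \<union> bounds q"
| "bounds (If b p q) = bounds p \<union> bounds q"
| "bounds (For x v p) = insert v (bounds p)"

text \<open>A body that touches neither counter nor bound makes the compiled \<open>While\<close>
  perform exactly the iterations that \<open>loop\<close> counts.\<close>

primrec wf_prog :: "prog \<Rightarrow> bool" where
  "wf_prog Nop = True"
| "wf_prog (Set x i a) = True"
| "wf_prog (Ask x i y) = True"
| "wf_prog (p ;; q) = (wf_prog p \<and> wf_prog q)"
| "wf_prog (If b p q) = (wf_prog p \<and> wf_prog q)"
| "wf_prog (For x v p) = (x \<noteq> v \<and> x \<notin> mods p \<and> v \<notin> mods p \<and> wf_prog p)"

text \<open>\<open>Z\<close> stands for a common bound on \<open>n\<close> and on all loop bounds.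
  Besides its body, an iteration pays for the guard and the increment, and a loop for its
  initialization and its last guard.\<close>

primrec time :: "nat \<Rightarrow> prog \<Rightarrow> nat" where
  "time Z Nop = 1"
| "time Z (Set x i a) = 1"
| "time Z (Ask x i y) = Z + 1"
| "time Z (p ;; q) = time Z p + time Z q"
| "time Z (If b p q) = 1 + time Z p + time Z q"
| "time Z (For x v p) = 2 + Z * (time Z p + 2)"

lemma loop_frame:
  assumes "\<And>m. F m y = m y" "y \<noteq> x"
  shows "loop F x m i y = m y"
  by (induction i) (use assms in \<open>simp_all add: put_row\<close>)

lemma ev_frame: "y \<notin> mods p \<Longrightarrow> ev n f p m y = m y"
  by (induction p arbitrary: m) (auto simp: put_row loop_frame)

text \<open>Each loop contributes a factor \<open>Z\<close>, and the program is fixed, so the degree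
  is a constant. In a sequence \<open>d + d'\<close> serves as a common exponent for both
  bounds.\<close>

lemma time_polynomial: "\<exists>C d. \<forall>Z. time Z p \<le> C * (Z + 1) ^ d"
proof (induction p)
  case Nop
  have "time Z Nop \<le> 1 * (Z + 1) ^ 0" for Z by simp
  then show ?case by blast
next
  case (Set x i a)
  have "time Z (Set x i a) \<le> 1 * (Z + 1) ^ 0" for Z by simp
  then show ?case by blast
next
  case (Ask x i y)
  have "time Z (Ask x i y) \<le> 1 * (Z + 1) ^ 1" for Z by simp
  then show ?case by blast
next
  case (Then p q)
  then obtain C d C' d' where *: "\<And>Z. time Z p \<le> C * (Z + 1) ^ d" "\<And>Z. time Z q \<le> C' * (Z + 1) ^ d'"
    by blast
  have "time Z (p ;; q) \<le> (C + C') * (Z + 1) ^ (d + d')" for Z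
  proof -
    have "C * (Z + 1) ^ d \<le> C * (Z + 1) ^ (d + d')" "C' * (Z + 1) ^ d' \<le> C' * (Z + 1) ^ (d + d')"
      by (intro mult_left_mono power_increasing; simp)+
    then show ?thesis using *[of Z] unfolding time.simps add_mult_distrib by linarith
  qed
  then show ?case by blast
next
  case (If b p q)
  then obtain C d C' d' where *: "\<And>Z. time Z p \<le> C * (Z + 1) ^ d" "\<And>Z. time Z q \<le> C' * (Z + 1) ^ d'"
    by blast
  have "time Z (If b p q) \<le> (1 + C + C') * (Z + 1) ^ (d + d')" for Z
  proof -
    have "C * (Z + 1) ^ d \<le> C * (Z + 1) ^ (d + d')" "C' * (Z + 1) ^ d' \<le> C' * (Z + 1) ^ (d + d')"
      "1 \<le> (Z + 1) ^ (d + d')"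
      by (intro mult_left_mono power_increasing one_le_power; simp)+
    then show ?thesis using *[of Z] unfolding time.simps add_mult_distrib by linarith
  qed
  then show ?case by blast
next
  case (For x v p)
  then obtain C d where *: "\<And>Z. time Z p \<le> C * (Z + 1) ^ d"
    by blast
  have "time Z (For x v p) \<le> (C + 4) * (Z + 1) ^ (d + 1)" for Z
  proof -
    have 1: "1 \<le> (Z + 1) ^ d" by simp
    have "Z * (time Z p + 2) \<le> (Z + 1) * (C * (Z + 1) ^ d + 2 * (Z + 1) ^ d)"
      by (intro mult_mono add_mono) (use *[of Z] 1 in auto)
    moreover have "2 * 1 \<le> 2 * (Z + 1) ^ (d + 1)"
      by (intro mult_left_mono one_le_power) auto
    ultimately show ?thesis by (simp add: algebra_simps)
  qed
  then show ?case by blast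
qed

text \<open>A normal form for \<open>tick\<close>, \<open>store\<close> and
  \<open>count_query\<close>: successive updates collapse into one, with their counters
  added.\<close>

definition advance :: "memory \<Rightarrow> nat \<Rightarrow> nat \<Rightarrow> state \<Rightarrow> state" where
  "advance m t q \<sigma> = \<sigma>\<lparr>mem := m, steps := steps \<sigma> + t, queries := queries \<sigma> + q\<rparr>"

lemma advance_simps [simp]:
  "mem (advance m t q \<sigma>) = m" "steps (advance m t q \<sigma>) = steps \<sigma> + t"
  "queries (advance m t q \<sigma>) = queries \<sigma> + q"
  "advance m t q (advance m' t' q' \<sigma>) = advance m (t' + t) (q' + q) \<sigma>"
  by (simp_all add: advance_def)

lemma tick_advance: "tick t \<sigma> = advance (mem \<sigma>) t 0 \<sigma>"
  by (simp add: tick_def advance_def)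

lemma store_advance: "store x i v \<sigma> = advance (put (mem \<sigma>) x (aval (mem \<sigma>) i) v) 0 0 \<sigma>"
  by (simp add: store_def advance_def put_def)

lemma count_query_advance: "count_query \<sigma> = advance (mem \<sigma>) 0 1 \<sigma>"
  by (simp add: count_query_def advance_def)

lemmas advance_intros = tick_advance store_advance count_query_advance

lemma exec_Seq_det:
  "exec n f c \<sigma> (return_pmf \<sigma>') \<Longrightarrow> exec n f d \<sigma>' \<mu> \<Longrightarrow> exec n f (Seq c d) \<sigma> \<mu>"
  using exec.Seq[of n f c \<sigma> "return_pmf \<sigma>'" d "\<lambda>_. \<mu>"] by (simp add: bind_return_pmf)

lemma exec_While_det:
  "bval (mem \<sigma>) b \<Longrightarrow> exec n f c (tick 1 \<sigma>) (return_pmf \<sigma>') \<Longrightarrow> exec n f (While b c) \<sigma>' \<mu> \<Longrightarrow>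
   exec n f (While b c) \<sigma> \<mu>"
  using exec.WhileTrue[of \<sigma> b n f c "return_pmf \<sigma>'" "\<lambda>_. \<mu>"] by (simp add: bind_return_pmf)

text \<open>Queries are counted exactly, time is only bounded. As no loop bound is ever assigned,
  \<open>Z\<close> bounds all of them throughout the run, also when inner loops are entered
  again.\<close>

lemma exec_compile:
  assumes "wf_prog p" "bounds p \<inter> mods p = {}" "\<And>v. v \<in> bounds p \<Longrightarrow> mem \<sigma> v 0 \<le> Z" "n \<le> Z"
  shows "\<exists>t\<le>time Z p. exec n f (compile p) \<sigma> (return_pmf (advance (ev n f p (mem \<sigma>)) t (qc n f p (mem \<sigma>)) \<sigma>))"
  using assms
proof (induction p arbitrary: \<sigma>)
  case Nop
  show ?case using exec.Skip[of n f \<sigma>] by (auto simp: advance_intros)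
next
  case (Set x i a)
  show ?case using exec.Assign[of n f x i a \<sigma>] by (auto simp: advance_intros)
next
  case (Ask x i y)
  show ?case using exec.Query[of n f x i y \<sigma>] Ask.prems
    by (intro exI[of _ "n + 1"]) (auto simp: advance_intros read_bits_def)
next
  case (Then p q)
  have "\<exists>t\<le>time Z p. exec n f (compile p) \<sigma> (return_pmf (advance (ev n f p (mem \<sigma>)) t (qc n f p (mem \<sigma>)) \<sigma>))"
    using Then.prems by (intro Then.IH) auto
  then obtain t where t: "t \<le> time Z p"
    "exec n f (compile p) \<sigma> (return_pmf (advance (ev n f p (mem \<sigma>)) t (qc n f p (mem \<sigma>)) \<sigma>))" (is "exec _ _ _ _ (return_pmf ?\<sigma>)")
    by blast
  have "\<exists>t\<le>time Z q. exec n f (compile q) ?\<sigma> (return_pmf (advance (ev n f q (mem ?\<sigma>)) t (qc n f q (mem ?\<sigma>)) ?\<sigma>))"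
  proof (rule Then.IH)
    show "mem ?\<sigma> v 0 \<le> Z" if "v \<in> bounds q" for v
    proof -
      have "v \<notin> mods p" using that Then.prems(2) by auto
      then show ?thesis using that Then.prems(3)[of v] by (simp add: ev_frame)
    qed
  qed (use Then.prems in auto)
  then obtain t' where t': "t' \<le> time Z q"
    "exec n f (compile q) ?\<sigma> (return_pmf (advance (ev n f q (mem ?\<sigma>)) t' (qc n f q (mem ?\<sigma>)) ?\<sigma>))"
    by blast
  show ?case using exec_Seq_det[OF t(2) t'(2)] t(1) t'(1)
    by (intro exI[of _ "t + t'"]) simp
next
  case (If b p q)
  show ?case
  proof (cases "bval (mem \<sigma>) b")
    case True
    have "\<exists>t\<le>time Z p. exec n f (compile p) (tick 1 \<sigma>) (return_pmf (advance (ev n f p (mem (tick 1 \<sigma>))) t (qc n f p (mem (tick 1 \<sigma>))) (tick 1 \<sigma>)))"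
      using If.prems by (intro If.IH) (auto simp: tick_advance)
    then obtain t where t: "t \<le> time Z p"
      "exec n f (compile p) (tick 1 \<sigma>) (return_pmf (advance (ev n f p (mem \<sigma>)) (1 + t) (qc n f p (mem \<sigma>)) \<sigma>))"
      by (auto simp: tick_advance)
    show ?thesis using exec.CondTrue[OF True t(2)] t(1) True
      by (intro exI[of _ "1 + t"]) simp
  next
    case False
    have "\<exists>t\<le>time Z q. exec n f (compile q) (tick 1 \<sigma>) (return_pmf (advance (ev n f q (mem (tick 1 \<sigma>))) t (qc n f q (mem (tick 1 \<sigma>))) (tick 1 \<sigma>)))"
      using If.prems by (intro If.IH) (auto simp: tick_advance)
    then obtain t where t: "t \<le> time Z q"
      "exec n f (compile q) (tick 1 \<sigma>) (return_pmf (advance (ev n f q (mem \<sigma>)) (1 + t) (qc n f q (mem \<sigma>)) \<sigma>))"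
      by (auto simp: tick_advance)
    show ?thesis using exec.CondFalse[OF False t(2)] t(1) False
      by (intro exI[of _ "1 + t"]) simp
  qed
next
  case (For x v p)
  let ?m = "mem \<sigma>"
  let ?N = "?m v 0"
  let ?l = "\<lambda>i. put (loop (ev n f p) x ?m i) x 0 i"
  let ?W = "While (Less (V x) (V v)) (Seq (compile p) (Assign x (Num 0) (Plus (V x) (Num 1))))"
  have xv: "x \<noteq> v" "x \<notin> mods p" "v \<notin> mods p" and wf: "wf_prog p" using For.prems by auto
  have frame: "?l i y = ?m y" if "y \<notin> mods p" "y \<noteq> x" for i y
    using that by (simp add: put_row loop_frame ev_frame)
  have lv: "?l i v 0 = ?N" and lx: "?l i x 0 = i" for i
    using frame[of v i] xv by (auto simp: put_apply)
  have N: "?N \<le> Z" using For.prems(3) by simp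
  \<comment> \<open>Induction on the number \<open>d\<close> of iterations left: the
    \<open>While\<close> rule peels off the first iteration, whereas \<open>loop\<close> is defined
    by its last.\<close>
  have W: "\<exists>t\<le>1 + d * (time Z p + 2). exec n f ?W \<tau>
        (return_pmf (advance (?l ?N) t (\<Sum>i=?N - d..<?N. qc n f p (?l i)) \<tau>))"
    if "d \<le> ?N" "mem \<tau> = ?l (?N - d)" for d \<tau>
    using that
  proof (induction d arbitrary: \<tau>)
    case 0
    have "\<not> bval (mem \<tau>) (Less (V x) (V v))"
      using 0 by (simp add: lv lx)
    from exec.WhileFalse[OF this] show ?case
      using 0 by (intro exI[of _ 1]) (simp add: tick_advance)
  next
    case (Suc d)
    define i where "i = ?N - Suc d"
    have i: "i < ?N" "?N - d = Suc i" using Suc.prems by (auto simp: i_def)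
    have m: "mem \<tau> = ?l i" using Suc.prems by (simp add: i_def)
    have b: "bval (mem \<tau>) (Less (V x) (V v))"
      using i by (simp add: m lv lx)
    have "\<exists>t\<le>time Z p. exec n f (compile p) (tick 1 \<tau>)
        (return_pmf (advance (ev n f p (mem (tick 1 \<tau>))) t (qc n f p (mem (tick 1 \<tau>))) (tick 1 \<tau>)))"
    proof (rule For.IH)
      show "mem (tick 1 \<tau>) w 0 \<le> Z" if "w \<in> bounds p" for w
      proof -
        have "w \<notin> mods p" "w \<noteq> x" using that For.prems(2) by auto
        then have "mem (tick 1 \<tau>) w = ?m w" using frame m by (simp add: tick_advance)
        then show ?thesis using For.prems(3)[of w] that by simp
      qed
    qed (use For.prems in auto)
    then obtain t where t: "t \<le> time Z p"
      "exec n f (compile p) (tick 1 \<tau>) (return_pmf (advance (loop (ev n f p) x ?m (Suc i)) (1 + t) (qc n f p (?l i)) \<tau>))"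
      (is "exec _ _ _ _ (return_pmf ?\<tau>)")
      by (auto simp: tick_advance m)
    have "exec n f (Assign x (Num 0) (Plus (V x) (Num 1))) ?\<tau>
        (return_pmf (advance (?l (Suc i)) (t + 2) (qc n f p (?l i)) \<tau>))"
    proof -
      have "loop (ev n f p) x ?m (Suc i) x 0 = i"
        using xv(2) by (simp add: ev_frame put_apply)
      then show ?thesis
        using exec.Assign[of n f x "Num 0" "Plus (V x) (Num 1)" ?\<tau>]
        by (simp add: advance_intros del: loop.simps)
    qed
    from exec_Seq_det[OF t(2) this] have body: "exec n f (Seq (compile p) (Assign x (Num 0) (Plus (V x) (Num 1)))) (tick 1 \<tau>)
        (return_pmf (advance (?l (Suc i)) (t + 2) (qc n f p (?l i)) \<tau>))" (is "exec _ _ _ _ (return_pmf ?\<rho>)") .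
    have "\<exists>t\<le>1 + d * (time Z p + 2). exec n f ?W ?\<rho>
        (return_pmf (advance (?l ?N) t (\<Sum>i=?N - d..<?N. qc n f p (?l i)) ?\<rho>))"
      using Suc.prems i by (intro Suc.IH) auto
    then obtain t' where t': "t' \<le> 1 + d * (time Z p + 2)" "exec n f ?W ?\<rho>
        (return_pmf (advance (?l ?N) t' (\<Sum>i=?N - d..<?N. qc n f p (?l i)) ?\<rho>))"
      by blast
    have "(\<Sum>i=?N - Suc d..<?N. qc n f p (?l i)) = qc n f p (?l i) + (\<Sum>i=?N - d..<?N. qc n f p (?l i))"
      using i by (simp add: i_def[symmetric] sum.atLeast_Suc_lessThan)
    then show ?case using exec_While_det[OF b body t'(2)] t(1) t'(1)
      by (intro exI[of _ "t + 2 + t'"]) simp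
  qed
  have init: "exec n f (Assign x (Num 0) (Num 0)) \<sigma> (return_pmf (advance (?l 0) 1 0 \<sigma>))"
    using exec.Assign[of n f x "Num 0" "Num 0" \<sigma>] by (simp add: advance_intros)
  from W[of ?N "advance (?l 0) 1 0 \<sigma>"] obtain t where t: "t \<le> 1 + ?N * (time Z p + 2)"
    "exec n f ?W (advance (?l 0) 1 0 \<sigma>) (return_pmf (advance (?l ?N) (1 + t) (\<Sum>i<?N. qc n f p (?l i)) \<sigma>))"
    by (auto simp: lessThan_atLeast0)
  have "1 + t \<le> 2 + Z * (time Z p + 2)"
    using t(1) mult_right_mono[OF N, of "time Z p + 2"] by linarith
  then show ?case using exec_Seq_det[OF init t(2)]
    by (intro exI[of _ "1 + t"]) simp
qed

section \<open>Probabilities\<close>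

abbreviation Pr :: "'a pmf \<Rightarrow> ('a \<Rightarrow> bool) \<Rightarrow> real" where
  "Pr M P \<equiv> measure_pmf.prob M {x. P x}"

abbreviation U :: "nat \<Rightarrow> bool list pmf" where
  "U n \<equiv> pmf_of_set (cube n)"

lemma cube_eq_lists: "cube n = {x. set x \<subseteq> UNIV \<and> length x = n}"
  by (simp add: cube_def)

lemma finite_cube [simp]: "finite (cube n)"
  unfolding cube_eq_lists by (rule finite_lists_length_eq) simp

lemma card_cube: "card (cube n) = 2 ^ n"
  unfolding cube_eq_lists by (subst card_lists_length_eq) simp_all

lemma cube_nonempty [simp]: "cube n \<noteq> {}"
proof -
  have "replicate n False \<in> cube n" by (simp add: cube_def)
  then show ?thesis by blast
qed

lemma Pr_mono: "(\<And>x. x \<in> set_pmf M \<Longrightarrow> P x \<Longrightarrow> Q x) \<Longrightarrow> Pr M P \<le> Pr M Q"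
  by (rule measure_pmf.finite_measure_mono_AE) (auto simp: AE_measure_pmf_iff)

lemma Pr_disj:
  assumes "\<And>x. x \<in> set_pmf M \<Longrightarrow> P x \<Longrightarrow> Q x \<or> R x"
  shows "Pr M P \<le> Pr M Q + Pr M R"
proof -
  have "Pr M P \<le> measure_pmf.prob M ({x. Q x} \<union> {x. R x})"
    by (rule measure_pmf.finite_measure_mono_AE) (use assms in \<open>auto simp: AE_measure_pmf_iff\<close>)
  also have "\<dots> \<le> Pr M Q + Pr M R"
    by (rule measure_Un_le) auto
  finally show ?thesis .
qed

lemma Pr_Bex:
  assumes "finite I" "\<And>x. x \<in> set_pmf M \<Longrightarrow> P x \<Longrightarrow> \<exists>i\<in>I. Q i x"
  shows "Pr M P \<le> (\<Sum>i\<in>I. Pr M (Q i))"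
proof -
  have "Pr M P \<le> Pr M (\<lambda>x. \<exists>i\<in>I. Q i x)"
    using assms(2) by (rule Pr_mono)
  also have "{x. \<exists>i\<in>I. Q i x} = (\<Union>i\<in>I. {x. Q i x})" by auto
  also have "measure_pmf.prob M \<dots> \<le> (\<Sum>i\<in>I. Pr M (Q i))"
    by (rule measure_pmf.finite_measure_subadditive_finite) (use assms(1) in auto)
  finally show ?thesis .
qed

lemma Pr_Bex_le:
  assumes "finite I" "\<And>x. x \<in> set_pmf M \<Longrightarrow> P x \<Longrightarrow> \<exists>i\<in>I. Q i x"
    and "\<And>i. i \<in> I \<Longrightarrow> Pr M (Q i) \<le> q" and "real (card I) \<le> c" and "0 \<le> q"
  shows "Pr M P \<le> c * q"
proof -
  have "Pr M P \<le> (\<Sum>i\<in>I. Pr M (Q i))"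
    by (rule Pr_Bex) (use assms in auto)
  also have "\<dots> \<le> real (card I) * q"
    using assms(3) by (rule sum_bounded_above)
  also have "\<dots> \<le> c * q"
    using assms(4,5) by (rule mult_right_mono)
  finally show ?thesis .
qed

lemma Pr_not: "Pr M (\<lambda>x. \<not> P x) = 1 - Pr M P"
  using measure_pmf.prob_compl[of "{x. P x}" M] by (simp add: Compl_eq_Diff_UNIV[symmetric] Collect_neg_eq)

lemma Pr_map: "Pr (map_pmf g M) P = Pr M (\<lambda>x. P (g x))"
  by simp

text \<open>Outcomes of the first stage outside \<open>G\<close> are charged in full, all others by
  the conditional bound \<open>b\<close>. This is how good early coins are combined with fresh later
  ones.\<close>

lemma Pr_bind_le:
  assumes "Pr M (\<lambda>x. \<not> G x) \<le> a" "0 \<le> b"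
    and "\<And>x. x \<in> set_pmf M \<Longrightarrow> G x \<Longrightarrow> Pr (K x) P \<le> b"
  shows "Pr (bind_pmf M K) P \<le> a + b"
proof -
  have a: "0 \<le> a" using assms(1) measure_nonneg order_trans by blast
  have "emeasure (bind_pmf M K) {x. P x} = (\<integral>\<^sup>+x. emeasure (K x) {x. P x} \<partial>M)"
    by simp
  also have "\<dots> \<le> (\<integral>\<^sup>+x. indicator {x. \<not> G x} x + ennreal b \<partial>M)"
  proof (rule nn_integral_mono_AE, unfold AE_measure_pmf_iff, intro ballI)
    fix x assume x: "x \<in> set_pmf M"
    show "emeasure (K x) {x. P x} \<le> indicator {x. \<not> G x} x + ennreal b"
    proof (cases "G x")
      case True
      then show ?thesis using assms(3)[OF x] assms(2)
        by (simp add: measure_pmf.emeasure_eq_measure)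
    next
      case False
      have "emeasure (K x) {x. P x} \<le> 1" by (rule measure_pmf.emeasure_le_1)
      also have "\<dots> \<le> 1 + ennreal b" by simp
      finally show ?thesis using False by simp
    qed
  qed
  also have "\<dots> = emeasure M {x. \<not> G x} + ennreal b"
    by (subst nn_integral_add) auto
  also have "\<dots> \<le> ennreal a + ennreal b"
    using assms(1) a by (intro add_right_mono) (simp add: measure_pmf.emeasure_eq_measure)
  also have "\<dots> = ennreal (a + b)" using a assms(2) by simp
  finally show ?thesis using a assms(2)
    by (simp add: measure_pmf.emeasure_eq_measure del: ennreal_plus)
qed

lemma Pr_pair_le:
  assumes "0 \<le> b" "\<And>x. x \<in> set_pmf A \<Longrightarrow> Pr B (Q x) \<le> b"
  shows "Pr (pair_pmf A B) (\<lambda>(x, y). Q x y) \<le> b"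
proof -
  have "Pr (pair_pmf A B) (\<lambda>(x, y). Q x y) \<le> 0 + b"
    unfolding pair_pmf_def
  proof (rule Pr_bind_le[where G = "\<lambda>_. True"])
    fix x assume "x \<in> set_pmf A"
    then show "Pr (bind_pmf B (\<lambda>y. return_pmf (x, y))) (\<lambda>(x, y). Q x y) \<le> b"
      using assms(2)[of x] by (simp add: map_pmf_def[symmetric])
  qed (use assms(1) in auto)
  then show ?thesis by simp
qed

lemma Pr_bij:
  assumes "bij_betw T A A" "A \<noteq> {}" "finite A"
  shows "Pr (pmf_of_set A) (\<lambda>x. P (T x)) = Pr (pmf_of_set A) P"
proof -
  have "Pr (pmf_of_set A) P = Pr (map_pmf T (pmf_of_set A)) P"
    by (simp add: map_pmf_of_set_bij_betw[OF assms])
  then show ?thesis by simp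
qed

lemma Pr_fst: "Pr (pair_pmf A B) (\<lambda>(x, y). P x) = Pr A P"
proof -
  have "Pr A P = Pr (map_pmf fst (pair_pmf A B)) P"
    by (simp only: map_fst_pair_pmf)
  then show ?thesis by (simp add: case_prod_beta')
qed

lemma Pr_snd: "Pr (pair_pmf A B) (\<lambda>(x, y). P y) = Pr B P"
proof -
  have "Pr B P = Pr (map_pmf snd (pair_pmf A B)) P"
    by (simp only: map_snd_pair_pmf)
  then show ?thesis by (simp add: case_prod_beta')
qed

lemma Pr_skip_mid: "Pr (pair_pmf A (pair_pmf B C)) (\<lambda>(x, y, z). P x z) = Pr (pair_pmf A C) (\<lambda>(x, z). P x z)"
proof -
  have "pair_pmf A C = pair_pmf A (map_pmf snd (pair_pmf B C))"
    by (simp only: map_snd_pair_pmf)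
  also have "\<dots> = map_pmf (apsnd snd) (pair_pmf A (pair_pmf B C))"
    by (rule pair_map_pmf2)
  finally have "Pr (pair_pmf A C) (\<lambda>(x, z). P x z) =
      Pr (map_pmf (apsnd snd) (pair_pmf A (pair_pmf B C))) (\<lambda>(x, z). P x z)"
    by simp
  then show ?thesis by (simp add: case_prod_beta')
qed

lemma Pr_product: 
  fixes A :: "'a::countable pmf" and B :: "'b::countable pmf"
  shows "Pr (pair_pmf A B) (\<lambda>(x, y). P x \<and> Q y) = Pr A P * Pr B Q"
proof -
  have "{(x, y). P x \<and> Q y} = {x. P x} \<times> {y. Q y}" by auto
  then show ?thesis using measure_pmf_prob_product[of "{x. P x}" "{y. Q y}" A B] by simp
qed

section \<open>Testing dictators\<close>

definition xr :: "bool list \<Rightarrow> bool list \<Rightarrow> bool list" where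
  "xr a b = map2 (\<noteq>) a b"

definition an :: "bool list \<Rightarrow> bool list \<Rightarrow> bool list" where
  "an a b = map2 (\<and>) a b"

lemma in_cube: "x \<in> cube n \<longleftrightarrow> length x = n"
  by (simp add: cube_def)

lemma set_U [simp]: "set_pmf (U n) = cube n"
  by simp

lemma length_xr [simp]: "length (xr a b) = min (length a) (length b)"
  by (simp add: xr_def)

lemma length_an [simp]: "length (an a b) = min (length a) (length b)"
  by (simp add: an_def)

lemma nth_xr: "i < length a \<Longrightarrow> i < length b \<Longrightarrow> xr a b ! i \<longleftrightarrow> a ! i \<noteq> b ! i"
  by (simp add: xr_def)

lemma nth_an: "i < length a \<Longrightarrow> i < length b \<Longrightarrow> an a b ! i \<longleftrightarrow> a ! i \<and> b ! i"
  by (simp add: an_def)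

lemma xr_cube [simp]: "a \<in> cube n \<Longrightarrow> b \<in> cube n \<Longrightarrow> xr a b \<in> cube n"
  by (simp add: cube_def)

lemma an_cube [simp]: "a \<in> cube n \<Longrightarrow> b \<in> cube n \<Longrightarrow> an a b \<in> cube n"
  by (simp add: cube_def)

lemma cube_eqI: "a \<in> cube n \<Longrightarrow> b \<in> cube n \<Longrightarrow> (\<And>i. i < n \<Longrightarrow> a ! i = b ! i) \<Longrightarrow> a = b"
  by (simp add: cube_def nth_equalityI)

lemma xr_xr: "a \<in> cube n \<Longrightarrow> b \<in> cube n \<Longrightarrow> xr (xr a b) b = a"
  by (rule cube_eqI[of _ n]) (auto simp: in_cube nth_xr)

lemma bij_xr: "a \<in> cube n \<Longrightarrow> bij_betw (\<lambda>b. xr b a) (cube n) (cube n)"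
  by (rule bij_betw_byWitness[where f' = "\<lambda>b. xr b a"]) (auto simp: xr_xr)

lemma Pr_xr: "a \<in> cube n \<Longrightarrow> Pr (U n) (\<lambda>b. P (xr b a)) = Pr (U n) P"
  by (rule Pr_bij[OF bij_xr]) auto

lemma pair_U: "pair_pmf (U n) (U m) = pmf_of_set (cube n \<times> cube m)"
proof (rule pmf_eqI)
  fix z :: "bool list \<times> bool list"
  show "pmf (pair_pmf (U n) (U m)) z = pmf (pmf_of_set (cube n \<times> cube m)) z"
    by (cases z) (auto simp: pmf_pair indicator_def card_cartesian_product)
qed

lemma Pr_pair_bij:
  assumes "bij_betw S (cube n) (cube n)" "bij_betw T (cube m) (cube m)"
  shows "Pr (pair_pmf (U n) (U m)) (\<lambda>(x, y). P (S x) (T y)) = Pr (pair_pmf (U n) (U m)) (\<lambda>(x, y). P x y)"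
proof -
  have "bij_betw (map_prod S T) (cube n \<times> cube m) (cube n \<times> cube m)"
    using assms by (simp add: bij_betw_map_prod)
  from Pr_bij[OF this, of "\<lambda>(x, y). P x y"] show ?thesis
    by (simp add: pair_U case_prod_beta')
qed

definition unit_vec :: "nat \<Rightarrow> nat \<Rightarrow> bool list" where
  "unit_vec n i = map (\<lambda>j. j = i) [0..<n]"

abbreviation ones :: "nat \<Rightarrow> bool list" where
  "ones n \<equiv> replicate n True"

lemma unit_vec_cube [simp]: "unit_vec n i \<in> cube n"
  by (simp add: unit_vec_def cube_def)

lemma ones_cube [simp]: "ones n \<in> cube n"
  by (simp add: cube_def)

lemma nth_unit_vec: "j < n \<Longrightarrow> unit_vec n i ! j \<longleftrightarrow> j = i"
  by (simp add: unit_vec_def)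

text \<open>
  The first condition is the linearity test of Blum, Luby and Rubinfeld, and the other two
  distinguish the parity of one variable from other parities.
\<close>

definition dict_ok :: "(bool list \<Rightarrow> bool) \<Rightarrow> bool list \<Rightarrow> bool list \<Rightarrow> bool list \<Rightarrow> bool" where
  "dict_ok \<phi> x c b \<longleftrightarrow>
     (\<phi> b \<noteq> \<phi> x) = \<phi> (xr b x) \<and> \<phi> b \<noteq> \<phi> (xr b (ones (length b))) \<and>
     (\<phi> b = \<phi> (xr b x) \<longrightarrow> \<phi> b = \<phi> (xr b (an x c)))"

text \<open>For a linear \<phi> the difference of its values at \<open>b\<close> and
  \<open>xr b a\<close> is its value at \<open>a\<close>, for every \<open>b\<close>. So
  \<open>p a\<close> is the share of votes for 1 at \<open>a\<close>, and \<open>g\<close> is the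
  majority decoding of \<phi>.\<close>

locale near_linear =
  fixes n :: nat and \<phi> :: "bool list \<Rightarrow> bool" and \<delta> :: real
  assumes blr: "Pr (pair_pmf (U n) (U n)) (\<lambda>(x, b). (\<phi> b \<noteq> \<phi> x) \<noteq> \<phi> (xr b x)) \<le> \<delta>"
    and \<delta>: "\<delta> < 1 / 12"
begin

definition p :: "bool list \<Rightarrow> real" where
  "p a = Pr (U n) (\<lambda>b. \<phi> b \<noteq> \<phi> (xr b a))"

definition g :: "bool list \<Rightarrow> bool" where
  "g a \<longleftrightarrow> p a > 1 / 2"

lemma p_bounds: "0 \<le> p a" "p a \<le> 1"
  by (auto simp: p_def)

text \<open>Two independent votes disagree with probability \<open>2 * (p a * (1 - p a))\<close>.
  They can disagree only if the linearity test fails at \<open>(x, b)\<close> or at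
  \<open>(xr x a, xr b a)\<close>, since both pairs have the same sum. Each of these pairs is
  uniform, so this happens with probability at most \<open>2 * \<delta>\<close>.\<close>

lemma p_variance:
  assumes a: "a \<in> cube n"
  shows "p a * (1 - p a) \<le> \<delta>"
proof -
  let ?\<psi> = "\<lambda>b. \<phi> b \<noteq> \<phi> (xr b a)"
  let ?U = "pair_pmf (U n) (U n)"
  let ?B = "\<lambda>x b. (\<phi> b \<noteq> \<phi> x) \<noteq> \<phi> (xr b x)"
  have 1: "Pr ?U (\<lambda>(x, b). ?\<psi> x \<noteq> ?\<psi> b) \<le> Pr ?U (\<lambda>(x, b). ?B x b) + Pr ?U (\<lambda>(x, b). ?B (xr x a) (xr b a))"
  proof (rule Pr_disj)
    fix z assume "z \<in> set_pmf ?U"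
    then obtain x b where z: "z = (x, b)" and xb: "x \<in> cube n" "b \<in> cube n" by auto
    have "xr (xr b a) (xr x a) = xr b x"
      by (rule cube_eqI[of _ n]) (use a xb in \<open>auto simp: in_cube nth_xr\<close>)
    moreover assume "case z of (x, b) \<Rightarrow> ?\<psi> x \<noteq> ?\<psi> b"
    ultimately show "(case z of (x, b) \<Rightarrow> ?B x b) \<or> (case z of (x, b) \<Rightarrow> ?B (xr x a) (xr b a))"
      unfolding z by auto
  qed
  have 2: "Pr ?U (\<lambda>(x, b). ?B (xr x a) (xr b a)) = Pr ?U (\<lambda>(x, b). ?B x b)"
    by (rule Pr_pair_bij) (use a bij_xr in auto)
  have 3: "Pr ?U (\<lambda>(x, b). ?\<psi> x \<noteq> ?\<psi> b) = 2 * (p a * (1 - p a))"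
  proof -
    have "Pr ?U (\<lambda>(x, b). ?\<psi> x \<noteq> ?\<psi> b) =
        measure_pmf.prob ?U ({(x, b). ?\<psi> x \<and> \<not> ?\<psi> b} \<union> {(x, b). \<not> ?\<psi> x \<and> ?\<psi> b})"
      by (rule arg_cong[where f = "measure_pmf.prob ?U"]) auto
    also have "\<dots> = Pr ?U (\<lambda>(x, b). ?\<psi> x \<and> \<not> ?\<psi> b) + Pr ?U (\<lambda>(x, b). \<not> ?\<psi> x \<and> ?\<psi> b)"
      by (rule measure_pmf.finite_measure_Union) auto
    also have "\<dots> = p a * (1 - p a) + (1 - p a) * p a"
    proof -
      have p: "Pr (U n) ?\<psi> = p a" by (simp only: p_def)
      then have np: "Pr (U n) (\<lambda>b. \<not> ?\<psi> b) = 1 - p a" by (simp only: Pr_not)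
      show ?thesis
        by (simp only: Pr_product[of "U n" "U n" ?\<psi> "\<lambda>b. \<not> ?\<psi> b"]
            Pr_product[of "U n" "U n" "\<lambda>b. \<not> ?\<psi> b" ?\<psi>] p np)
    qed
    finally show ?thesis by simp
  qed
  from 1 2 3 blr show ?thesis by simp
qed

text \<open>The majority holds at least half of the votes, so the bound on the product leaves at
  most \<open>2 * \<delta>\<close> to the minority.\<close>

lemma g_error:
  assumes "a \<in> cube n"
  shows "Pr (U n) (\<lambda>b. (\<phi> b \<noteq> \<phi> (xr b a)) \<noteq> g a) \<le> 2 * \<delta>"
proof (cases "g a")
  case True
  then have "1 / 2 * (1 - p a) \<le> p a * (1 - p a)"
    using p_bounds by (intro mult_right_mono) (auto simp: g_def)
  then have "1 - p a \<le> 2 * \<delta>" using p_variance[OF assms] by simp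
  then show ?thesis using True Pr_not[of "U n" "\<lambda>b. \<phi> b \<noteq> \<phi> (xr b a)"] by (simp add: p_def)
next
  case False
  then have "p a * (1 / 2) \<le> p a * (1 - p a)"
    using p_bounds by (intro mult_left_mono) (auto simp: g_def)
  then have "p a \<le> 2 * \<delta>" using p_variance[OF assms] by simp
  then show ?thesis using False by (simp add: p_def)
qed

text \<open>The votes from \<open>b\<close> along \<open>a\<close>, from \<open>xr b a\<close> along
  \<open>a'\<close> and from \<open>b\<close> along \<open>xr a a'\<close> telescope. Each is wrong
  with probability at most \<open>2 * \<delta>\<close>, so for some \<open>b\<close> all three are
  right. Hence \<open>g\<close> is linear everywhere, not just mostly.\<close>

lemma g_xr:
  assumes a: "a \<in> cube n" "a' \<in> cube n"
  shows "g (xr a a') \<longleftrightarrow> g a \<noteq> g a'"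
proof (rule ccontr)
  assume *: "\<not> ?thesis"
  let ?E = "\<lambda>a b. (\<phi> b \<noteq> \<phi> (xr b a)) \<noteq> g a"
  have "Pr (U n) (\<lambda>b. True) \<le> Pr (U n) (\<lambda>b. ?E a b \<or> ?E a' (xr b a)) + Pr (U n) (?E (xr a a'))"
  proof (rule Pr_disj)
    fix b assume "b \<in> set_pmf (U n)"
    then have b: "b \<in> cube n" by simp
    have "xr (xr b a) a' = xr b (xr a a')"
      by (rule cube_eqI[of _ n]) (use a b in \<open>auto simp: in_cube nth_xr\<close>)
    then show "(?E a b \<or> ?E a' (xr b a)) \<or> ?E (xr a a') b" using * by auto
  qed
  also have "Pr (U n) (\<lambda>b. ?E a b \<or> ?E a' (xr b a)) \<le> Pr (U n) (?E a) + Pr (U n) (\<lambda>b. ?E a' (xr b a))"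
    by (rule Pr_disj) auto
  also have "Pr (U n) (\<lambda>b. ?E a' (xr b a)) = Pr (U n) (?E a')"
    using a by (intro Pr_xr)
  finally have "1 \<le> 6 * \<delta>"
    using g_error[of a] g_error[of a'] g_error[of "xr a a'"] a by simp
  then show False using \<delta> by simp
qed

text \<open>Consecutive initial segments of the all-ones vector differ by a unit vector, so by
  linearity one of these unit vectors inherits the value 1.\<close>

lemma g_ones_unit_vec:
  assumes "g (ones n)"
  obtains i where "i < n" "g (unit_vec n i)"
proof -
  let ?v = "\<lambda>m. map (\<lambda>j. j < m) [0..<n]"
  have v: "?v m \<in> cube n" for m by (simp add: cube_def)
  have "\<exists>i<n. g (unit_vec n i)" if "m \<le> n" "g (?v m)" for m
    using that
  proof (induction m)
    case 0
    have "?v 0 = xr (?v 0) (?v 0)" by (rule cube_eqI[of _ n]) (auto simp: in_cube nth_xr)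
    then show ?case using g_xr[OF v v, of 0 0] 0 by simp
  next
    case (Suc m)
    have "?v (Suc m) = xr (?v m) (unit_vec n m)"
      by (rule cube_eqI[of _ n]) (auto simp: in_cube nth_xr nth_unit_vec unit_vec_cube[unfolded in_cube])
    then have "g (?v m) \<or> g (unit_vec n m)"
      using g_xr[OF v unit_vec_cube, of m m] Suc.prems by simp
    then show ?case using Suc by (meson Suc_leD Suc_le_lessD)
  qed
  moreover have "?v n = ones n" by (rule cube_eqI[of _ n]) (auto simp: in_cube)
  ultimately show ?thesis using assms that by (metis le_refl)
qed

end

text \<open>Used to bound \<open>Q\<close> from below: both maps preserve the uniform distribution,
  and every point of \<open>P\<close> lies in \<open>Q\<close> or is moved there, at the price of a
  factor of two.\<close>

lemma Pr_toggle:
  assumes "bij_betw S (cube n) (cube n)" "bij_betw T (cube m) (cube m)"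
    and "\<And>x y. x \<in> cube n \<Longrightarrow> y \<in> cube m \<Longrightarrow> P x y \<Longrightarrow> Q x y \<or> Q (S x) (T y)"
  shows "Pr (pair_pmf (U n) (U m)) (\<lambda>(x, y). P x y) \<le> 2 * Pr (pair_pmf (U n) (U m)) (\<lambda>(x, y). Q x y)"
proof -
  have "Pr (pair_pmf (U n) (U m)) (\<lambda>(x, y). P x y) \<le>
      Pr (pair_pmf (U n) (U m)) (\<lambda>(x, y). Q x y) + Pr (pair_pmf (U n) (U m)) (\<lambda>(x, y). Q (S x) (T y))"
    by (rule Pr_disj) (use assms(3) in auto)
  then show ?thesis unfolding Pr_pair_bij[OF assms(1,2)] by simp
qed

text \<open>
  The map \<open>g\<close> decoded from \<open>\<phi>\<close> by self-correction is linear. If \<open>g\<close> is 1 on the unit vector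
  of \<open>i\<close> and on some \<open>a\<close> with \<open>a ! i = False\<close>, then adding these two vectors to \<open>x\<close> and the first
  one to \<open>c\<close> moves any pair \<open>(x, c)\<close> to one that violates the last condition of the test.
\<close>

lemma dictator_test:
  assumes "Pr (pair_pmf (U n) (pair_pmf (U n) (U n))) (\<lambda>(x, c, b). \<not> dict_ok \<phi> x c b) < 1 / 100"
  shows "\<exists>i<n. \<forall>a\<in>cube n. Pr (U n) (\<lambda>b. (\<phi> b \<noteq> \<phi> (xr b a)) \<noteq> a ! i) \<le> 1 / 50"
proof -
  let ?W = "pair_pmf (U n) (pair_pmf (U n) (U n))"
  \<comment> \<open>Every event that forces the test to fail inherits the bound on its
    failure.\<close>
  have *: "Pr ?W P < 1 / 100" if "\<And>x c b. x \<in> cube n \<Longrightarrow> c \<in> cube n \<Longrightarrow> b \<in> cube n \<Longrightarrow> P (x, c, b) \<Longrightarrow> \<not> dict_ok \<phi> x c b" for P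
    by (rule le_less_trans[OF Pr_mono assms]) (use that in auto)
  have "Pr ?W (\<lambda>(x, c, b). (\<phi> b \<noteq> \<phi> x) \<noteq> \<phi> (xr b x)) < 1 / 100"
    by (rule *) (auto simp: dict_ok_def)
  then interpret near_linear n \<phi> "1 / 100"
    unfolding Pr_skip_mid by unfold_locales auto
  \<comment> \<open>Otherwise \<phi> would rarely tell \<open>b\<close> from its complement, while
    the second condition of the test makes them differ with probability above 99/100.\<close>
  have g1: "g (ones n)"
  proof (rule ccontr)
    assume "\<not> ?thesis"
    then have "Pr (U n) (\<lambda>b. \<phi> b \<noteq> \<phi> (xr b (ones n))) \<le> 1 / 50"
      using g_error[of "ones n"] by simp
    moreover have "Pr ?W (\<lambda>(x, c, b). \<phi> b = \<phi> (xr b (ones n))) < 1 / 100"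
      by (rule *) (auto simp: dict_ok_def in_cube)
    then have "Pr (U n) (\<lambda>b. \<not> \<phi> b \<noteq> \<phi> (xr b (ones n))) < 1 / 100"
      unfolding Pr_skip_mid[of _ _ _ "\<lambda>x b. \<phi> b = \<phi> (xr b (ones n))"] Pr_snd by simp
    ultimately show False unfolding Pr_not by simp
  qed
  then obtain i where i: "i < n" "g (unit_vec n i)" by (rule g_ones_unit_vec)
  let ?e = "unit_vec n i"
  have e: "?e \<in> cube n" by simp
  have g0: "\<not> g a" if a: "a \<in> cube n" "\<not> a ! i" for a
  proof
    assume ga: "g a"
    let ?P = "pair_pmf (U n) (U n)"
    define Q where "Q x c \<longleftrightarrow> \<not> g x \<and> g (an x c)" for x c
    define Q' where "Q' x c \<longleftrightarrow> \<not> g x \<and> x ! i" for x :: "bool list" and c :: "bool list"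
    define Q'' where "Q'' x c \<longleftrightarrow> x ! i" for x :: "bool list" and c :: "bool list"
    have ident: "bij_betw (\<lambda>x. x) (cube n) (cube n)" by (simp add: bij_betw_def)
    \<comment> \<open>Three moves, each costing a factor of two: adding the unit vector to
      \<open>x\<close> achieves \<open>x ! i\<close>, adding \<open>a\<close> to \<open>x\<close>
      achieves \<open>\<not> g x\<close> and keeps \<open>x ! i\<close>, and adding the unit vector
      to \<open>c\<close> achieves \<open>g (an x c)\<close>.\<close>
    have "Pr ?P (\<lambda>(x, c). True) \<le> 2 * Pr ?P (\<lambda>(x, c). Q'' x c)"
    proof (rule Pr_toggle[OF bij_xr[OF e] ident])
      show "Q'' x c \<or> Q'' (xr x ?e) c" if "x \<in> cube n" for x c
        using that i(1) e by (auto simp: Q''_def nth_xr in_cube nth_unit_vec)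
    qed
    also have "Pr ?P (\<lambda>(x, c). Q'' x c) \<le> 2 * Pr ?P (\<lambda>(x, c). Q' x c)"
    proof (rule Pr_toggle[OF bij_xr[OF a(1)] ident])
      show "Q' x c \<or> Q' (xr x a) c" if "x \<in> cube n" "Q'' x c" for x c
        using that i(1) a ga g_xr[OF that(1) a(1)] by (auto simp: Q'_def Q''_def nth_xr in_cube)
    qed
    also have "Pr ?P (\<lambda>(x, c). Q' x c) \<le> 2 * Pr ?P (\<lambda>(x, c). Q x c)"
    proof (rule Pr_toggle[OF ident bij_xr[OF e]])
      show "Q x c \<or> Q x (xr c ?e)" if "x \<in> cube n" "c \<in> cube n" "Q' x c" for x c
      proof -
        have "an x (xr c ?e) = xr (an x c) ?e"
          by (rule cube_eqI[of _ n])
             (use that e in \<open>auto simp: Q'_def nth_an nth_xr in_cube nth_unit_vec\<close>)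
        then show ?thesis
          using that i(2) g_xr[of "an x c" ?e] by (auto simp: Q_def Q'_def)
      qed
    qed
    finally have "1 / 8 \<le> Pr ?P (\<lambda>(x, c). Q x c)" by simp
    also have "\<dots> = Pr ?W (\<lambda>(x, c, b). Q x c)"
    proof -
      have "Pr (pair_pmf (pair_pmf (U n) (U n)) (U n)) (\<lambda>(z, b). case z of (x, c) \<Rightarrow> Q x c) = Pr ?P (\<lambda>(x, c). Q x c)"
        by (rule Pr_fst)
      then show ?thesis by (simp add: pair_pair_pmf case_prod_beta')
    qed
    \<comment> \<open>On \<open>Q\<close> with both votes correct the test fails: the vote at
      \<open>x\<close> says that \<phi> agrees at \<open>b\<close> and \<open>xr b x\<close>, and
      the vote at \<open>an x c\<close> says that it differs at \<open>b\<close> and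
      \<open>xr b (an x c)\<close>. The total 1/100 + 2/100 + 2/100 is below 1/8.\<close>
    also have "\<dots> \<le> Pr ?W (\<lambda>(x, c, b). \<not> dict_ok \<phi> x c b) +
        Pr ?W (\<lambda>(x, c, b). (\<phi> b \<noteq> \<phi> (xr b x)) \<noteq> g x \<or> (\<phi> b \<noteq> \<phi> (xr b (an x c))) \<noteq> g (an x c))"
      by (rule Pr_disj) (auto simp: Q_def dict_ok_def)
    also have "Pr ?W (\<lambda>(x, c, b). (\<phi> b \<noteq> \<phi> (xr b x)) \<noteq> g x \<or> (\<phi> b \<noteq> \<phi> (xr b (an x c))) \<noteq> g (an x c))
       \<le> Pr ?W (\<lambda>(x, c, b). (\<phi> b \<noteq> \<phi> (xr b x)) \<noteq> g x) +
          Pr ?W (\<lambda>(x, c, b). (\<phi> b \<noteq> \<phi> (xr b (an x c))) \<noteq> g (an x c))"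
      by (rule Pr_disj) auto
    also have "Pr ?W (\<lambda>(x, c, b). (\<phi> b \<noteq> \<phi> (xr b x)) \<noteq> g x) \<le> 2 * (1 / 100)"
      by (intro Pr_pair_le[of _ _ _ "\<lambda>x z. case z of (c, b) \<Rightarrow> _ x c b"] Pr_pair_le g_error) auto
    also have "Pr ?W (\<lambda>(x, c, b). (\<phi> b \<noteq> \<phi> (xr b (an x c))) \<noteq> g (an x c)) \<le> 2 * (1 / 100)"
      by (intro Pr_pair_le[of _ _ _ "\<lambda>x z. case z of (c, b) \<Rightarrow> _ x c b"] Pr_pair_le g_error) auto
    finally show False using assms by simp
  qed
  have g: "g a \<longleftrightarrow> a ! i" if a: "a \<in> cube n" for a
  proof (cases "a ! i")
    case True
    have "\<not> xr a ?e ! i" using True a e i(1) by (simp add: nth_xr in_cube nth_unit_vec)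
    then have "\<not> g (xr a ?e)" using g0 a e by simp
    then show ?thesis using g_xr[OF a e] i(2) True by simp
  next
    case False
    then show ?thesis using g0 a by simp
  qed
  show ?thesis using g_error i(1) g by (intro exI[of _ i]) auto
qed

section \<open>The tester\<close>

text \<open>The restriction of \<open>f\<close> to inputs that are constant on each block; one
  evaluation is one query to \<open>f\<close>.\<close>

definition hashed :: "nat \<Rightarrow> (bool list \<Rightarrow> bool) \<Rightarrow> (nat \<Rightarrow> nat) \<Rightarrow> nat set \<Rightarrow> bool" where
  "hashed n f h S = f (map (\<lambda>i. h i \<in> S) [0..<n])"

text \<open>
  If \<open>f\<close> is a monotone DNF, \<open>T\<close> is minimal with \<open>hashed n f h T\<close> and there are no hash collisions,
  then \<open>literal n f h T j\<close> is the one variable of the term for \<open>T\<close> in block \<open>j\<close>.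
\<close>

definition literal :: "nat \<Rightarrow> (bool list \<Rightarrow> bool) \<Rightarrow> (nat \<Rightarrow> nat) \<Rightarrow> nat set \<Rightarrow> nat \<Rightarrow> bool list \<Rightarrow> bool" where
  "literal n f h T j z = f (map (\<lambda>i. if h i = j then z ! i else h i \<in> T) [0..<n])"

definition sel :: "bool list \<Rightarrow> nat set" where
  "sel y = {j. j < length y \<and> y ! j}"

text \<open>Searches for a place where \<open>F\<close> changes as the prefix of \<open>Y\<close>
  grows: \<open>hi\<close> stays on the true side and \<open>lo\<close> on the false side. For
  monotone \<open>F\<close> this yields the shortest sufficient prefix.\<close>

definition bisect :: "(nat set \<Rightarrow> bool) \<Rightarrow> nat set \<Rightarrow> nat set \<Rightarrow> nat \<times> nat \<Rightarrow> nat \<times> nat" where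
  "bisect F T Y = (\<lambda>(lo, hi). let mid = (lo + hi) div 2 in
     if F (T \<union> (Y \<inter> {..<mid})) then (lo, mid) else (mid, hi))"

text \<open>For monotone \<open>F\<close> the block found completes the shortest sufficient prefix
  and is thus indispensable; only the part of \<open>Y\<close> below it remains to be
  searched.\<close>

definition extend :: "(nat set \<Rightarrow> bool) \<Rightarrow> nat \<Rightarrow> nat set \<Rightarrow> nat set \<times> nat \<Rightarrow> nat set \<times> nat" where
  "extend F w Y = (\<lambda>(T, b). if F T then (T, b) else
     let lo = fst ((bisect F T Y ^^ w) (0, b)) in (insert lo T, lo))"

definition find_term :: "(nat set \<Rightarrow> bool) \<Rightarrow> nat \<Rightarrow> nat \<Rightarrow> nat \<Rightarrow> nat set \<Rightarrow> nat set" where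
  "find_term F L w r Y = fst ((extend F w Y ^^ L) ({}, r))"

text \<open>\<open>bad\<close> is never reset and forces rejection. It records a search that did not
  succeed within \<open>L\<close> blocks, or a sample that would require one term too many.\<close>

definition learn_step ::
  "(nat set \<Rightarrow> bool) \<Rightarrow> nat \<Rightarrow> nat \<Rightarrow> nat \<Rightarrow> nat \<Rightarrow> bool list \<Rightarrow> nat set list \<times> bool \<Rightarrow> nat set list \<times> bool" where
  "learn_step F L w r s y = (\<lambda>(D, bad).
     if F (sel y) \<and> \<not> (\<exists>T\<in>set D. T \<subseteq> sel y)
     then if length D < s
       then let T = find_term F L w r (sel y) in (D @ [T], bad \<or> \<not> F T)
       else (D, True)
     else (D, bad))"

definition learn ::
  "(nat set \<Rightarrow> bool) \<Rightarrow> nat \<Rightarrow> nat \<Rightarrow> nat \<Rightarrow> nat \<Rightarrow> bool list list \<Rightarrow> nat set list \<times> bool" where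
  "learn F L w r s ys = fold (learn_step F L w r s) ys ([], False)"

text \<open>The literal values at \<open>x\<close> that are compared with \<open>f x\<close> are
  among those queried for \<open>dict_ok\<close>, so the comparison costs no further literal
  queries.\<close>

definition round_ok ::
  "nat \<Rightarrow> (bool list \<Rightarrow> bool) \<Rightarrow> (nat \<Rightarrow> nat) \<Rightarrow> nat set list \<Rightarrow> bool list \<Rightarrow> bool list \<times> bool list \<Rightarrow> bool" where
  "round_ok n f h D x cb \<longleftrightarrow>
     (\<forall>T\<in>set D. \<forall>j\<in>T. dict_ok (literal n f h T j) x (fst cb) (snd cb)) \<and>
     (f x \<longleftrightarrow> (\<exists>T\<in>set D. \<forall>j\<in>T. literal n f h T j x))"

definition row_ok ::
  "nat \<Rightarrow> (bool list \<Rightarrow> bool) \<Rightarrow> (nat \<Rightarrow> nat) \<Rightarrow> nat set list \<Rightarrow> bool list \<times> (bool list \<times> bool list) list \<Rightarrow> bool" where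
  "row_ok n f h D z \<longleftrightarrow> (\<forall>cb\<in>set (snd z). round_ok n f h D (fst z) cb)"

text \<open>All \<open>K\<close> rounds share the point \<open>x\<close> but use fresh pairs, so
  that a wrong value at \<open>x\<close> of a decodable literal passes with probability
  exponentially small in \<open>K\<close>.\<close>

definition row_pmf :: "nat \<Rightarrow> nat \<Rightarrow> (bool list \<times> (bool list \<times> bool list) list) pmf" where
  "row_pmf n K = pair_pmf (U n) (replicate_pmf K (pair_pmf (U n) (U n)))"

section \<open>Independent repetitions\<close>

lemma replicate_pmf_Suc_pair:
  "replicate_pmf (Suc m) M = map_pmf (\<lambda>(x, xs). x # xs) (pair_pmf M (replicate_pmf m M))"
  by (simp add: pair_pmf_def map_pmf_def bind_assoc_pmf bind_return_pmf)

lemma Pr_replicate_all: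
  fixes M :: "'a::countable pmf"
  shows "Pr (replicate_pmf m M) (\<lambda>xs. \<forall>x\<in>set xs. Q x) = Pr M Q ^ m"
proof (induction m)
  case 0
  show ?case by simp
next
  case (Suc m)
  have "Pr (replicate_pmf (Suc m) M) (\<lambda>xs. \<forall>x\<in>set xs. Q x) =
      Pr (pair_pmf M (replicate_pmf m M)) (\<lambda>(x, xs). Q x \<and> (\<forall>x\<in>set xs. Q x))"
    unfolding replicate_pmf_Suc_pair Pr_map by (simp add: case_prod_beta')
  then show ?case unfolding Pr_product Suc by simp
qed

lemma Pr_replicate_nth:
  assumes "i < m"
  shows "Pr (replicate_pmf m M) (\<lambda>xs. Q (xs ! i)) = Pr M Q"
  using assms
proof (induction m arbitrary: i)
  case (Suc m)
  show ?case
  proof (cases i)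
    case 0
    then have "Pr (replicate_pmf (Suc m) M) (\<lambda>xs. Q (xs ! i)) = Pr (pair_pmf M (replicate_pmf m M)) (\<lambda>(x, xs). Q x)"
      unfolding replicate_pmf_Suc_pair Pr_map by (simp add: case_prod_beta')
    then show ?thesis unfolding Pr_fst .
  next
    case (Suc i')
    then have "Pr (replicate_pmf (Suc m) M) (\<lambda>xs. Q (xs ! i)) = Pr (pair_pmf M (replicate_pmf m M)) (\<lambda>(x, xs). Q (xs ! i'))"
      unfolding replicate_pmf_Suc_pair Pr_map by (simp add: case_prod_beta')
    then show ?thesis unfolding Pr_snd using Suc.IH[of i'] Suc.prems Suc by simp
  qed
qed simp

lemma Pr_replicate_ex:
  assumes "Pr M Q \<le> q"
  shows "Pr (replicate_pmf m M) (\<lambda>xs. \<exists>x\<in>set xs. Q x) \<le> real m * q"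
proof (rule Pr_Bex_le[where I = "{..<m}" and Q = "\<lambda>i xs. Q (xs ! i)"])
  show "\<exists>i\<in>{..<m}. Q (xs ! i)" if "xs \<in> set_pmf (replicate_pmf m M)" "\<exists>x\<in>set xs. Q x" for xs
    using that by (auto simp: set_replicate_pmf in_set_conv_nth)
  show "0 \<le> q" using assms measure_nonneg order_trans by blast
qed (use assms in \<open>auto simp: Pr_replicate_nth\<close>)

section \<open>Soundness\<close>

text \<open>The first round alone rejects often enough: its point and pair form a uniform triple, on
  which the dictator test of this literal fails with probability at least 1/100.\<close>

lemma row_reject_bad_literal:
  assumes T: "T \<in> set D" "j \<in> T" and K: "0 < K"
    and bad: "\<not> Pr (pair_pmf (U n) (pair_pmf (U n) (U n)))
      (\<lambda>(x, c, b). \<not> dict_ok (literal n f h T j) x c b) < 1 / 100"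
  shows "Pr (row_pmf n K) (row_ok n f h D) \<le> 99 / 100"
proof -
  let ?ok = "dict_ok (literal n f h T j)"
  from K obtain K' where K': "K = Suc K'" by (cases K) auto
  have "Pr (row_pmf n K) (row_ok n f h D) \<le>
      Pr (row_pmf n K) (\<lambda>(x, cbs). ?ok x (fst (cbs ! 0)) (snd (cbs ! 0)))"
  proof (rule Pr_mono)
    fix z assume "z \<in> set_pmf (row_pmf n K)" "row_ok n f h D z"
    then show "case z of (x, cbs) \<Rightarrow> ?ok x (fst (cbs ! 0)) (snd (cbs ! 0))"
      using T by (auto simp: row_pmf_def row_ok_def round_ok_def set_replicate_pmf K'
          dest!: bspec[where x = "snd z ! 0"])
  qed
  also have "\<dots> = Pr (pair_pmf (U n) (pair_pmf (U n) (U n))) (\<lambda>(x, c, b). ?ok x c b)"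
  proof -
    let ?M = "pair_pmf (U n) (U n)"
    have "map_pmf (\<lambda>xs. xs ! 0) (replicate_pmf K ?M) = map_pmf fst (pair_pmf ?M (replicate_pmf K' ?M))"
      unfolding K' replicate_pmf_Suc_pair by (simp add: map_pmf_comp case_prod_beta')
    then have "pair_pmf (U n) ?M = pair_pmf (U n) (map_pmf (\<lambda>xs. xs ! 0) (replicate_pmf K ?M))"
      by (simp only: map_fst_pair_pmf)
    also have "\<dots> = map_pmf (apsnd (\<lambda>xs. xs ! 0)) (row_pmf n K)"
      unfolding row_pmf_def by (rule pair_map_pmf2)
    finally have "Pr (pair_pmf (U n) ?M) (\<lambda>(x, c, b). ?ok x c b) =
        Pr (map_pmf (apsnd (\<lambda>xs. xs ! 0)) (row_pmf n K)) (\<lambda>(x, c, b). ?ok x c b)" by simp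
    then show ?thesis by (simp add: case_prod_beta')
  qed
  also have "\<dots> \<le> 99 / 100"
    using bad Pr_not[of "pair_pmf (U n) (pair_pmf (U n) (U n))" "\<lambda>(x, c, b). ?ok x c b"]
    by (simp add: case_prod_beta')
  finally show ?thesis .
qed

text \<open>Learned sets that decode to the same term merge, which only lowers the number of
  terms.\<close>

lemma dnf_of_literals:
  fixes i :: "nat set \<Rightarrow> nat \<Rightarrow> nat"
  assumes "length D \<le> s" "\<And>T j. T \<in> set D \<Longrightarrow> j \<in> T \<Longrightarrow> i T j < n"
  shows "(\<lambda>x. \<exists>T\<in>set D. \<forall>j\<in>T. x ! i T j) \<in> monotone_dnf n s"
proof -
  let ?D = "(\<lambda>T. i T ` T) ` set D"
  have "card ?D \<le> s"
    using card_image_le[of "set D" "\<lambda>T. i T ` T"] card_length[of D] assms(1) by simp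
  moreover have "(\<exists>T\<in>set D. \<forall>j\<in>T. x ! i T j) = dnf_val ?D x" for x
    by (auto simp: dnf_val_def)
  ultimately show ?thesis
    unfolding monotone_dnf_def using assms(2) by (intro CollectI exI[of _ ?D]) auto
qed

text \<open>Let \<open>G\<close> be the DNF of the decoded variables. A row passes only if
  \<open>f\<close> and \<open>G\<close> agree at \<open>x\<close>, which has probability at most
  \<open>1 - \<epsilon>\<close>, or if some literal is wrong at \<open>x\<close> and still passes
  \<open>K\<close> linearity tests there.\<close>

lemma row_reject_far:
  assumes far: "eps_far n \<epsilon> f (monotone_dnf n s)"
    and D: "length D \<le> s" "\<And>T. T \<in> set D \<Longrightarrow> finite T \<and> card T \<le> L"
    and K: "0 < K"
    and good: "\<And>T j. T \<in> set D \<Longrightarrow> j \<in> T \<Longrightarrow> \<exists>i<n. \<forall>a\<in>cube n.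
      Pr (U n) (\<lambda>b. (literal n f h T j b \<noteq> literal n f h T j (xr b a)) \<noteq> a ! i) \<le> 1 / 50"
  shows "Pr (row_pmf n K) (row_ok n f h D) \<le> 1 - \<epsilon> + real (s * L) * (1 / 50) ^ K"
proof -
  define dict where "dict T j i \<longleftrightarrow> i < n \<and> (\<forall>a\<in>cube n.
      Pr (U n) (\<lambda>b. (literal n f h T j b \<noteq> literal n f h T j (xr b a)) \<noteq> a ! i) \<le> 1 / 50)" for T j i
  define i where "i T j = (SOME i. dict T j i)" for T j
  have i: "dict T j (i T j)" if "T \<in> set D" "j \<in> T" for T j
    unfolding i_def by (rule someI_ex) (use good[OF that] in \<open>simp add: dict_def\<close>)
  define G where "G x \<longleftrightarrow> (\<exists>T\<in>set D. \<forall>j\<in>T. x ! i T j)" for x :: "bool list"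
  have "G \<in> monotone_dnf n s"
    unfolding G_def[abs_def] using dnf_of_literals[of D s i n] D(1) i unfolding dict_def by blast
  then have "\<epsilon> \<le> Pr (U n) (\<lambda>x. f x \<noteq> G x)" using far by (auto simp: eps_far_def)
  then have G: "Pr (U n) (\<lambda>x. \<not> f x \<noteq> G x) \<le> 1 - \<epsilon>" unfolding Pr_not by simp
  define I where "I = Sigma (set D) (\<lambda>T. T)"
  have I: "finite I" "card I \<le> s * L"
  proof -
    show "finite I" using D(2) by (auto simp: I_def)
    have "card I = (\<Sum>T\<in>set D. card T)" unfolding I_def by (rule card_SigmaI) (use D(2) in auto)
    also have "\<dots> \<le> card (set D) * L" using D(2) by (intro sum_bounded_above[where K = L, simplified]) auto
    also have "\<dots> \<le> s * L" using card_length[of D] D(1) by (intro mult_right_mono) auto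
    finally show "card I \<le> s * L" .
  qed
  define E where "E = (\<lambda>(T, j) (x, cbs :: (bool list \<times> bool list) list). literal n f h T j x \<noteq> x ! i T j \<and>
      (\<forall>cb\<in>set cbs. (literal n f h T j (snd cb) \<noteq> literal n f h T j x) = literal n f h T j (xr (snd cb) x)))"
  have E: "Pr (row_pmf n K) (E Tj) \<le> (1 / 50) ^ K" if TjI: "Tj \<in> I" for Tj
  proof -
    obtain T j where Tj: "Tj = (T, j)" "T \<in> set D" "j \<in> T" using TjI by (auto simp: I_def)
    let ?\<phi> = "literal n f h T j"
    have "Pr (replicate_pmf K (pair_pmf (U n) (U n))) (\<lambda>cbs. ?\<phi> x \<noteq> x ! i T j \<and>
      (\<forall>cb\<in>set cbs. (?\<phi> (snd cb) \<noteq> ?\<phi> x) = ?\<phi> (xr (snd cb) x))) \<le> (1 / 50) ^ K" if x: "x \<in> cube n" for x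
    proof (cases "?\<phi> x \<noteq> x ! i T j")
      case True
      let ?Q = "\<lambda>b. (?\<phi> b \<noteq> ?\<phi> x) = ?\<phi> (xr b x)"
      have "Pr (pair_pmf (U n) (U n)) (\<lambda>(c, b). ?Q b) = Pr (U n) ?Q" by (rule Pr_snd)
      \<comment> \<open>As \<phi> is wrong at \<open>x\<close>, passing the linearity test means
        that \<open>b\<close> votes against \<open>x ! i\<close>.\<close>
      also have "\<dots> \<le> Pr (U n) (\<lambda>b. (?\<phi> b \<noteq> ?\<phi> (xr b x)) \<noteq> x ! i T j)"
        by (rule Pr_mono) (use True in auto)
      also have "\<dots> \<le> 1 / 50" using i[OF Tj(2,3)] x by (simp add: dict_def)
      finally have "Pr (pair_pmf (U n) (U n)) (\<lambda>cb. ?Q (snd cb)) ^ K \<le> (1 / 50) ^ K"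
        by (intro power_mono) (auto simp: case_prod_beta')
      then show ?thesis using True Pr_replicate_all[of K "pair_pmf (U n) (U n)" "\<lambda>cb. ?Q (snd cb)"] by simp
    qed simp
    then show ?thesis unfolding row_pmf_def E_def Tj prod.case by (intro Pr_pair_le) auto
  qed
  have "Pr (row_pmf n K) (row_ok n f h D) \<le> Pr (row_pmf n K) (\<lambda>(x, cbs). \<not> f x \<noteq> G x) +
      Pr (row_pmf n K) (\<lambda>z. \<exists>Tj\<in>I. E Tj z)"
  proof (rule Pr_disj)
    fix z assume z: "z \<in> set_pmf (row_pmf n K)" "row_ok n f h D z"
    obtain x cbs where zz: "z = (x, cbs)" by force
    have x: "x \<in> cube n" "length cbs = K" using z(1) by (auto simp: row_pmf_def zz set_replicate_pmf)
    have ok: "round_ok n f h D x cb" if "cb \<in> set cbs" for cb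
      using z(2) that by (auto simp: row_ok_def zz)
    show "(case z of (x, cbs) \<Rightarrow> \<not> f x \<noteq> G x) \<or> (\<exists>Tj\<in>I. E Tj z)"
    proof (cases "\<forall>T\<in>set D. \<forall>j\<in>T. literal n f h T j x = x ! i T j")
      case True
      have "cbs \<noteq> []" using x K by auto
      then obtain cb where "cb \<in> set cbs" by (meson hd_in_set)
      from ok[OF this] show ?thesis using True by (auto simp: zz round_ok_def G_def)
    next
      case False
      then obtain T j where "T \<in> set D" "j \<in> T" "literal n f h T j x \<noteq> x ! i T j" by blast
      moreover have "(literal n f h T j (snd cb) \<noteq> literal n f h T j x) = literal n f h T j (xr (snd cb) x)"
        if "cb \<in> set cbs" for cb
        using ok[OF that] \<open>T \<in> set D\<close> \<open>j \<in> T\<close> by (auto simp: round_ok_def dict_ok_def)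
      ultimately have "(T, j) \<in> I" "E (T, j) z" by (auto simp: I_def E_def zz)
      then show ?thesis by blast
    qed
  qed
  also have "Pr (row_pmf n K) (\<lambda>(x, cbs). \<not> f x \<noteq> G x) = Pr (U n) (\<lambda>x. \<not> f x \<noteq> G x)"
    unfolding row_pmf_def by (rule Pr_fst)
  also have "Pr (row_pmf n K) (\<lambda>z. \<exists>Tj\<in>I. E Tj z) \<le> real (s * L) * (1 / 50) ^ K"
    by (rule Pr_Bex_le[OF I(1) _ E]) (use I(2) in \<open>auto simp del: of_nat_mult\<close>)
  finally show ?thesis using G by simp
qed

text \<open>A row rejects with probability at least \<open>1 / (100 * k)\<close>. A literal that
  fails the dictator test gives 1/100; otherwise the choice of \<open>K\<close> makes the union
  bound at most \<open>1 / (2 * k)\<close>, half of the distance guaranteed by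
  \<open>1 / k \<le> \<epsilon>\<close>. Hence all \<open>200 * k\<close> rows pass with probability
  at most exp(-2).\<close>

lemma Pr_far_accepted:
  assumes far: "eps_far n \<epsilon> f (monotone_dnf n s)" and k: "1 / \<epsilon> \<le> real k" "\<epsilon> > 0" "1 \<le> k"
    and D: "length D \<le> s" "\<And>T. T \<in> set D \<Longrightarrow> finite T \<and> card T \<le> L"
    and K: "0 < K" "2 * s * L * k \<le> 2 ^ K"
  shows "Pr (replicate_pmf (200 * k) (row_pmf n K)) (\<lambda>zs. \<forall>z\<in>set zs. row_ok n f h D z) \<le> 1 / 3"
proof -
  have "Pr (row_pmf n K) (row_ok n f h D) \<le> 1 - 1 / (100 * real k)"
  proof (cases "\<exists>T\<in>set D. \<exists>j\<in>T. \<not> Pr (pair_pmf (U n) (pair_pmf (U n) (U n)))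
      (\<lambda>(x, c, b). \<not> dict_ok (literal n f h T j) x c b) < 1 / 100")
    case True
    then have "Pr (row_pmf n K) (row_ok n f h D) \<le> 99 / 100"
      using row_reject_bad_literal K(1) by blast
    also have "\<dots> \<le> 1 - 1 / (100 * real k)" using k(3) by (simp add: field_simps)
    finally show ?thesis .
  next
    case False
    have "\<epsilon> \<ge> 1 / k" using k by (simp add: field_simps)
    have "real (s * L) * (1 / 50) ^ K \<le> 1 / (2 * real k)"
    proof -
      have "real (2 * s * L * k) \<le> 2 ^ K" using K(2) by (metis of_nat_le_iff of_nat_numeral of_nat_power)
      also have "\<dots> \<le> 50 ^ K" by (rule power_mono) auto
      finally show ?thesis using k(3) by (simp add: field_simps power_one_over)
    qed
    moreover have "Pr (row_pmf n K) (row_ok n f h D) \<le> 1 - \<epsilon> + real (s * L) * (1 / 50) ^ K"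
    proof (rule row_reject_far[OF far D K(1)])
      fix T j assume "T \<in> set D" "j \<in> T"
      then show "\<exists>i<n. \<forall>a\<in>cube n. Pr (U n) (\<lambda>b. (literal n f h T j b \<noteq> literal n f h T j (xr b a)) \<noteq> a ! i) \<le> 1 / 50"
        using False by (intro dictator_test) blast
    qed
    moreover have "1 / (2 * real k) = 1 / real k / 2" by simp
    ultimately have "Pr (row_pmf n K) (row_ok n f h D) \<le> 1 - 1 / (2 * real k)"
      using \<open>\<epsilon> \<ge> 1 / k\<close> by linarith
    also have "\<dots> \<le> 1 - 1 / (100 * real k)" using k(3) by (simp add: field_simps)
    finally show ?thesis .
  qed
  also have "\<dots> \<le> exp (- (1 / (100 * real k)))"
    using exp_ge_add_one_self[of "- (1 / (100 * real k))"] by simp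
  finally have "Pr (row_pmf n K) (row_ok n f h D) ^ (200 * k) \<le> exp (- (1 / (100 * real k))) ^ (200 * k)"
    by (intro power_mono) auto
  also have "\<dots> = exp (- 2)"
    using k(3) by (simp add: exp_of_nat_mult[symmetric])
  also have "\<dots> \<le> 1 / 3"
    using exp_ge_add_one_self[of 2] by (simp add: exp_minus field_simps)
  finally show ?thesis unfolding Pr_replicate_all .
qed

section \<open>Learning\<close>

text \<open>This works for arbitrary \<open>F\<close>: the two ends of the interval always have
  different values, and each halving halves the bound on its length, from \<open>2 ^ w\<close> down
  to one.\<close>

lemma bisect_inv:
  assumes "\<not> F T" "F (T \<union> (Y \<inter> {..<b}))" "b \<le> 2 ^ w" "i \<le> w" "(bisect F T Y ^^ i) (0, b) = (lo, hi)"
  shows "lo < hi \<and> hi \<le> b \<and> hi - lo \<le> 2 ^ (w - i) \<and> \<not> F (T \<union> (Y \<inter> {..<lo})) \<and> F (T \<union> (Y \<inter> {..<hi}))"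
  using assms(4,5)
proof (induction i arbitrary: lo hi)
  case 0
  have "b \<noteq> 0" using assms(1,2) by (intro notI) simp
  then show ?case using 0 assms by simp
next
  case (Suc i)
  obtain lo' hi' where 1: "(bisect F T Y ^^ i) (0, b) = (lo', hi')" by force
  have IH: "lo' < hi'" "hi' \<le> b" "hi' - lo' \<le> 2 ^ (w - i)" "\<not> F (T \<union> (Y \<inter> {..<lo'}))" "F (T \<union> (Y \<inter> {..<hi'}))"
    using Suc.IH[OF _ 1] Suc.prems by auto
  define p where "p = (2::nat) ^ (w - Suc i)"
  have "w - i = Suc (w - Suc i)" using Suc.prems by simp
  then have p: "hi' - lo' \<le> 2 * p" "1 \<le> p" using IH(3) by (auto simp: p_def)
  define mid where "mid = (lo' + hi') div 2"
  have mid: "lo' \<le> mid" "mid < hi'" "mid - lo' \<le> p" "hi' - mid \<le> p"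
    using IH(1) p by (auto simp: mid_def)
  have 2: "(if F (T \<union> (Y \<inter> {..<mid})) then (lo', mid) else (mid, hi')) = (lo, hi)"
    using Suc.prems(2) unfolding funpow.simps o_apply 1 by (auto simp: bisect_def mid_def Let_def split: if_splits)
  show ?case
  proof (cases "F (T \<union> (Y \<inter> {..<mid}))")
    case True
    then have "lo' < mid" using mid(1) IH(4) by (metis le_neq_implies_less)
    then show ?thesis using True 2 mid IH by (auto simp: p_def)
  next
    case False
    then show ?thesis using 2 mid IH by (auto simp: p_def)
  qed
qed

text \<open>The ends are now \<open>lo\<close> and \<open>Suc lo\<close>, so the value of
  \<open>F\<close> changes by the single block \<open>lo\<close>, which therefore belongs to
  \<open>Y\<close>.\<close>

lemma bisect_correct:
  assumes "\<not> F T" "F (T \<union> (Y \<inter> {..<b}))" "b \<le> 2 ^ w"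
  defines "lo \<equiv> fst ((bisect F T Y ^^ w) (0, b))"
  shows "lo < b" "\<not> F (T \<union> (Y \<inter> {..<lo}))" "F (insert lo T \<union> (Y \<inter> {..<lo}))" "lo \<in> Y"
proof -
  obtain hi where hi: "(bisect F T Y ^^ w) (0, b) = (lo, hi)" by (metis lo_def prod.collapse)
  from bisect_inv[OF assms(1-3) le_refl hi] have *: "lo < hi" "hi \<le> b" "hi - lo \<le> 1"
    "\<not> F (T \<union> (Y \<inter> {..<lo}))" "F (T \<union> (Y \<inter> {..<hi}))" by auto
  then have hi: "hi = Suc lo" by simp
  show "lo < b" "\<not> F (T \<union> (Y \<inter> {..<lo}))" using * by auto
  show Y: "lo \<in> Y"
  proof (rule ccontr)
    assume "lo \<notin> Y"
    then have "Y \<inter> {..<hi} = Y \<inter> {..<lo}" unfolding hi by (auto simp: less_Suc_eq)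
    then show False using * by simp
  qed
  then have "insert lo T \<union> (Y \<inter> {..<lo}) = T \<union> (Y \<inter> {..<hi})" unfolding hi by (auto simp: less_Suc_eq)
  then show "F (insert lo T \<union> (Y \<inter> {..<lo}))" using * by simp
qed

text \<open>The blocks found lie at or above \<open>b\<close> and the search stays below, so each
  step adds a new block until \<open>F T\<close> holds. For monotone \<open>F\<close> an
  indispensable block stays so, because the sets considered later are contained in the earlier
  ones.\<close>

lemma extend_inv:
  assumes "F Y" "Y \<subseteq> {..<r}" "r \<le> 2 ^ w" "(extend F w Y ^^ i) ({}, r) = (T, b)"
  shows "F (T \<union> (Y \<inter> {..<b})) \<and> T \<subseteq> Y \<and> b \<le> r \<and> T \<inter> {..<b} = {} \<and> finite T \<and> card T \<le> i \<and>
    (\<not> F T \<longrightarrow> card T = i) \<and> (mono F \<longrightarrow> (\<forall>j\<in>T. \<not> F ((T - {j}) \<union> (Y \<inter> {..<b}))))"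
  using assms(4)
proof (induction i arbitrary: T b)
  case 0
  have "Y \<inter> {..<r} = Y" using assms(2) by auto
  then show ?case using 0 assms by auto
next
  case (Suc i)
  obtain T' b' where 1: "(extend F w Y ^^ i) ({}, r) = (T', b')" by force
  have IH: "F (T' \<union> (Y \<inter> {..<b'}))" "T' \<subseteq> Y" "b' \<le> r" "T' \<inter> {..<b'} = {}" "finite T'" "card T' \<le> i"
    "\<not> F T' \<Longrightarrow> card T' = i" "\<And>j. mono F \<Longrightarrow> j \<in> T' \<Longrightarrow> \<not> F ((T' - {j}) \<union> (Y \<inter> {..<b'}))"
    using Suc.IH[OF 1] by blast+
  show ?case
  proof (cases "F T'")
    case True
    then have T: "T = T'" "b = b'" using Suc.prems 1 by (auto simp: extend_def)
    have "card T' \<le> Suc i" using IH(6) by simp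
    then show ?thesis using IH(1-5,8) True unfolding T by blast
  next
    case False
    define lo where "lo = fst ((bisect F T' Y ^^ w) (0, b'))"
    have T: "T = insert lo T'" "b = lo" using Suc.prems 1 False by (auto simp: extend_def lo_def Let_def)
    have lo: "lo < b'" "\<not> F (T' \<union> (Y \<inter> {..<lo}))" "F (insert lo T' \<union> (Y \<inter> {..<lo}))" "lo \<in> Y"
      unfolding lo_def using bisect_correct[OF False IH(1), of w] IH(3) assms(3) by auto
    have "lo \<notin> T'" using IH(4) lo(1) by auto
    moreover have "\<not> F ((T - {j}) \<union> (Y \<inter> {..<lo}))" if "mono F" "j \<in> T" for j
    proof (cases "j = lo")
      case True
      then show ?thesis using lo(2) \<open>lo \<notin> T'\<close> by (simp add: T)
    next
      case False
      then have "(T - {j}) \<union> (Y \<inter> {..<lo}) \<subseteq> (T' - {j}) \<union> (Y \<inter> {..<b'})"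
        using lo(1,4) by (auto simp: T)
      then have "F ((T - {j}) \<union> (Y \<inter> {..<lo})) \<le> F ((T' - {j}) \<union> (Y \<inter> {..<b'}))"
        by (rule monoD[OF that(1)])
      then show ?thesis using IH(8)[OF that(1), of j] that False by (auto simp: T)
    qed
    ultimately have "mono F \<longrightarrow> (\<forall>j\<in>T. \<not> F ((T - {j}) \<union> (Y \<inter> {..<lo})))" by blast
    moreover have "F (T \<union> (Y \<inter> {..<lo})) \<and> T \<subseteq> Y \<and> lo \<le> r \<and> T \<inter> {..<lo} = {} \<and> finite T \<and>
        card T \<le> Suc i \<and> (\<not> F T \<longrightarrow> card T = Suc i)"
      using IH(1-7) False lo \<open>lo \<notin> T'\<close> by (auto simp: T(1))
    ultimately show ?thesis unfolding T(2) by blast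
  qed
qed

lemma find_term_subset:
  assumes "F Y" "Y \<subseteq> {..<r}" "r \<le> 2 ^ w"
  shows "find_term F L w r Y \<subseteq> Y" "card (find_term F L w r Y) \<le> L"
proof -
  obtain T b where "(extend F w Y ^^ L) ({}, r) = (T, b)" by force
  with extend_inv[OF assms this] show "find_term F L w r Y \<subseteq> Y" "card (find_term F L w r Y) \<le> L"
    by (auto simp: find_term_def)
qed

lemma sel_subset: "y \<in> cube r \<Longrightarrow> sel y \<subseteq> {..<r}"
  by (auto simp: sel_def cube_def)

lemma learn_snoc: "learn F L w r s (ys @ [y]) = learn_step F L w r s y (learn F L w r s ys)"
  by (simp add: learn_def)

text \<open>Valid for an arbitrary oracle: these bounds are all that soundness uses about
  learning.\<close>

lemma learn_size:
  assumes "set ys \<subseteq> cube r" "r \<le> 2 ^ w" "learn F L w r s ys = (D, bad)"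
  shows "length D \<le> s \<and> (\<forall>T\<in>set D. T \<subseteq> {..<r} \<and> card T \<le> L)"
  using assms(1,3)
proof (induction ys arbitrary: D bad rule: rev_induct)
  case Nil
  then show ?case by (simp add: learn_def)
next
  case (snoc y ys)
  obtain D' bad' where 1: "learn F L w r s ys = (D', bad')" by force
  have IH: "length D' \<le> s" "\<And>T. T \<in> set D' \<Longrightarrow> T \<subseteq> {..<r} \<and> card T \<le> L"
    using snoc.IH[OF _ 1] snoc.prems by auto
  have y: "sel y \<subseteq> {..<r}" using snoc.prems by (intro sel_subset) auto
  from snoc.prems(2) have 2: "learn_step F L w r s y (D', bad') = (D, bad)"
    by (simp add: learn_snoc 1)
  show ?case
  proof (cases "F (sel y) \<and> \<not> (\<exists>T\<in>set D'. T \<subseteq> sel y) \<and> length D' < s")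
    case True
    then have "D = D' @ [find_term F L w r (sel y)]" using 2 by (auto simp: learn_step_def Let_def)
    then show ?thesis using True IH find_term_subset[of F "sel y" r w L] y assms(2) by auto
  next
    case False
    then have "D = D'" using 2 by (auto simp: learn_step_def split: if_splits)
    then show ?thesis using IH by auto
  qed
qed

section \<open>Monotone DNFs under a fixed hash function\<close>

locale hashed_dnf =
  fixes n r L s :: nat and f :: "bool list \<Rightarrow> bool" and C :: "nat set set" and h :: "nat \<Rightarrow> nat"
  assumes C: "finite C" "card C \<le> s" "\<And>T. T \<in> C \<Longrightarrow> T \<subseteq> {..<n}"
    and f: "\<And>x. x \<in> cube n \<Longrightarrow> f x = dnf_val C x"
    and h: "\<And>i. i < n \<Longrightarrow> h i < r"
begin

abbreviation "F \<equiv> hashed n f h"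

lemma F: "F S \<longleftrightarrow> (\<exists>T\<in>C. h ` T \<subseteq> S)"
proof -
  have "F S \<longleftrightarrow> dnf_val C (map (\<lambda>i. h i \<in> S) [0..<n])"
    unfolding hashed_def by (rule f) (simp add: cube_def)
  also have "\<dots> \<longleftrightarrow> (\<exists>T\<in>C. \<forall>i\<in>T. h i \<in> S)"
    unfolding dnf_val_def using C(3) by (intro bex_cong refl ball_cong) (auto simp: subset_iff)
  finally show ?thesis by auto
qed

lemma mono_F: "mono F"
  by (rule monoI) (auto simp: F)

text \<open>The only event in which the search for a term may run out of its \<open>L\<close>
  steps.\<close>

definition large_hit :: "bool list \<Rightarrow> bool" where
  "large_hit y \<longleftrightarrow> (\<exists>T\<in>C. L < card (h ` T) \<and> h ` T \<subseteq> sel y)"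

text \<open>Minimality is what turns the literals of \<open>T\<close> into single variables.\<close>

definition term_block :: "nat set \<Rightarrow> bool" where
  "term_block T \<longleftrightarrow> (\<exists>T0\<in>C. T = h ` T0) \<and> card T \<le> L \<and> (\<forall>j\<in>T. \<not> F (T - {j}))"

text \<open>The image of some term lies in the union of \<open>T\<close> and the prefix of the
  sample below \<open>b\<close>. It contains \<open>T\<close>, as every block of \<open>T\<close> is
  indispensable. If \<open>F T\<close> failed, \<open>T\<close> would have \<open>L\<close> blocks
  and be a proper part of this image, so the sample would satisfy an image of more than
  \<open>L\<close> blocks.\<close>

lemma find_term_correct:
  assumes y: "y \<in> cube r" "F (sel y)" "\<not> large_hit y" and r: "r \<le> 2 ^ w"
  defines "T \<equiv> find_term F L w r (sel y)"
  shows "F T" "term_block T" "T \<subseteq> sel y"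
proof -
  obtain b where "(extend F w (sel y) ^^ L) ({}, r) = (T, b)"
    by (metis T_def find_term_def prod.collapse)
  from extend_inv[OF y(2) sel_subset[OF y(1)] r this] mono_F
  have T: "F (T \<union> (sel y \<inter> {..<b}))" "T \<subseteq> sel y" "finite T" "card T \<le> L" "\<not> F T \<Longrightarrow> card T = L"
    "\<And>j. j \<in> T \<Longrightarrow> \<not> F ((T - {j}) \<union> (sel y \<inter> {..<b}))"
    by auto
  from T(1) obtain T0 where T0: "T0 \<in> C" "h ` T0 \<subseteq> T \<union> (sel y \<inter> {..<b})" by (auto simp: F)
  have fin: "finite (h ` T0)" using C(3)[OF T0(1)] by (meson finite_imageI finite_lessThan finite_subset)
  have sub: "T \<subseteq> h ` T0"
  proof
    fix j assume j: "j \<in> T"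
    show "j \<in> h ` T0"
    proof (rule ccontr)
      assume "j \<notin> h ` T0"
      then have "h ` T0 \<subseteq> (T - {j}) \<union> (sel y \<inter> {..<b})" using T0 by blast
      then show False using T(6)[OF j] T0(1) by (auto simp: F)
    qed
  qed
  show FT: "F T"
  proof (rule ccontr)
    assume nF: "\<not> F T"
    then have "T \<noteq> h ` T0" using T0(1) by (auto simp: F)
    then have "card T < card (h ` T0)" using sub fin by (intro psubset_card_mono) auto
    then have "L < card (h ` T0)" using T(5)[OF nF] by simp
    moreover have "h ` T0 \<subseteq> sel y" using T0(2) T(2) by auto
    ultimately show False using y(3) T0(1) by (auto simp: large_hit_def)
  qed
  have min: "\<not> F (T - {j})" if "j \<in> T" for j
  proof -
    have "F (T - {j}) \<le> F ((T - {j}) \<union> (sel y \<inter> {..<b}))" by (rule monoD[OF mono_F]) auto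
    then show ?thesis using T(6)[OF that] by auto
  qed
  from FT obtain T1 where T1: "T1 \<in> C" "h ` T1 \<subseteq> T" by (auto simp: F)
  have "h ` T1 = T"
  proof (rule ccontr)
    assume "h ` T1 \<noteq> T"
    then obtain j where "j \<in> T" "h ` T1 \<subseteq> T - {j}" using T1(2) by blast
    then show False using min T1(1) by (auto simp: F)
  qed
  then show "term_block T" using T1(1) T(4) min by (auto simp: term_block_def)
  show "T \<subseteq> sel y" by (rule T(2))
qed

text \<open>A new term lies inside its sample while no earlier one does, so the list consists of
  distinct images of terms. There are at most \<open>s\<close> of these, hence the list never
  overflows.\<close>

lemma learn_correct:
  assumes "set ys \<subseteq> cube r" "\<And>y. y \<in> set ys \<Longrightarrow> \<not> large_hit y" "r \<le> 2 ^ w" "learn F L w r s ys = (D, bad)"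
  shows "\<not> bad \<and> distinct D \<and> (\<forall>T\<in>set D. term_block T) \<and>
    (\<forall>y\<in>set ys. F (sel y) \<longrightarrow> (\<exists>T\<in>set D. T \<subseteq> sel y))"
  using assms(1,2,4)
proof (induction ys arbitrary: D bad rule: rev_induct)
  case Nil
  then show ?case by (simp add: learn_def)
next
  case (snoc y ys)
  obtain D' bad' where 1: "learn F L w r s ys = (D', bad')" by force
  have IH: "\<not> bad'" "distinct D'" "\<And>T. T \<in> set D' \<Longrightarrow> term_block T"
    "\<And>y. y \<in> set ys \<Longrightarrow> F (sel y) \<Longrightarrow> \<exists>T\<in>set D'. T \<subseteq> sel y"
    using snoc.IH[OF _ _ 1] snoc.prems by auto
  from snoc.prems(3) have 2: "learn_step F L w r s y (D', bad') = (D, bad)"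
    by (simp add: learn_snoc 1)
  show ?case
  proof (cases "F (sel y) \<and> \<not> (\<exists>T\<in>set D'. T \<subseteq> sel y)")
    case True
    let ?T = "find_term F L w r (sel y)"
    have T: "F ?T" "term_block ?T" "?T \<subseteq> sel y"
      using find_term_correct[of y w] True snoc.prems assms(3) by auto
    then have new: "?T \<notin> set D'" using True by blast
    have "insert ?T (set D') \<subseteq> (`) h ` C" using T(2) IH(3) unfolding term_block_def by blast
    then have "card (insert ?T (set D')) \<le> card ((`) h ` C)" by (intro card_mono) (use C in auto)
    also have "\<dots> \<le> s" using card_image_le[OF C(1), of "(`) h"] C(2) by simp
    finally have "length D' < s" using new IH(2) by (simp add: distinct_card)
    then have "D = D' @ [?T]" "bad = bad'" using 2 True T(1) by (auto simp: learn_step_def Let_def)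
    then show ?thesis using IH T new by auto
  next
    case False
    then have "D = D'" "bad = bad'" using 2 by (auto simp: learn_step_def split: if_splits)
    then show ?thesis using IH False by auto
  qed
qed

text \<open>
  Long terms are shortened to \<open>L + 1\<close> variables, so that injectivity of \<open>h\<close> on few variables
  suffices to keep the images of long terms long.
\<close>

definition cut :: "nat set \<Rightarrow> nat set" where
  "cut T = (if card T \<le> L then T else (SOME T'. T' \<subseteq> T \<and> card T' = L + 1))"

definition core :: "nat set" where
  "core = \<Union> (cut ` C)"

lemma cut: "cut T \<subseteq> T" "card T \<le> L \<Longrightarrow> cut T = T" "L < card T \<Longrightarrow> card (cut T) = L + 1" "card (cut T) \<le> L + 1"
proof -
  have *: "cut T \<subseteq> T \<and> card (cut T) = L + 1" if "L < card T"
  proof -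
    have "\<exists>T'\<subseteq>T. card T' = L + 1" using that obtain_subset_with_card_n[of "L + 1" T] by auto
    from someI_ex[OF this] show ?thesis using that by (simp add: cut_def)
  qed
  show "cut T \<subseteq> T" "card T \<le> L \<Longrightarrow> cut T = T" "L < card T \<Longrightarrow> card (cut T) = L + 1" "card (cut T) \<le> L + 1"
    using * by (cases "card T \<le> L"; simp add: cut_def)+
qed

lemma core_subset: "core \<subseteq> {..<n}"
  using C(3) cut(1) by (fastforce simp: core_def)

lemma card_core: "card core \<le> s * (L + 1)"
proof -
  have "card core \<le> (\<Sum>T\<in>C. card (cut T))"
    unfolding core_def using C(1) by (rule card_UN_le)
  also have "\<dots> \<le> card C * (L + 1)"
    using sum_bounded_above[of C "\<lambda>T. card (cut T)" "L + 1"] cut(4) by simp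
  also have "\<dots> \<le> s * (L + 1)" using C(2) by (rule mult_right_mono) simp
  finally show ?thesis .
qed

lemma finite_term: "T \<in> C \<Longrightarrow> finite T"
  using C(3) finite_subset by blast

definition learned :: "nat set list \<Rightarrow> nat set set" where
  "learned D = {T0 \<in> C. card T0 \<le> L \<and> h ` T0 \<in> set D}"

context
  assumes inj: "inj_on h core"
begin

lemma inj_cut: "T \<in> C \<Longrightarrow> inj_on h (cut T)"
  using inj by (rule inj_on_subset) (auto simp: core_def)

text \<open>If \<open>T\<close> were long, the \<open>L + 1\<close> variables of its cut, which
  belong to the core, would have distinct images.\<close>

lemma small_image: "T \<in> C \<Longrightarrow> card (h ` T) \<le> L \<Longrightarrow> card T \<le> L"
proof (rule ccontr)
  assume T: "T \<in> C" "card (h ` T) \<le> L" "\<not> card T \<le> L"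
  then have "L + 1 = card (h ` cut T)" using cut(3)[of T] inj_cut[of T] by (simp add: card_image)
  also have "\<dots> \<le> card (h ` T)"
    using cut(1) finite_term[OF T(1)] by (intro card_mono) auto
  finally show False using T(2) by simp
qed

text \<open>A term \<open>T1\<close> satisfied by the query has its image inside that of
  \<open>T0\<close>, since all other blocks are 0. By minimality the images are equal, so
  \<open>T1\<close> is short; injectivity on the core gives \<open>T1 = T0\<close>, and then the
  variable \<open>i\<close> alone decides.\<close>

lemma literal_term_block:
  assumes T0: "T0 \<in> C" and T: "term_block (h ` T0)" and i: "i \<in> T0" and z: "z \<in> cube n"
  shows "literal n f h (h ` T0) (h i) z = z ! i"
proof -
  let ?z = "map (\<lambda>i'. if h i' = h i then z ! i' else h i' \<in> h ` T0) [0..<n]"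
  have lit: "literal n f h (h ` T0) (h i) z = dnf_val C ?z"
    unfolding literal_def by (rule f) (simp add: cube_def)
  have T0s: "card T0 \<le> L" using small_image T0 T by (auto simp: term_block_def)
  have T0c: "T0 \<subseteq> core" using cut(2)[OF T0s] T0 by (auto simp: core_def)
  show ?thesis
  proof
    assume zi: "z ! i"
    have "?z ! i'" if "i' \<in> T0" for i'
    proof (cases "h i' = h i")
      case True
      then have "i' = i" using inj_onD[OF inj] T0c i that by blast
      then show ?thesis using zi C(3)[OF T0] i by (auto simp: subset_iff)
    next
      case False
      then show ?thesis using that C(3)[OF T0] by (auto simp: subset_iff)
    qed
    then show "literal n f h (h ` T0) (h i) z" unfolding lit dnf_val_def using T0 by blast
  next
    assume "literal n f h (h ` T0) (h i) z"
    then obtain T1 where T1: "T1 \<in> C" "\<And>i'. i' \<in> T1 \<Longrightarrow> ?z ! i'" unfolding lit dnf_val_def by blast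
    have z': "if h i' = h i then z ! i' else h i' \<in> h ` T0" if "i' \<in> T1" for i'
      using T1(2)[OF that] C(3)[OF T1(1)] that by (auto simp: subset_iff)
    have sub: "h ` T1 \<subseteq> h ` T0"
    proof
      fix j assume "j \<in> h ` T1"
      then obtain i' where "i' \<in> T1" "j = h i'" by auto
      then show "j \<in> h ` T0" using z'[of i'] i by (auto split: if_splits)
    qed
    have eq: "h ` T1 = h ` T0"
    proof (rule ccontr)
      assume "h ` T1 \<noteq> h ` T0"
      then obtain j where "j \<in> h ` T0" "h ` T1 \<subseteq> h ` T0 - {j}" using sub by blast
      then show False using T T1(1) by (auto simp: term_block_def F)
    qed
    then have "card T1 \<le> L" using small_image[OF T1(1)] T by (auto simp: term_block_def)
    then have "T1 \<subseteq> core" using cut(2) T1(1) by (auto simp: core_def)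
    then have "T1 = T0" using eq T0c inj_on_image_eq_iff[OF inj] by blast
    then show "z ! i" using z'[of i] i by simp
  qed
qed

lemma dict_ok_variable:
  assumes "i < n" "\<And>z. z \<in> cube n \<Longrightarrow> \<phi> z = z ! i" "x \<in> cube n" "c \<in> cube n" "b \<in> cube n"
  shows "dict_ok \<phi> x c b"
proof -
  have "length b = n" using assms by (simp add: cube_def)
  have "\<phi> (xr b x) = (b ! i \<noteq> x ! i)" "\<phi> (xr b (ones n)) = (\<not> b ! i)"
    "\<phi> (xr b (an x c)) = (b ! i \<noteq> (x ! i \<and> c ! i))" "\<phi> x = x ! i" "\<phi> b = b ! i"
    using assms by (auto simp: nth_xr nth_an in_cube)
  then show ?thesis by (auto simp: dict_ok_def \<open>length b = n\<close>)
qed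

text \<open>Learned terms imply \<open>f\<close>, so the learned hypothesis errs only at points
  where \<open>f\<close> holds and no learned term does. All other checks pass because the literals
  are variables.\<close>

lemma round_ok_learned:
  assumes D: "\<And>T. T \<in> set D \<Longrightarrow> term_block T" and x: "x \<in> cube n" "cb \<in> cube n \<times> cube n"
    and fx: "f x \<Longrightarrow> \<exists>T\<in>learned D. \<forall>i\<in>T. x ! i"
  shows "round_ok n f h D x cb"
proof -
  have image: "\<exists>T0\<in>learned D. T = h ` T0" if "T \<in> set D" for T
    using D[OF that] that small_image by (auto simp: term_block_def learned_def)
  have lit: "literal n f h (h ` T0) (h i) z = z ! i" if "T0 \<in> learned D" "i \<in> T0" "z \<in> cube n" for T0 i z
    using that D by (intro literal_term_block) (auto simp: learned_def)
  have "dict_ok (literal n f h T j) x (fst cb) (snd cb)" if Tj: "T \<in> set D" "j \<in> T" for T j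
  proof -
    obtain T0 where T0: "T0 \<in> learned D" "T = h ` T0" using image Tj by blast
    then obtain i where i: "i \<in> T0" "j = h i" using Tj by auto
    show ?thesis
    proof (rule dict_ok_variable)
      show "i < n" using T0(1) i(1) C(3) by (auto simp: learned_def)
    qed (use x T0 i lit in auto)
  qed
  moreover have "f x \<longleftrightarrow> (\<exists>T\<in>set D. \<forall>j\<in>T. literal n f h T j x)"
  proof
    assume "f x"
    then obtain T0 where T0: "T0 \<in> learned D" "\<And>i. i \<in> T0 \<Longrightarrow> x ! i" using fx by blast
    then have "\<forall>j\<in>h ` T0. literal n f h (h ` T0) j x" using lit x by auto
    then show "\<exists>T\<in>set D. \<forall>j\<in>T. literal n f h T j x" using T0(1) unfolding learned_def by blast
  next
    assume "\<exists>T\<in>set D. \<forall>j\<in>T. literal n f h T j x"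
    then obtain T where T: "T \<in> set D" "\<And>j. j \<in> T \<Longrightarrow> literal n f h T j x" by blast
    then obtain T0 where T0: "T0 \<in> learned D" "T = h ` T0" using image by blast
    then have "\<forall>i\<in>T0. x ! i" using lit x T by blast
    then show "f x" using f[OF x(1)] T0 by (auto simp: dnf_val_def learned_def)
  qed
  ultimately show ?thesis by (simp add: round_ok_def)
qed

end

end

section \<open>Completeness\<close>

lemma U_Pi_pmf: "U n = map_pmf (\<lambda>\<omega>. map \<omega> [0..<n]) (Pi_pmf {..<n} False (\<lambda>_. bernoulli_pmf (1 / 2)))"
proof -
  have "bij_betw (\<lambda>\<omega>. map \<omega> [0..<n]) (PiE_dflt {..<n} False (\<lambda>_. UNIV)) (cube n)"
    by (rule bij_betw_byWitness[where f' = "\<lambda>x i. if i < n then x ! i else False"])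
       (auto simp: PiE_dflt_def cube_def fun_eq_iff intro!: nth_equalityI)
  from map_pmf_of_set_bij_betw[OF this] show ?thesis
    by (simp add: bernoulli_pmf_half_conv_pmf_of_set Pi_pmf_of_set finite_PiE_dflt)
qed

lemma map_restrict_U:
  assumes "A \<subseteq> {..<n}"
  shows "map_pmf (\<lambda>x i. i \<in> A \<and> x ! i) (U n) = Pi_pmf A False (\<lambda>_. bernoulli_pmf (1 / 2))"
proof -
  have "(\<lambda>i. i \<in> A \<and> map \<omega> [0..<n] ! i) = (\<lambda>i. if i \<in> A then \<omega> i else False)" for \<omega> :: "nat \<Rightarrow> bool"
    using assms by (auto simp: fun_eq_iff subset_iff)
  then show ?thesis
    using Pi_pmf_subset[OF _ assms, of False "\<lambda>_. bernoulli_pmf (1 / 2)"]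
    by (simp add: U_Pi_pmf map_pmf_comp)
qed

text \<open>On variables without collisions a random block assignment looks like a random input.
  This transfers what is learned from blocks to uniform inputs of \<open>f\<close>.\<close>

lemma map_hash_U:
  assumes "A \<subseteq> {..<n}" "inj_on h A" "h ` A \<subseteq> {..<r}"
  shows "map_pmf (\<lambda>y i. i \<in> A \<and> y ! h i) (U r) = map_pmf (\<lambda>x i. i \<in> A \<and> x ! i) (U n)"
proof -
  \<comment> \<open>Outside \<open>A\<close> the values have to avoid the image of \<open>A\<close>;
    the number \<open>r\<close> does.\<close>
  define h' where "h' i = (if i \<in> A then h i else r)" for i
  have fin: "finite A" using assms(1) finite_subset by blast
  have "bij_betw h' A (h ` A)"
    using assms(2) by (auto simp: bij_betw_def inj_on_def h'_def)
  then have "Pi_pmf A False (\<lambda>_. bernoulli_pmf (1 / 2)) =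
      map_pmf (\<lambda>g. g \<circ> h') (Pi_pmf (h ` A) False (\<lambda>_. bernoulli_pmf (1 / 2)))"
    by (rule Pi_pmf_bij_betw[OF fin]) (use assms(3) in \<open>auto simp: h'_def\<close>)
  also have "\<dots> = map_pmf (\<lambda>y. (\<lambda>i. i \<in> h ` A \<and> y ! i) \<circ> h') (U r)"
    unfolding map_restrict_U[OF assms(3), symmetric] map_pmf_comp ..
  also have "(\<lambda>y. (\<lambda>i. i \<in> h ` A \<and> y ! i) \<circ> h') = (\<lambda>y i. i \<in> A \<and> y ! h i)" 
    using assms(3) by (force simp: h'_def fun_eq_iff)
  finally show ?thesis unfolding map_restrict_U[OF assms(1)] by simp
qed

lemma Pr_all_true:
  assumes "A \<subseteq> {..<n}"
  shows "Pr (U n) (\<lambda>x. \<forall>i\<in>A. x ! i) = (1 / 2) ^ card A"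
proof -
  have fin: "finite A" using assms finite_subset by blast
  have "Pr (U n) (\<lambda>x. \<forall>i\<in>A. x ! i) = Pr (map_pmf (\<lambda>x i. i \<in> A \<and> x ! i) (U n)) (\<lambda>\<omega>. \<forall>i\<in>A. \<omega> i)"
    unfolding Pr_map by simp
  also have "\<dots> = measure_pmf.prob (Pi_pmf A False (\<lambda>_. bernoulli_pmf (1 / 2))) (Pi A (\<lambda>_. {True}))"
    unfolding map_restrict_U[OF assms] by (rule arg_cong[where f = "measure_pmf.prob _"]) auto
  also have "\<dots> = (\<Prod>i\<in>A. measure_pmf.prob (bernoulli_pmf (1 / 2)) {True})"
    by (rule measure_Pi_pmf_Pi[OF fin])
  finally show ?thesis by (simp add: measure_pmf_single)
qed

lemma Pr_all_true_le:
  assumes "A \<subseteq> {..<n}" "L < card A"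
  shows "Pr (U n) (\<lambda>x. \<forall>i\<in>A. x ! i) \<le> (1 / 2) ^ (L + 1)"
  unfolding Pr_all_true[OF assms(1)] by (rule power_decreasing) (use assms(2) in auto)

context hashed_dnf
begin

lemma Pr_large_hit: "Pr (U r) large_hit \<le> real s * (1 / 2) ^ (L + 1)"
proof (rule Pr_Bex_le[OF C(1), where Q = "\<lambda>T y. L < card (h ` T) \<and> (\<forall>j\<in>h ` T. y ! j)"])
  show "Pr (U r) (\<lambda>y. L < card (h ` T) \<and> (\<forall>j\<in>h ` T. y ! j)) \<le> (1 / 2) ^ (L + 1)" if "T \<in> C" for T
  proof (cases "L < card (h ` T)")
    case True
    have "h ` T \<subseteq> {..<r}" using C(3)[OF that] h by auto
    from Pr_all_true_le[OF this True] True show ?thesis by simp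
  qed simp
qed (use C(2) in \<open>auto simp: large_hit_def sel_def\<close>)

definition missed :: "nat set set \<Rightarrow> bool list \<Rightarrow> bool" where
  "missed S y \<longleftrightarrow> F (sel y) \<and> \<not> (\<exists>T\<in>S. T \<subseteq> sel y)"

text \<open>
  The learned terms depend on the samples, so a union bound over all sets of terms is used.
\<close>

lemma Pr_learn_fails:
  assumes "0 \<le> e" "e \<le> 1"
  shows "Pr (replicate_pmf m (U r)) (\<lambda>ys. (\<exists>y\<in>set ys. large_hit y) \<or>
      (\<exists>S\<subseteq>(`) h ` C. e < Pr (U r) (missed S) \<and> (\<forall>y\<in>set ys. \<not> missed S y)))
    \<le> real m * (real s * (1 / 2) ^ (L + 1)) + 2 ^ s * (1 - e) ^ m"
proof -
  let ?Q = "\<lambda>S ys. e < Pr (U r) (missed S) \<and> (\<forall>y\<in>set ys. \<not> missed S y)"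
  have "Pr (replicate_pmf m (U r)) (\<lambda>ys. (\<exists>y\<in>set ys. large_hit y) \<or> (\<exists>S\<subseteq>(`) h ` C. ?Q S ys))
      \<le> Pr (replicate_pmf m (U r)) (\<lambda>ys. \<exists>y\<in>set ys. large_hit y) +
         Pr (replicate_pmf m (U r)) (\<lambda>ys. \<exists>S\<in>Pow ((`) h ` C). ?Q S ys)"
    by (rule Pr_disj) auto
  also have "Pr (replicate_pmf m (U r)) (\<lambda>ys. \<exists>S\<in>Pow ((`) h ` C). ?Q S ys) \<le> 2 ^ s * (1 - e) ^ m"
  proof (rule Pr_Bex_le[where I = "Pow ((`) h ` C)" and Q = ?Q])
    show "Pr (replicate_pmf m (U r)) (?Q S) \<le> (1 - e) ^ m" for S
    proof (cases "e < Pr (U r) (missed S)")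
      case True
      have "Pr (U r) (\<lambda>y. \<not> missed S y) ^ m \<le> (1 - e) ^ m"
        by (rule power_mono) (use True in \<open>auto simp only: Pr_not\<close>, auto)
      then show ?thesis using True unfolding Pr_replicate_all[symmetric] by simp
    qed (use assms in simp)
    have "card (Pow ((`) h ` C)) = 2 ^ card ((`) h ` C)" by (simp add: card_Pow C(1))
    also have "\<dots> \<le> 2 ^ s"
      using card_image_le[OF C(1), of "(`) h"] C(2) by (intro power_increasing) auto
    finally show "real (card (Pow ((`) h ` C))) \<le> 2 ^ s"
      by (metis of_nat_le_iff of_nat_numeral of_nat_power)
  qed (use C(1) assms in auto)
  also have "Pr (replicate_pmf m (U r)) (\<lambda>ys. \<exists>y\<in>set ys. large_hit y) \<le> real m * (real s * (1 / 2) ^ (L + 1))"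
    by (rule Pr_replicate_ex[OF Pr_large_hit])
  finally show ?thesis by simp
qed

text \<open>Apart from satisfied long terms, the failure \<open>R\<close> concerns short terms only
  and thus depends on the core. It has the same probability when the variables read random blocks
  through \<open>h\<close>, and there it implies \<open>missed\<close>.\<close>

lemma Pr_not_learned:
  assumes inj: "inj_on h core" and D: "\<And>T. T \<in> set D \<Longrightarrow> term_block T" and e: "Pr (U r) (missed (set D)) \<le> e"
  shows "Pr (U n) (\<lambda>x. f x \<and> \<not> (\<exists>T\<in>learned D. \<forall>i\<in>T. x ! i)) \<le> real s * (1 / 2) ^ (L + 1) + e"
proof -
  \<comment> \<open>As a predicate on assignments to variables, \<open>R\<close> applies both to an
    input \<open>x\<close> and to blocks read through \<open>h\<close>.\<close>
  define R where "R \<omega> \<longleftrightarrow> (\<exists>T\<in>C. card T \<le> L \<and> (\<forall>i\<in>T. \<omega> i)) \<and> \<not> (\<exists>T\<in>learned D. \<forall>i\<in>T. \<omega> i)" for \<omega> :: "nat \<Rightarrow> bool"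
  have small: "T \<subseteq> core" if "T \<in> C" "card T \<le> L" for T
    using cut(2)[OF that(2)] that(1) by (auto simp: core_def)
  have R_core: "R (\<lambda>i. i \<in> core \<and> \<omega> i) \<longleftrightarrow> R \<omega>" for \<omega>
  proof -
    have eq: "(\<forall>i\<in>T. i \<in> core \<and> \<omega> i) \<longleftrightarrow> (\<forall>i\<in>T. \<omega> i)" if "T \<in> C" "card T \<le> L" for T
      using small[OF that] by blast
    have "(\<exists>T\<in>C. card T \<le> L \<and> (\<forall>i\<in>T. i \<in> core \<and> \<omega> i)) \<longleftrightarrow> (\<exists>T\<in>C. card T \<le> L \<and> (\<forall>i\<in>T. \<omega> i))"
      using eq by blast
    moreover have "(\<exists>T\<in>learned D. \<forall>i\<in>T. i \<in> core \<and> \<omega> i) \<longleftrightarrow> (\<exists>T\<in>learned D. \<forall>i\<in>T. \<omega> i)"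
      by (rule bex_cong) (use eq in \<open>auto simp: learned_def\<close>)
    ultimately show ?thesis unfolding R_def by blast
  qed
  have "Pr (U n) (\<lambda>x. f x \<and> \<not> (\<exists>T\<in>learned D. \<forall>i\<in>T. x ! i)) \<le>
      Pr (U n) (\<lambda>x. \<exists>T\<in>C. L < card T \<and> (\<forall>i\<in>T. x ! i)) + Pr (U n) (\<lambda>x. R (\<lambda>i. x ! i))"
    by (rule Pr_disj) (simp add: R_def f dnf_val_def, meson not_le)
  also have "Pr (U n) (\<lambda>x. R (\<lambda>i. x ! i)) \<le> e"
  proof -
    have "Pr (U n) (\<lambda>x. R (\<lambda>i. x ! i)) = Pr (map_pmf (\<lambda>x i. i \<in> core \<and> x ! i) (U n)) R"
      unfolding Pr_map R_core ..
    also have "\<dots> = Pr (map_pmf (\<lambda>y i. i \<in> core \<and> y ! h i) (U r)) R"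
      by (subst map_hash_U[OF core_subset inj]) (use h core_subset in auto)
    also have "\<dots> = Pr (U r) (\<lambda>y. R (\<lambda>i. y ! h i))"
      unfolding Pr_map R_core ..
    also have "\<dots> \<le> Pr (U r) (missed (set D))"
    proof (rule Pr_mono)
      fix y assume y: "y \<in> set_pmf (U r)" and R: "R (\<lambda>i. y ! h i)"
      have sub: "h ` T \<subseteq> sel y \<longleftrightarrow> (\<forall>i\<in>T. y ! h i)" if "T \<in> C" for T
        using y C(3)[OF that] h by (auto simp: sel_def in_cube)
      have image: "\<exists>T0\<in>learned D. T = h ` T0" if "T \<in> set D" for T
        using D[OF that] that small_image[OF inj] by (auto simp: term_block_def learned_def)
      have "F (sel y)"
        using R sub unfolding R_def F by blast
      moreover have "\<not> T \<subseteq> sel y" if T: "T \<in> set D" for T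
      proof
        assume "T \<subseteq> sel y"
        with image[OF T] obtain T0 where "T0 \<in> learned D" "h ` T0 \<subseteq> sel y" by blast
        then show False using R sub[of T0] unfolding R_def learned_def by blast
      qed
      ultimately show "missed (set D) y" unfolding missed_def by blast
    qed
    finally show ?thesis using e by simp
  qed
  also have "Pr (U n) (\<lambda>x. \<exists>T\<in>C. L < card T \<and> (\<forall>i\<in>T. x ! i)) \<le> real s * (1 / 2) ^ (L + 1)"
  proof (rule Pr_Bex_le[OF C(1), where Q = "\<lambda>T x. L < card T \<and> (\<forall>i\<in>T. x ! i)"])
    show "Pr (U n) (\<lambda>x. L < card T \<and> (\<forall>i\<in>T. x ! i)) \<le> (1 / 2) ^ (L + 1)" if "T \<in> C" for T
      using Pr_all_true_le[OF C(3)[OF that], of L] by (cases "L < card T") auto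
  qed (use C(2) in auto)
  finally show ?thesis by simp
qed

text \<open>Only the point \<open>x\<close> of a row can cause its rejection, whatever the pairs
  are, so a union bound over the rows suffices.\<close>

lemma Pr_rows_rejected:
  assumes inj: "inj_on h core" and D: "\<And>T. T \<in> set D \<Longrightarrow> term_block T" and e: "Pr (U r) (missed (set D)) \<le> e"
  shows "Pr (replicate_pmf m (row_pmf n K)) (\<lambda>zs. \<not> (\<forall>z\<in>set zs. row_ok n f h D z))
    \<le> real m * (real s * (1 / 2) ^ (L + 1) + e)"
proof -
  let ?N = "\<lambda>x. f x \<and> \<not> (\<exists>T\<in>learned D. \<forall>i\<in>T. x ! i)"
  have "Pr (row_pmf n K) (\<lambda>z. \<not> row_ok n f h D z) \<le> Pr (row_pmf n K) (\<lambda>(x, cbs). ?N x)"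
  proof (rule Pr_mono)
    fix z assume z: "z \<in> set_pmf (row_pmf n K)" "\<not> row_ok n f h D z"
    obtain x cbs where zz: "z = (x, cbs)" by force
    have x: "x \<in> cube n" "set cbs \<subseteq> cube n \<times> cube n"
      using z(1) by (auto simp: row_pmf_def zz set_replicate_pmf)
    have "?N x"
    proof (rule ccontr)
      assume "\<not> ?N x"
      then have "round_ok n f h D x cb" if "cb \<in> set cbs" for cb
        using round_ok_learned[OF inj D x(1)] x(2) that by blast
      then show False using z(2) by (auto simp: row_ok_def zz)
    qed
    then show "case z of (x, cbs) \<Rightarrow> ?N x" by (simp add: zz)
  qed
  also have "\<dots> = Pr (U n) ?N" unfolding row_pmf_def by (rule Pr_fst)
  also have "\<dots> \<le> real s * (1 / 2) ^ (L + 1) + e" by (rule Pr_not_learned[OF inj D e])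
  finally have "Pr (replicate_pmf m (row_pmf n K)) (\<lambda>zs. \<exists>z\<in>set zs. \<not> row_ok n f h D z)
      \<le> real m * (real s * (1 / 2) ^ (L + 1) + e)"
    by (rule Pr_replicate_ex)
  then show ?thesis by simp
qed

end

section \<open>Random hash values and their collisions\<close>

definition horner :: "bool list \<Rightarrow> nat" where
  "horner bs = foldl (\<lambda>a b. 2 * a + of_bool b) 0 bs"

lemma horner_snoc: "horner (bs @ [b]) = 2 * horner bs + of_bool b"
  by (simp add: horner_def)

lemma horner_less: "horner bs < 2 ^ length bs"
proof (induction bs rule: rev_induct)
  case Nil
  then show ?case by (simp add: horner_def)
next
  case (snoc b bs)
  then show ?case by (cases b) (auto simp: horner_snoc)
qed

lemma horner_inj: "length bs = length cs \<Longrightarrow> horner bs = horner cs \<Longrightarrow> bs = cs"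
proof (induction bs arbitrary: cs rule: rev_induct)
  case (snoc b bs)
  then obtain cs' c where cs: "cs = cs' @ [c]" by (metis length_0_conv snoc_eq_iff_butlast)
  have eq: "2 * horner bs + of_bool b = 2 * horner cs' + of_bool c"
    using snoc.prems by (simp add: horner_snoc cs)
  have "x = y \<and> u = v" if "2 * x + u = 2 * y + v" "u \<le> 1" "v \<le> 1" for x y u v :: nat
    using that by presburger
  from this[OF eq] have "horner bs = horner cs' \<and> (of_bool b :: nat) = of_bool c" by simp
  then have "horner bs = horner cs'" "b = c" by (auto split: if_splits simp: of_bool_def)
  then show ?case using snoc by (simp add: cs)
qed simp

definition hash :: "bool list list \<Rightarrow> nat \<Rightarrow> nat" where
  "hash hs i = horner (hs ! i)"

lemma hash_less:
  "hs \<in> set_pmf (replicate_pmf n (U w)) \<Longrightarrow> i < n \<Longrightarrow> hash hs i < 2 ^ w"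
  using horner_less[of "hs ! i"] by (auto simp: hash_def set_replicate_pmf in_lists_conv_set in_cube)

lemma Pr_replicate_collision:
  assumes "i < j" "j < m" "\<And>v. pmf M v \<le> q" "0 \<le> q"
  shows "Pr (replicate_pmf m M) (\<lambda>xs. xs ! i = xs ! j) \<le> q"
  using assms(1,2)
proof (induction m arbitrary: i j)
  case (Suc m)
  then obtain j' where j: "j = Suc j'" by (cases j) auto
  show ?case
  proof (cases i)
    case 0
    \<comment> \<open>The tail is drawn first; the head then has to hit one fixed value.\<close>
    have "Pr (replicate_pmf (Suc m) M) (\<lambda>xs. xs ! i = xs ! j) = Pr (pair_pmf (replicate_pmf m M) M) (\<lambda>(xs, x). x = xs ! j')"
      unfolding replicate_pmf_Suc_pair Pr_map 0 j
      by (subst pair_commute_pmf) (simp add: case_prod_beta')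
    also have "\<dots> \<le> q"
      by (rule Pr_pair_le) (use assms(3,4) in \<open>auto simp: pmf.rep_eq\<close>)
    finally show ?thesis .
  next
    case (Suc i')
    have "Pr (replicate_pmf (Suc m) M) (\<lambda>xs. xs ! i = xs ! j) = Pr (pair_pmf M (replicate_pmf m M)) (\<lambda>(x, xs). xs ! i' = xs ! j')"
      unfolding replicate_pmf_Suc_pair Pr_map Suc j by (simp add: case_prod_beta')
    then show ?thesis unfolding Pr_snd using Suc.IH[of i' j'] Suc.prems Suc j by simp
  qed
qed simp

text \<open>A birthday bound. Distinct strings of \<open>w\<close> bits have distinct values, so a
  collision of hash values is an equality of random strings.\<close>

lemma Pr_hash_collision:
  assumes "A \<subseteq> {..<n}"
  shows "Pr (replicate_pmf n (U w)) (\<lambda>hs. \<not> inj_on (hash hs) A) \<le> real ((card A)\<^sup>2) * (1 / 2 ^ w)"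
proof -
  let ?I = "{(i, j) \<in> A \<times> A. i < j}"
  have fin: "finite A" using assms finite_subset by blast
  show ?thesis
  proof (rule Pr_Bex_le[where I = ?I and Q = "\<lambda>(i, j) hs. hs ! i = hs ! j"])
    show "finite ?I" by (rule finite_subset[of _ "A \<times> A"]) (use fin in auto)
    have "card ?I \<le> card (A \<times> A)" by (rule card_mono) (use fin in auto)
    then show "real (card ?I) \<le> real ((card A)\<^sup>2)"
      by (simp add: card_cartesian_product power2_eq_square flip: of_nat_mult)
    fix ij assume "ij \<in> ?I"
    then obtain i j where ij: "ij = (i, j)" "i < j" "j < n" using assms by auto
    show "Pr (replicate_pmf n (U w)) ((\<lambda>(i, j) hs. hs ! i = hs ! j) ij) \<le> 1 / 2 ^ w"
      unfolding ij prod.case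
      by (rule Pr_replicate_collision[OF ij(2,3)]) (auto simp: indicator_def card_cube)
  next
    fix hs assume hs: "hs \<in> set_pmf (replicate_pmf n (U w))" "\<not> inj_on (hash hs) A"
    then obtain i j where ij: "i \<in> A" "j \<in> A" "i < j" "hash hs i = hash hs j"
      by (metis inj_on_def linorder_neqE_nat)
    have "length (hs ! i') = w" if "i' \<in> A" for i'
      using hs(1) that assms by (auto simp: set_replicate_pmf in_lists_conv_set in_cube subset_iff)
    then have "hs ! i = hs ! j" using horner_inj ij by (auto simp: hash_def)
    then show "\<exists>ij\<in>?I. (\<lambda>(i, j) hs. hs ! i = hs ! j) ij hs" using ij by auto
  qed auto
qed

section \<open>The tester as a function of its coins\<close>

type_synonym coins = "bool list list \<times> bool list list \<times> (bool list \<times> (bool list \<times> bool list) list) list"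

text \<open>
  Here \<open>k = \<lceil>1 / \<epsilon>\<rceil>\<close> and \<open>2 ^ l \<ge> s * k\<close>. With \<open>2 ^ (4 * l + 13)\<close> blocks, collisions among the at most
  \<open>s * (2 * l + 19)\<close> variables that matter are unlikely, and so is it that any sample satisfies a term
  of more than \<open>2 * l + 18\<close> variables. The number of samples for learning beats the union bound over
  \<open>2 ^ s\<close> sets of terms at error \<open>1 / (4800 * k)\<close>, which the \<open>200 * k\<close> test rows do not notice.
\<close>

definition coins_pmf :: "nat \<Rightarrow> nat \<Rightarrow> nat \<Rightarrow> nat \<Rightarrow> coins pmf" where
  "coins_pmf n s k l =
     pair_pmf (replicate_pmf n (U (4 * l + 13)))
       (pair_pmf (replicate_pmf (19200 * (s * k)) (U (2 ^ (4 * l + 13))))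
         (replicate_pmf (200 * k) (row_pmf n (2 * l + 18))))"

definition accepts :: "nat \<Rightarrow> (bool list \<Rightarrow> bool) \<Rightarrow> nat \<Rightarrow> nat \<Rightarrow> coins \<Rightarrow> bool" where
  "accepts n f s l = (\<lambda>(hs, ys, zs).
     case learn (hashed n f (hash hs)) (2 * l + 18) (4 * l + 13) (2 ^ (4 * l + 13)) s ys of
       (D, bad) \<Rightarrow> \<not> bad \<and> (\<forall>z\<in>set zs. row_ok n f (hash hs) D z))"

lemma Suc_le_two_power: "l + 1 \<le> 2 ^ l"
  by (induction l) auto

text \<open>The bound holds for every hash and all samples, so only the coins of the test rows
  matter.\<close>

lemma accepts_sound:
  assumes far: "eps_far n \<epsilon> f (monotone_dnf n s)" and k: "1 / \<epsilon> \<le> real k" "\<epsilon> > 0" "1 \<le> k"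
    and l: "s * k \<le> 2 ^ l"
  shows "Pr (coins_pmf n s k l) (accepts n f s l) \<le> 1 / 3"
proof -
  let ?L = "2 * l + 18" and ?w = "4 * l + 13"
  \<comment> \<open>Here \<open>2 * l + 18\<close> is both the bound on term sizes and the number of
    rounds. By \<open>s * k \<le> 2 ^ l\<close> and \<open>l + 1 \<le> 2 ^ l\<close> the left side
    is at most \<open>36 * 2 ^ (2 * l)\<close>, and 36 is below 2^18.\<close>
  have K: "2 * s * ?L * k \<le> 2 ^ ?L"
  proof -
    have "2 * s * ?L * k = (s * k) * (2 * ?L)" by (simp add: algebra_simps)
    also have "\<dots> \<le> 2 ^ l * (36 * 2 ^ l)"
      by (rule mult_mono) (use l Suc_le_two_power[of l] in auto)
    also have "\<dots> \<le> 2 ^ ?L" by (simp add: power_add power_mult power2_eq_square flip: power_mult_distrib)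
    finally show ?thesis .
  qed
  have "Pr (replicate_pmf (200 * k) (row_pmf n ?L)) (\<lambda>zs. accepts n f s l (hs, ys, zs)) \<le> 1 / 3"
    if ys: "ys \<in> set_pmf (replicate_pmf (19200 * (s * k)) (U (2 ^ ?w)))" for hs ys
  proof -
    obtain D bad where D: "learn (hashed n f (hash hs)) ?L ?w (2 ^ ?w) s ys = (D, bad)" by force
    have "set ys \<subseteq> cube (2 ^ ?w)" using ys by (auto simp: set_replicate_pmf)
    from learn_size[OF this le_refl D]
    have D': "length D \<le> s" "\<And>T. T \<in> set D \<Longrightarrow> finite T \<and> card T \<le> ?L"
      by (auto intro: finite_subset)
    have "Pr (replicate_pmf (200 * k) (row_pmf n ?L)) (\<lambda>zs. accepts n f s l (hs, ys, zs)) \<le>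
        Pr (replicate_pmf (200 * k) (row_pmf n ?L)) (\<lambda>zs. \<forall>z\<in>set zs. row_ok n f (hash hs) D z)"
      by (rule Pr_mono) (simp add: accepts_def D)
    also have "\<dots> \<le> 1 / 3"
      by (rule Pr_far_accepted[OF far k D' _ K]) auto
    finally show ?thesis .
  qed
  then have "Pr (coins_pmf n s k l) (\<lambda>(hs, z). case z of (ys, zs) \<Rightarrow> accepts n f s l (hs, ys, zs)) \<le> 1 / 3"
    unfolding coins_pmf_def by (intro Pr_pair_le) auto
  then show ?thesis by (simp add: case_prod_beta')
qed

lemma two_power_exp_bound:
  assumes "1 \<le> s"
  shows "(2::real) ^ s * exp (- 4 * real s) \<le> 1 / 12"
proof -
  \<comment> \<open>The Taylor bound 1 + 2 + 2 = 5 on \<open>exp 2\<close> gives 25 for its square,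
    and 2/25 is below 1/12.\<close>
  have "25 \<le> (exp 2 :: real) * exp 2"
    using mult_mono[of 5 "exp 2 :: real" 5 "exp 2"] exp_lower_Taylor_quadratic[of 2] by simp
  then have e: "2 * exp (- 4 :: real) \<le> 1 / 12"
    by (simp add: exp_minus exp_add[symmetric] field_simps)
  have "(2::real) ^ s * exp (- 4 * real s) = (2 * exp (- 4)) ^ s"
    by (simp add: power_mult_distrib exp_of_nat_mult[symmetric] mult.commute)
  also have "\<dots> \<le> (2 * exp (- 4)) ^ 1"
    by (rule power_decreasing) (use assms e in auto)
  finally show ?thesis using e by simp
qed

lemma accepts_complete:
  assumes f: "f \<in> monotone_dnf n s" and sk: "1 \<le> s" "1 \<le> k" and l: "s * k \<le> 2 ^ l"
  shows "Pr (coins_pmf n s k l) (\<lambda>c. \<not> accepts n f s l c) \<le> 1 / 3"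
proof -
  define L where "L = 2 * l + 18"
  define w where "w = 4 * l + 13"
  define p where "p = (2::real) ^ l"
  \<comment> \<open>Over \<open>19200 * (s * k)\<close> samples this weight gives the exponent
    \<open>4 * s\<close>, and over \<open>200 * k\<close> rows it costs only 1/24.\<close>
  define e where "e = 1 / (4800 * real k)"
  define \<eta> where "\<eta> = real s * (1 / 2) ^ (L + 1)"
  have p: "1 \<le> p" "real (s * k) \<le> p"
  proof -
    show "1 \<le> p" by (simp add: p_def)
    have "real (s * k) \<le> real (2 ^ l)" using l by (simp only: of_nat_le_iff)
    then show "real (s * k) \<le> p" by (simp add: p_def)
  qed
  have sp: "real s \<le> p"
  proof -
    have "s * 1 \<le> s * k" using sk by (intro mult_left_mono) auto
    then show ?thesis using p(2) by (metis mult.right_neutral of_nat_mono order_trans)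
  qed
  have lp: "real l + 1 \<le> p"
    using Suc_le_two_power[of l] unfolding p_def by (metis of_nat_1 of_nat_add of_nat_mono of_nat_numeral of_nat_power)
  \<comment> \<open>524288 is 2^19 and, below, 8192 is 2^13.\<close>
  have powL: "(1 / 2) ^ (L + 1) = 1 / (524288 * p\<^sup>2)"
    by (simp add: L_def p_def power_add power_one_over power_mult[symmetric] mult.commute)
  have poww: "(2::real) ^ w = 8192 * p ^ 4"
    by (simp add: w_def p_def power_add power_mult[symmetric] mult.commute)
  from f obtain C where C: "finite C" "card C \<le> s" "\<And>T. T \<in> C \<Longrightarrow> T \<subseteq> {..<n}"
    "\<And>x. x \<in> cube n \<Longrightarrow> f x = dnf_val C x"
    by (auto simp: monotone_dnf_def)
  have e: "0 \<le> e" "e \<le> 1" using sk by (auto simp: e_def field_simps)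
  \<comment> \<open>The core depends on \<open>C\<close> and \<open>L\<close> only. A dummy hash
    makes it available before \<open>hs\<close> is drawn, so that the collision bound concerns a
    fixed set of variables.\<close>
  interpret H0: hashed_dnf n 1 L s f C "\<lambda>_. 0"
    by unfold_locales (use C in auto)
  have 1: "Pr (replicate_pmf n (U w)) (\<lambda>hs. \<not> inj_on (hash hs) H0.core) \<le> 1 / 12"
  proof -
    have "real (card H0.core) \<le> real (s * (L + 1))"
      using H0.card_core by (simp only: of_nat_le_iff)
    also have "\<dots> = real s * (2 * real l + 19)" by (simp add: L_def)
    also have "\<dots> \<le> p * (19 * p)"
      using sp lp by (intro mult_mono) auto
    finally have "real ((card H0.core)\<^sup>2) \<le> (19 * p\<^sup>2)\<^sup>2"
      unfolding of_nat_power by (intro power_mono) (auto simp: power2_eq_square)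
    then have "real ((card H0.core)\<^sup>2) * (1 / 2 ^ w) \<le> (19 * p\<^sup>2)\<^sup>2 * (1 / (8192 * p ^ 4))"
      unfolding poww by (intro mult_right_mono) auto
    also have "\<dots> = 361 / 8192"
      using p(1) by (simp add: power_mult_distrib flip: power_mult)
    finally show ?thesis using Pr_hash_collision[OF H0.core_subset, of w] by simp
  qed
  \<comment> \<open>One half of 1/6 covers samples that satisfy a large image, the other half the
    union bound over sets of terms.\<close>
  have 2: "Pr (replicate_pmf (19200 * (s * k)) (U (2 ^ w))) (\<lambda>ys. \<not> G ys) \<le> 1 / 6"
    if "Pr (replicate_pmf (19200 * (s * k)) (U (2 ^ w))) (\<lambda>ys. \<not> G ys)
       \<le> real (19200 * (s * k)) * \<eta> + 2 ^ s * (1 - e) ^ (19200 * (s * k))" for G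
  proof -
    have "real (19200 * (s * k)) * \<eta> \<le> 19200 * p * (p / (524288 * p\<^sup>2))"
      unfolding \<eta>_def powL using p sp by (intro mult_mono) (auto simp: divide_right_mono)
    also have "\<dots> = 19200 / 524288" using p(1) by (simp add: power2_eq_square)
    also have "\<dots> \<le> 1 / 12" by simp
    finally have a: "real (19200 * (s * k)) * \<eta> \<le> 1 / 12" .
    have "(1 - e) ^ (19200 * (s * k)) \<le> exp (- e) ^ (19200 * (s * k))"
      using exp_ge_add_one_self[of "- e"] e by (intro power_mono) auto
    also have "\<dots> = exp (- 4 * real s)"
      using sk by (simp add: exp_of_nat_mult[symmetric] e_def)
    finally have "2 ^ s * (1 - e) ^ (19200 * (s * k)) \<le> 2 ^ s * exp (- 4 * real s)"
      by (intro mult_left_mono) auto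
    also have "\<dots> \<le> 1 / 12" by (rule two_power_exp_bound[OF sk(1)])
    finally show ?thesis using that a by simp
  qed
  have 3: "real (200 * k) * (\<eta> + e) \<le> 1 / 12"
  proof -
    have "real (200 * k) * \<eta> = 200 * real (s * k) / (524288 * p\<^sup>2)"
      unfolding \<eta>_def powL by simp
    also have "\<dots> \<le> 200 * p\<^sup>2 / (524288 * p\<^sup>2)"
      using p by (intro divide_right_mono mult_left_mono) (auto intro: order_trans simp: power2_eq_square)
    also have "\<dots> = 200 / 524288" using p(1) by simp
    also have "\<dots> \<le> 1 / 24" by simp
    finally have "real (200 * k) * \<eta> \<le> 1 / 24" .
    moreover have "real (200 * k) * e = 1 / 24" using sk by (simp add: e_def)
    ultimately show ?thesis by (simp add: distrib_left)
  qed
  have hs: "Pr (pair_pmf (replicate_pmf (19200 * (s * k)) (U (2 ^ w))) (replicate_pmf (200 * k) (row_pmf n L)))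
      (\<lambda>(ys, zs). \<not> accepts n f s l (hs, ys, zs)) \<le> 1 / 6 + 1 / 12"
    if hs: "hs \<in> set_pmf (replicate_pmf n (U w))" "inj_on (hash hs) H0.core" for hs
  proof -
    interpret hashed_dnf n "2 ^ w" L s f C "hash hs"
      by unfold_locales (use C hash_less[OF hs(1)] in auto)
    \<comment> \<open>The two cores unfold to the same set.\<close>
    have inj: "inj_on (hash hs) core" using hs(2) by (simp add: core_def cut_def H0.core_def H0.cut_def)
    define G where "G ys \<longleftrightarrow> \<not> ((\<exists>y\<in>set ys. large_hit y) \<or>
      (\<exists>S\<subseteq>(`) (hash hs) ` C. e < Pr (U (2 ^ w)) (missed S) \<and> (\<forall>y\<in>set ys. \<not> missed S y)))" for ys
    have G: "Pr (replicate_pmf (19200 * (s * k)) (U (2 ^ w))) (\<lambda>ys. \<not> G ys) \<le> 1 / 6"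
      by (rule 2) (use Pr_learn_fails[OF e] in \<open>simp only: G_def not_not \<eta>_def\<close>)
    show ?thesis
      unfolding pair_pmf_def
    proof (rule Pr_bind_le[OF G])
      fix ys assume ys: "ys \<in> set_pmf (replicate_pmf (19200 * (s * k)) (U (2 ^ w)))" "G ys"
      obtain D bad where D: "learn F L w (2 ^ w) s ys = (D, bad)" by force
      have ysc: "set ys \<subseteq> cube (2 ^ w)" using ys(1) by (auto simp: set_replicate_pmf)
      have "\<not> bad \<and> distinct D \<and> (\<forall>T\<in>set D. term_block T) \<and>
          (\<forall>y\<in>set ys. F (sel y) \<longrightarrow> (\<exists>T\<in>set D. T \<subseteq> sel y))"
        by (rule learn_correct[OF ysc _ le_refl D]) (use ys(2) in \<open>auto simp: G_def\<close>)
      then have L: "\<not> bad" "\<And>T. T \<in> set D \<Longrightarrow> term_block T" "\<And>y. y \<in> set ys \<Longrightarrow> \<not> missed (set D) y"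
        by (auto simp: missed_def)
      have "set D \<subseteq> (`) (hash hs) ` C" using L(2) unfolding term_block_def by blast
      then have "Pr (U (2 ^ w)) (missed (set D)) \<le> e"
        using ys(2) L(3) unfolding G_def by (meson not_less)
      from Pr_rows_rejected[OF inj L(2) this, of "200 * k" L] 3
      have "Pr (replicate_pmf (200 * k) (row_pmf n L)) (\<lambda>zs. \<not> (\<forall>z\<in>set zs. row_ok n f (hash hs) D z)) \<le> 1 / 12"
        by (simp add: \<eta>_def)
      moreover have "accepts n f s l (hs, ys, zs) \<longleftrightarrow> (\<forall>z\<in>set zs. row_ok n f (hash hs) D z)" for zs
        using D L(1) by (simp add: accepts_def L_def w_def)
      ultimately show "Pr (bind_pmf (replicate_pmf (200 * k) (row_pmf n L)) (\<lambda>zs. return_pmf (ys, zs)))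
          (\<lambda>(ys, zs). \<not> accepts n f s l (hs, ys, zs)) \<le> 1 / 12"
        by (simp add: map_pmf_def[symmetric])
    qed simp
  qed
  have "Pr (coins_pmf n s k l) (\<lambda>(hs, z). case z of (ys, zs) \<Rightarrow> \<not> accepts n f s l (hs, ys, zs)) \<le> 1 / 12 + (1 / 6 + 1 / 12)"
    unfolding coins_pmf_def pair_pmf_def[of "replicate_pmf n _"] L_def[symmetric] w_def[symmetric]
  proof (rule Pr_bind_le[OF 1])
    fix hs assume "hs \<in> set_pmf (replicate_pmf n (U w))" "inj_on (hash hs) H0.core"
    from hs[OF this] show "Pr (bind_pmf (pair_pmf (replicate_pmf (19200 * (s * k)) (U (2 ^ w))) (replicate_pmf (200 * k) (row_pmf n L)))
        (\<lambda>z. return_pmf (hs, z))) (\<lambda>(hs, z). case z of (ys, zs) \<Rightarrow> \<not> accepts n f s l (hs, ys, zs)) \<le> 1 / 6 + 1 / 12"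
      by (simp add: map_pmf_def[symmetric])
  qed simp
  then show ?thesis by (simp add: case_prod_beta')
qed

section \<open>The program\<close>

abbreviation Nz :: "aexp \<Rightarrow> bexp" where
  "Nz a \<equiv> Less (Num 0) a"

abbreviation Eq :: "aexp \<Rightarrow> aexp \<Rightarrow> bexp" where
  "Eq a b \<equiv> BAnd (BNot (Less a b)) (BNot (Less b a))"

abbreviation set0 :: "string \<Rightarrow> aexp \<Rightarrow> prog" where
  "set0 x a \<equiv> Set x (Num 0) a"

definition hash_prog :: prog where
  "hash_prog = For ''i'' ''n'' (
     Set ''h'' (V ''i'') (Num 0) ;;
     For ''b'' ''hb'' (
       Set ''h'' (V ''i'') (Plus (Plus (Cell ''h'' (V ''i'')) (Cell ''h'' (V ''i''))) (Cell ''R'' (V ''ptr''))) ;;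
       set0 ''ptr'' (Plus (V ''ptr'') (Num 1))))"

text \<open>The offsets \<open>t * r\<close> of the rows of the table \<open>D\<close>, tabulated by
  addition because the machine cannot multiply.\<close>

definition rb_prog :: prog where
  "rb_prog = For ''t'' ''s'' (
     Set ''rb'' (Plus (V ''t'') (Num 1)) (Plus (Cell ''rb'' (V ''t'')) (V ''r'')))"

text \<open>One routine evaluates \<open>F\<close> wherever it is needed: \<open>mid = 0\<close>
  asks for \<open>T\<close>, \<open>mid = r\<close> with empty \<open>T\<close> asks for
  \<open>Y\<close>, and other values give the sets of the binary search.\<close>

definition ask_blocks :: prog where
  "ask_blocks =
     For ''i'' ''n'' (
       If (BAnd (Less (Cell ''h'' (V ''i'')) (V ''mid'')) (Nz (Cell ''Y'' (Cell ''h'' (V ''i'')))))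
         (Set ''W'' (V ''i'') (Num 1))
         (Set ''W'' (V ''i'') (Cell ''T'' (Cell ''h'' (V ''i''))))) ;;
     Ask ''q'' (Num 0) ''W''"

definition bisect_prog :: prog where
  "bisect_prog = For ''g'' ''hb'' (
     set0 ''mid'' (Div (Plus (V ''lo'') (V ''hi'')) (Num 2)) ;; ask_blocks ;;
     If (Nz (V ''q'')) (set0 ''hi'' (V ''mid'')) (set0 ''lo'' (V ''mid'')))"

definition extend_prog :: prog where
  "extend_prog =
     set0 ''mid'' (Num 0) ;; ask_blocks ;;
     If (Nz (V ''q'')) Nop (
       set0 ''lo'' (Num 0) ;; set0 ''hi'' (V ''b'') ;; bisect_prog ;;
       Set ''T'' (V ''lo'') (Num 1) ;; set0 ''b'' (V ''lo''))"

definition clear_prog :: prog where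
  "clear_prog = For ''j'' ''r'' (Set ''T'' (V ''j'') (Num 0))"

definition find_prog :: prog where
  "find_prog =
     clear_prog ;; set0 ''b'' (V ''r'') ;; For ''e'' ''L'' extend_prog ;;
     set0 ''mid'' (Num 0) ;; ask_blocks"

definition eval_prog :: prog where
  "eval_prog =
     set0 ''v'' (Num 0) ;;
     For ''d'' ''s'' (If (Less (V ''d'') (V ''nd'')) (
       set0 ''c'' (Num 1) ;;
       For ''j'' ''r'' (
         If (BAnd (Nz (Cell ''D'' (Plus (Cell ''rb'' (V ''d'')) (V ''j'')))) (BNot (Nz (Cell ''Y'' (V ''j'')))))
           (set0 ''c'' (Num 0)) Nop) ;;
       If (Nz (V ''c'')) (set0 ''v'' (Num 1)) Nop) Nop)"

definition save_prog :: prog where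
  "save_prog =
     For ''j'' ''r'' (Set ''D'' (Plus (Cell ''rb'' (V ''nd'')) (V ''j'')) (Cell ''T'' (V ''j''))) ;;
     set0 ''nd'' (Plus (V ''nd'') (Num 1))"

definition add_prog :: prog where
  "add_prog =
     If (Less (V ''nd'') (V ''s''))
       (find_prog ;; If (Nz (V ''q'')) Nop (set0 ''bad'' (Num 1)) ;; save_prog)
       (set0 ''bad'' (Num 1))"

definition sample_prog :: prog where
  "sample_prog =
     For ''j'' ''r'' (Set ''Y'' (V ''j'') (Cell ''R'' (Plus (V ''ptr'') (V ''j'')))) ;;
     set0 ''ptr'' (Plus (V ''ptr'') (V ''r'')) ;;
     clear_prog ;; set0 ''mid'' (V ''r'') ;; ask_blocks ;; eval_prog ;;
     If (BAnd (Nz (V ''q'')) (BNot (Nz (V ''v'')))) add_prog Nop"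

definition learn_prog :: prog where
  "learn_prog = For ''t'' ''m1'' sample_prog"

definition ask_literal :: "string \<Rightarrow> aexp \<Rightarrow> prog" where
  "ask_literal x z =
     For ''i'' ''n'' (
       If (Eq (Cell ''h'' (V ''i'')) (V ''j'')) (Set ''W'' (V ''i'') z)
         (Set ''W'' (V ''i'') (Cell ''D'' (Plus (Cell ''rb'' (V ''d'')) (Cell ''h'' (V ''i'')))))) ;;
     Ask x (Num 0) ''W''"

text \<open>Bit \<open>i\<close> of each of the three points of a round: \<open>x\<close> starts at
  \<open>px\<close>, \<open>c\<close> at \<open>ptr\<close>, and \<open>b\<close> right after
  \<open>c\<close>.\<close>

abbreviation X_bit :: aexp where
  "X_bit \<equiv> Cell ''R'' (Plus (V ''px'') (V ''i''))"

abbreviation C_bit :: aexp where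
  "C_bit \<equiv> Cell ''R'' (Plus (V ''ptr'') (V ''i''))"

abbreviation B_bit :: aexp where
  "B_bit \<equiv> Cell ''R'' (Plus (Plus (V ''ptr'') (V ''n'')) (V ''i''))"

text \<open>Exclusive or of bits is addition modulo 2, and conjunction is half of the sum, rounded
  down. The value \<open>q2\<close> at \<open>x\<close> also serves to evaluate the term, through
  the flag \<open>c\<close>.\<close>

definition dict_prog :: prog where
  "dict_prog =
     ask_literal ''q0'' B_bit ;;
     ask_literal ''q1'' (Mod (Plus B_bit X_bit) (Num 2)) ;;
     ask_literal ''q2'' X_bit ;;
     ask_literal ''q3'' (Mod (Plus B_bit (Num 1)) (Num 2)) ;;
     ask_literal ''q4'' (Mod (Plus B_bit (Div (Plus X_bit C_bit) (Num 2))) (Num 2)) ;;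
     If (BAnd (Eq (Mod (Plus (V ''q0'') (V ''q2'')) (Num 2)) (V ''q1''))
          (BAnd (BNot (Eq (V ''q0'') (V ''q3'')))
            (BNot (BAnd (Eq (V ''q0'') (V ''q1'')) (BNot (Eq (V ''q0'') (V ''q4'')))))))
       Nop (set0 ''bad'' (Num 1)) ;;
     If (Nz (V ''q2'')) Nop (set0 ''c'' (Num 0))"

definition term_prog :: prog where
  "term_prog =
     set0 ''c'' (Num 1) ;;
     For ''j'' ''r'' (If (Nz (Cell ''D'' (Plus (Cell ''rb'' (V ''d'')) (V ''j'')))) dict_prog Nop) ;;
     If (Nz (V ''c'')) (set0 ''v'' (Num 1)) Nop"

definition round_prog :: prog where
  "round_prog =
     set0 ''v'' (Num 0) ;;
     For ''d'' ''s'' (If (Less (V ''d'') (V ''nd'')) term_prog Nop) ;;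
     If (Eq (V ''v'') (V ''fx'')) Nop (set0 ''bad'' (Num 1)) ;;
     set0 ''ptr'' (Plus (Plus (V ''ptr'') (V ''n'')) (V ''n''))"

definition row_prog :: prog where
  "row_prog =
     set0 ''px'' (V ''ptr'') ;;
     For ''i'' ''n'' (Set ''W'' (V ''i'') (Cell ''R'' (Plus (V ''ptr'') (V ''i'')))) ;;
     Ask ''fx'' (Num 0) ''W'' ;;
     set0 ''ptr'' (Plus (V ''ptr'') (V ''n'')) ;;
     For ''e'' ''L'' round_prog"

definition test_prog :: prog where
  "test_prog = For ''t'' ''m2'' row_prog"

definition main_prog :: prog where
  "main_prog =
     hash_prog ;; rb_prog ;; learn_prog ;; test_prog ;;
     If (Nz (V ''bad'')) Nop (set0 ''out'' (Num 1))"

lemmas prog_defs = hash_prog_def rb_prog_def ask_blocks_def bisect_prog_def extend_prog_def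
  clear_prog_def find_prog_def eval_prog_def save_prog_def add_prog_def sample_prog_def learn_prog_def
  ask_literal_def dict_prog_def term_prog_def round_prog_def row_prog_def test_prog_def main_prog_def

lemma wf_main_prog: "wf_prog main_prog"
  by (simp add: prog_defs)

lemma bounds_main_prog: "bounds main_prog \<subseteq> {''n'', ''hb'', ''s'', ''r'', ''L'', ''m1'', ''m2''}"
  by (simp add: prog_defs)

lemma mods_main_prog: "bounds main_prog \<inter> mods main_prog = {}"
  by (simp add: prog_defs)

section \<open>Correctness of the program\<close>

text \<open>An invariant rule that carries a query count along. Arrays that the body does not modify
  are handed to the induction step as equations, so invariants mention only what changes; the last
  premise allows the loop to reset its counter.\<close>

lemma For_rule:
  assumes "J 0 m 0"
    and "\<And>i m' q. i < m v 0 \<Longrightarrow> (\<And>y. y \<noteq> x \<Longrightarrow> y \<notin> mods p \<Longrightarrow> m' y = m y) \<Longrightarrow> m' x 0 = i \<Longrightarrow>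
      J i m' q \<Longrightarrow> J (Suc i) (ev n f p m') (q + qc n f p m')"
    and "\<And>i m' q k. J i m' q \<Longrightarrow> J i (put m' x 0 k) q"
  shows "J (m v 0) (ev n f (For x v p) m) (qc n f (For x v p) m)"
proof -
  let ?l = "loop (ev n f p) x m"
  have "J i (?l i) (\<Sum>i<i. qc n f p (put (?l i) x 0 i))" if "i \<le> m v 0" for i
    using that
  proof (induction i)
    case 0
    then show ?case using assms(1) by simp
  next
    case (Suc i)
    have "J (Suc i) (ev n f p (put (?l i) x 0 i)) ((\<Sum>i<i. qc n f p (put (?l i) x 0 i)) + qc n f p (put (?l i) x 0 i))"
    proof (rule assms(2))
      show "put (?l i) x 0 i y = m y" if "y \<noteq> x" "y \<notin> mods p" for y
        using that by (simp add: put_row loop_frame ev_frame)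
      show "J i (put (?l i) x 0 i) (\<Sum>i<i. qc n f p (put (?l i) x 0 i))"
        by (rule assms(3)) (use Suc in simp)
      show "put (?l i) x 0 i x 0 = i" by (simp add: put_apply)
    qed (use Suc in simp)
    then show ?case by simp
  qed
  then show ?thesis using assms(3) by simp
qed

primrec asks :: "prog \<Rightarrow> bool" where
  "asks Nop = False"
| "asks (Set x i a) = False"
| "asks (Ask x i y) = True"
| "asks (p ;; q) = (asks p \<or> asks q)"
| "asks (If b p q) = (asks p \<or> asks q)"
| "asks (For x v p) = asks p"

lemma qc_no_asks: "\<not> asks p \<Longrightarrow> qc n f p m = 0"
  by (induction p arbitrary: m) auto

lemma For_fill:
  assumes "\<And>i m'. i < m v 0 \<Longrightarrow> (\<And>y. y \<noteq> x \<Longrightarrow> y \<notin> mods p \<Longrightarrow> m' y = m y) \<Longrightarrow> m' x 0 = i \<Longrightarrow>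
      ev n f p m' W = (m' W)(off + i := g i)"
    and "x \<noteq> W"
  shows "ev n f (For x v p) m W = (\<lambda>j. if off \<le> j \<and> j < off + m v 0 then g (j - off) else m W j)"
proof (rule For_rule[where J = "\<lambda>i m' q. m' W = (\<lambda>j. if off \<le> j \<and> j < off + i then g (j - off) else m W j)"])
  fix i m' and q :: nat
  assume "i < m v 0" "\<And>y. y \<noteq> x \<Longrightarrow> y \<notin> mods p \<Longrightarrow> m' y = m y" "m' x 0 = i"
    "m' W = (\<lambda>j. if off \<le> j \<and> j < off + i then g (j - off) else m W j)"
  with assms(1)[OF this(1-3)] show "ev n f p m' W = (\<lambda>j. if off \<le> j \<and> j < off + Suc i then g (j - off) else m W j)"
    by (auto simp: fun_eq_iff)
qed (use assms(2) in \<open>auto simp: put_row\<close>)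

lemma put_same: "put m x i v x = (m x)(i := v)"
  by (simp add: put_def)

definition nz :: "(nat \<Rightarrow> nat) \<Rightarrow> nat set" where
  "nz a = {j. a j \<noteq> 0}"

lemma nz_upd: "nz (a(k := Suc 0)) = insert k (nz a)"
  by (auto simp: nz_def)

lemma mods_ask_blocks [simp]: "mods ask_blocks = {''i'', ''W'', ''q''}"
  by (auto simp: ask_blocks_def)

lemma qc_ask_blocks [simp]: "qc n f ask_blocks m = 1"
  by (simp add: ask_blocks_def)

lemma ask_blocks:
  assumes "m ''n'' 0 = n"
  shows "ev n f ask_blocks m ''q'' 0 =
    of_bool (hashed n f (m ''h'') (nz (m ''T'') \<union> (nz (m ''Y'') \<inter> {..<m ''mid'' 0})))"
proof -
  let ?p = "If (BAnd (Less (Cell ''h'' (V ''i'')) (V ''mid'')) (Nz (Cell ''Y'' (Cell ''h'' (V ''i'')))))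
         (Set ''W'' (V ''i'') (Num 1))
         (Set ''W'' (V ''i'') (Cell ''T'' (Cell ''h'' (V ''i''))))"
  have "ev n f (For ''i'' ''n'' ?p) m ''W'' = (\<lambda>j. if 0 \<le> j \<and> j < 0 + m ''n'' 0 then
      (if m ''h'' j < m ''mid'' 0 \<and> m ''Y'' (m ''h'' j) \<noteq> 0 then 1 else m ''T'' (m ''h'' j)) else m ''W'' j)"
    by (subst For_fill[where off = 0 and g = "\<lambda>j. if m ''h'' j < m ''mid'' 0 \<and> m ''Y'' (m ''h'' j) \<noteq> 0 then 1 else m ''T'' (m ''h'' j)"])
       (auto simp: put_def)
  then have eq: "map (\<lambda>j. ev n f (For ''i'' ''n'' ?p) m ''W'' j \<noteq> 0) [0..<n] =
      map (\<lambda>i. m ''h'' i \<in> nz (m ''T'') \<union> (nz (m ''Y'') \<inter> {..<m ''mid'' 0})) [0..<n]"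
    using assms by (auto simp: nz_def)
  show ?thesis
    unfolding ask_blocks_def hashed_def ev.simps(3,4) eq by (simp add: put_apply)
qed

lemma mods_clear_prog [simp]: "mods clear_prog = {''j'', ''T''}"
  by (auto simp: clear_prog_def)

lemma qc_clear_prog [simp]: "qc n f clear_prog m = 0"
  by (rule qc_no_asks) (simp add: clear_prog_def)

lemma clear_prog:
  assumes "nz (m ''T'') \<subseteq> {..<m ''r'' 0}"
  shows "nz (ev n f clear_prog m ''T'') = {}"
proof -
  have "ev n f clear_prog m ''T'' = (\<lambda>j. if 0 \<le> j \<and> j < 0 + m ''r'' 0 then 0 else m ''T'' j)"
    unfolding clear_prog_def
    by (subst For_fill[where off = 0 and g = "\<lambda>j. 0"]) (auto simp: put_def)
  then show ?thesis using assms by (auto simp: nz_def)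
qed

lemma mods_bisect_prog [simp]: "mods bisect_prog = {''g'', ''mid'', ''i'', ''W'', ''q'', ''hi'', ''lo''}"
  by (auto simp: bisect_prog_def)

lemma mods_extend_prog [simp]:
  "mods extend_prog = {''g'', ''mid'', ''i'', ''W'', ''q'', ''hi'', ''lo'', ''T'', ''b''}"
  by (auto simp: extend_prog_def)

lemma mods_find_prog [simp]:
  "mods find_prog = {''e'', ''j'', ''g'', ''mid'', ''i'', ''W'', ''q'', ''hi'', ''lo'', ''T'', ''b''}"
  by (auto simp: find_prog_def)

lemma mods_eval_prog [simp]: "mods eval_prog = {''v'', ''d'', ''c'', ''j''}"
  by (auto simp: eval_prog_def)

lemma qc_eval_prog [simp]: "qc n f eval_prog m = 0"
  by (rule qc_no_asks) (simp add: eval_prog_def)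

lemma mods_save_prog [simp]: "mods save_prog = {''j'', ''D'', ''nd''}"
  by (auto simp: save_prog_def)

lemma qc_save_prog [simp]: "qc n f save_prog m = 0"
  by (rule qc_no_asks) (simp add: save_prog_def)

lemma mods_ask_literal [simp]: "mods (ask_literal x z) = {''i'', ''W'', x}"
  by (auto simp: ask_literal_def)

lemma qc_ask_literal [simp]: "qc n f (ask_literal x z) m = 1"
  by (simp add: ask_literal_def)

section \<open>Learning on the machine\<close>

definition env_vars :: "string set" where
  "env_vars = {''n'', ''r'', ''s'', ''L'', ''hb'', ''h'', ''R'', ''rb''}"

text \<open>The hash table, the coins and the row offsets are in place before learning starts and
  stay constant afterwards; \<open>env\<close> says that the memory holds them.\<close>

locale machine =
  fixes n r s L w :: nat and f :: "bool list \<Rightarrow> bool" and h R rb :: "nat \<Rightarrow> nat"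
  assumes h: "\<And>i. i < n \<Longrightarrow> h i < r" and rb: "\<And>d. d \<le> s \<Longrightarrow> rb d = d * r" and rw: "r \<le> 2 ^ w"
begin

definition env :: "memory \<Rightarrow> bool" where
  "env m \<longleftrightarrow> m ''n'' 0 = n \<and> m ''r'' 0 = r \<and> m ''s'' 0 = s \<and> m ''L'' 0 = L \<and> m ''hb'' 0 = w \<and>
     m ''h'' = h \<and> m ''R'' = R \<and> m ''rb'' = rb"

lemma envD: "env m \<Longrightarrow> m ''n'' 0 = n" "env m \<Longrightarrow> m ''r'' 0 = r" "env m \<Longrightarrow> m ''s'' 0 = s"
  "env m \<Longrightarrow> m ''L'' 0 = L" "env m \<Longrightarrow> m ''hb'' 0 = w" "env m \<Longrightarrow> m ''h'' = h" "env m \<Longrightarrow> m ''R'' = R"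
  "env m \<Longrightarrow> m ''rb'' = rb"
  by (simp_all add: env_def)

lemma env_frame: "env m \<Longrightarrow> (\<And>y. y \<in> env_vars \<Longrightarrow> m' y = m y) \<Longrightarrow> env m'"
  by (simp add: env_def env_vars_def)

lemma env_ev: "env m \<Longrightarrow> mods p \<inter> env_vars = {} \<Longrightarrow> env (ev n f p m)"
  by (erule env_frame) (auto intro!: ev_frame)

lemma env_put: "env m \<Longrightarrow> x \<notin> env_vars \<Longrightarrow> env (put m x i k)"
  by (erule env_frame) (auto intro!: put_row)

abbreviation "F \<equiv> hashed n f h"

lemma ask_env:
  assumes "env m"
  shows "ev n f ask_blocks m ''q'' 0 = of_bool (F (nz (m ''T'') \<union> (nz (m ''Y'') \<inter> {..<m ''mid'' 0})))"
  using ask_blocks[of m n f] envD[OF assms] by simp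

lemma bisect_prog:
  assumes "env m"
  shows "ev n f bisect_prog m ''lo'' 0 =
      fst ((bisect F (nz (m ''T'')) (nz (m ''Y'')) ^^ w) (m ''lo'' 0, m ''hi'' 0)) \<and> qc n f bisect_prog m = w"
proof -
  let ?B = "bisect F (nz (m ''T'')) (nz (m ''Y''))"
  let ?p = "set0 ''mid'' (Div (Plus (V ''lo'') (V ''hi'')) (Num 2)) ;; ask_blocks ;;
     If (Nz (V ''q'')) (set0 ''hi'' (V ''mid'')) (set0 ''lo'' (V ''mid''))"
  let ?J = "\<lambda>i m' q. (m' ''lo'' 0, m' ''hi'' 0) = (?B ^^ i) (m ''lo'' 0, m ''hi'' 0) \<and> q = i"
  have "?J (m ''hb'' 0) (ev n f bisect_prog m) (qc n f bisect_prog m)"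
    unfolding bisect_prog_def
  proof (rule For_rule[where J = ?J])
    fix i m' and q :: nat
    assume fr: "\<And>y. y \<noteq> ''g'' \<Longrightarrow> y \<notin> mods ?p \<Longrightarrow> m' y = m y" and J: "?J i m' q"
    define m1 where "m1 = put m' ''mid'' 0 ((m' ''lo'' 0 + m' ''hi'' 0) div 2)"
    define m2 where "m2 = ev n f ask_blocks m1"
    have "env m1" unfolding m1_def
      by (rule env_put, rule env_frame[OF assms]) (auto simp: env_vars_def intro!: fr)
    then have q: "m2 ''q'' 0 = of_bool (F (nz (m ''T'') \<union> (nz (m ''Y'') \<inter> {..<(m' ''lo'' 0 + m' ''hi'' 0) div 2})))"
      using fr unfolding m2_def by (simp add: ask_env m1_def put_apply put_row)
    have m2: "m2 ''lo'' 0 = m' ''lo'' 0" "m2 ''hi'' 0 = m' ''hi'' 0" "m2 ''mid'' 0 = (m' ''lo'' 0 + m' ''hi'' 0) div 2"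
      by (simp_all add: m2_def ev_frame m1_def put_apply)
    have ev: "ev n f ?p m' = (if m2 ''q'' 0 \<noteq> 0 then put m2 ''hi'' 0 (m2 ''mid'' 0) else put m2 ''lo'' 0 (m2 ''mid'' 0))"
      by (simp add: m2_def m1_def)
    have "(ev n f ?p m' ''lo'' 0, ev n f ?p m' ''hi'' 0) = ?B (m' ''lo'' 0, m' ''hi'' 0)"
      unfolding ev by (simp add: q m2 put_apply bisect_def Let_def)
    then show "?J (Suc i) (ev n f ?p m') (q + qc n f ?p m')" using J by simp
  qed (auto simp: put_apply)
  then show ?thesis using envD[OF assms] by (metis fst_conv)
qed

lemma extend_prog:
  assumes "env m"
  shows "(nz (ev n f extend_prog m ''T''), ev n f extend_prog m ''b'' 0) =
      extend F w (nz (m ''Y'')) (nz (m ''T''), m ''b'' 0) \<and> qc n f extend_prog m \<le> 1 + w"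
proof -
  define m1 where "m1 = ev n f ask_blocks (put m ''mid'' 0 0)"
  define m2 where "m2 = put (put m1 ''lo'' 0 0) ''hi'' 0 (m1 ''b'' 0)"
  define m3 where "m3 = ev n f bisect_prog m2"
  have "env (put m ''mid'' 0 0)" by (rule env_put[OF assms]) (simp add: env_vars_def)
  then have q: "m1 ''q'' 0 = of_bool (F (nz (m ''T'')))" and e1: "env m1"
    unfolding m1_def by (auto simp: ask_env put_apply put_row env_vars_def intro!: env_ev)
  have e2: "env m2" unfolding m2_def by (intro env_put e1) (auto simp: env_vars_def)
  have fr: "m1 ''T'' = m ''T''" "m1 ''Y'' = m ''Y''" "m1 ''b'' 0 = m ''b'' 0"
    "m2 ''T'' = m ''T''" "m2 ''Y'' = m ''Y''" "m2 ''lo'' 0 = 0" "m2 ''hi'' 0 = m ''b'' 0"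
    "m3 ''T'' = m ''T''"
    by (simp_all add: m1_def m2_def m3_def ev_frame put_row put_apply)
  have lo: "m3 ''lo'' 0 = fst ((bisect F (nz (m ''T'')) (nz (m ''Y'')) ^^ w) (0, m ''b'' 0))"
    "qc n f bisect_prog m2 = w"
    using bisect_prog[OF e2] by (auto simp: m3_def fr)
  have ev: "ev n f extend_prog m =
      (if m1 ''q'' 0 \<noteq> 0 then m1 else put (put m3 ''T'' (m3 ''lo'' 0) 1) ''b'' 0 (m3 ''lo'' 0))"
    by (simp add: extend_prog_def m1_def m2_def m3_def put_apply)
  have qc: "qc n f extend_prog m = (if m1 ''q'' 0 \<noteq> 0 then 1 else 1 + qc n f bisect_prog m2)"
    by (simp add: extend_prog_def m1_def m2_def put_apply)
  have T: "nz (put m3 ''T'' k (Suc 0) ''T'') = insert k (nz (m ''T''))" for k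
    unfolding put_same fr nz_upd ..
  let ?lo = "fst ((bisect F (nz (m ''T'')) (nz (m ''Y'')) ^^ w) (0, m ''b'' 0))"
  have "nz (ev n f extend_prog m ''T'') = (if F (nz (m ''T'')) then nz (m ''T'') else insert ?lo (nz (m ''T'')))"
    by (simp add: ev q fr(1) put_row T lo)
  moreover have "ev n f extend_prog m ''b'' 0 = (if F (nz (m ''T'')) then m ''b'' 0 else ?lo)"
    by (simp add: ev q fr lo put_apply)
  moreover have "qc n f extend_prog m \<le> 1 + w"
    by (simp add: qc lo)
  ultimately show ?thesis by (simp add: extend_def Let_def)
qed

lemma find_prog:
  assumes "env m" "nz (m ''T'') \<subseteq> {..<r}"
  shows "nz (ev n f find_prog m ''T'') = find_term F L w r (nz (m ''Y''))"
    and "ev n f find_prog m ''q'' 0 = of_bool (F (find_term F L w r (nz (m ''Y''))))"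
    and "qc n f find_prog m \<le> L * (1 + w) + 1"
proof -
  define m1 where "m1 = put (ev n f clear_prog m) ''b'' 0 r"
  define m2 where "m2 = ev n f (For ''e'' ''L'' extend_prog) m1"
  define m3 where "m3 = put m2 ''mid'' 0 0"
  have e0: "env (ev n f clear_prog m)" by (rule env_ev[OF assms(1)]) (simp add: env_vars_def)
  have e1: "env m1" unfolding m1_def by (intro env_put e0) (simp add: env_vars_def)
  have m1: "nz (m1 ''T'') = {}" "m1 ''b'' 0 = r" "m1 ''Y'' = m ''Y''"
    using clear_prog[of m n f] envD[OF assms(1)] assms(2) by (auto simp: m1_def put_row put_apply ev_frame)
  let ?J = "\<lambda>i m' q. (nz (m' ''T''), m' ''b'' 0) = (extend F w (nz (m ''Y'')) ^^ i) ({}, r) \<and> q \<le> i * (1 + w)"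
  have "?J (m1 ''L'' 0) m2 (qc n f (For ''e'' ''L'' extend_prog) m1)"
    unfolding m2_def
  proof (rule For_rule[where J = ?J])
    fix i m' and q :: nat
    assume fr: "\<And>y. y \<noteq> ''e'' \<Longrightarrow> y \<notin> mods extend_prog \<Longrightarrow> m' y = m1 y" and J: "?J i m' q"
    have "env m'" by (rule env_frame[OF e1]) (auto simp: env_vars_def intro!: fr)
    from extend_prog[OF this] J fr[of "''Y''"]
    show "?J (Suc i) (ev n f extend_prog m') (q + qc n f extend_prog m')"
      by (simp add: m1)
  qed (auto simp: m1 put_apply put_row)
  then have J: "nz (m2 ''T'') = find_term F L w r (nz (m ''Y''))"
    "qc n f (For ''e'' ''L'' extend_prog) m1 \<le> L * (1 + w)"
    using envD[OF e1] unfolding find_term_def by (metis fst_conv, simp)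
  have e3: "env m3" unfolding m3_def m2_def
    by (intro env_put env_ev e1) (auto simp: env_vars_def)
  have ev: "ev n f find_prog m = ev n f ask_blocks m3" 
    using envD[OF e0] by (simp add: find_prog_def m3_def m2_def m1_def)
  have "m3 ''T'' = m2 ''T''" "m3 ''mid'' 0 = 0" by (auto simp: m3_def put_row put_apply)
  then show "nz (ev n f find_prog m ''T'') = find_term F L w r (nz (m ''Y''))"
    and "ev n f find_prog m ''q'' 0 = of_bool (F (find_term F L w r (nz (m ''Y''))))"
    unfolding ev ask_env[OF e3] using J(1) by (simp_all add: ev_frame)
  show "qc n f find_prog m \<le> L * (1 + w) + 1"
    using J(2) envD[OF e0] by (simp add: find_prog_def m1_def)
qed

definition enc :: "nat set list \<Rightarrow> memory \<Rightarrow> bool" where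
  "enc D m \<longleftrightarrow> m ''nd'' 0 = length D \<and> length D \<le> s \<and>
     (\<forall>d<length D. D ! d \<subseteq> {..<r} \<and> (\<forall>j<r. m ''D'' (rb d + j) \<noteq> 0 \<longleftrightarrow> j \<in> D ! d))"

lemma enc_frame: "enc D m \<Longrightarrow> m' ''nd'' = m ''nd'' \<Longrightarrow> m' ''D'' = m ''D'' \<Longrightarrow> enc D m'"
  by (simp add: enc_def)

lemma eval_prog:
  assumes "env m" "enc D m" "nz (m ''Y'') \<subseteq> {..<r}"
  shows "ev n f eval_prog m ''v'' 0 = of_bool (\<exists>T\<in>set D. T \<subseteq> nz (m ''Y''))"
proof -
  let ?Y = "nz (m ''Y'')"
  let ?inner = "If (BAnd (Nz (Cell ''D'' (Plus (Cell ''rb'' (V ''d'')) (V ''j'')))) (BNot (Nz (Cell ''Y'' (V ''j'')))))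
           (set0 ''c'' (Num 0)) Nop"
  let ?q = "set0 ''c'' (Num 1) ;; For ''j'' ''r'' ?inner ;; If (Nz (V ''c'')) (set0 ''v'' (Num 1)) Nop"
  let ?p = "If (Less (V ''d'') (V ''nd'')) ?q Nop"
  let ?m = "put m ''v'' 0 0"
  let ?J = "\<lambda>i m' (q::nat). m' ''v'' 0 = of_bool (\<exists>d<i. d < length D \<and> D ! d \<subseteq> ?Y)"
  have "?J (?m ''s'' 0) (ev n f (For ''d'' ''s'' ?p) ?m) (qc n f (For ''d'' ''s'' ?p) ?m)"
  proof (rule For_rule[where J = ?J])
    fix i m' and q :: nat
    assume fr: "\<And>y. y \<noteq> ''d'' \<Longrightarrow> y \<notin> mods ?p \<Longrightarrow> m' y = ?m y" and i: "m' ''d'' 0 = i" and J: "?J i m' q"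
    have "m' ''nd'' = m ''nd''" "m' ''D'' = m ''D''" "m' ''Y'' = m ''Y''"
      by (subst fr; simp add: put_row)+
    note fr' = this
    show "?J (Suc i) (ev n f ?p m') (q + qc n f ?p m')"
    proof (cases "i < length D")
      case True
      define m1 where "m1 = put m' ''c'' 0 1"
      have "env m1" unfolding m1_def
        by (rule env_put, rule env_frame[OF assms(1)]) (auto simp: env_vars_def put_row fr)
      note e1 = envD[OF this]
      let ?K = "\<lambda>j m' (q::nat). m' ''c'' 0 = of_bool (\<forall>j'<j. j' \<in> D ! i \<longrightarrow> j' \<in> ?Y) \<and> m' ''d'' 0 = i \<and> m' ''v'' 0 = m1 ''v'' 0"
      have K: "?K (m1 ''r'' 0) (ev n f (For ''j'' ''r'' ?inner) m1) (qc n f (For ''j'' ''r'' ?inner) m1)"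
      proof (rule For_rule[where J = ?K])
        fix j m'' and q :: nat
        assume j: "j < m1 ''r'' 0" and fr2: "\<And>y. y \<noteq> ''j'' \<Longrightarrow> y \<notin> mods ?inner \<Longrightarrow> m'' y = m1 y"
          and m'': "m'' ''j'' 0 = j" and K: "?K j m'' q"
        have f2: "m'' ''D'' = m ''D''" "m'' ''Y'' = m ''Y''"
          by (subst fr2; simp add: m1_def put_row fr')+
        have rb': "m'' ''rb'' = rb" using fr2[of "''rb''"] e1(8) by simp
        have "m ''D'' (rb i + j) \<noteq> 0 \<longleftrightarrow> j \<in> D ! i"
          using assms(2) True j e1 by (simp add: enc_def)
        moreover have "m ''Y'' j \<noteq> 0 \<longleftrightarrow> j \<in> ?Y" by (simp add: nz_def)
        ultimately show "?K (Suc j) (ev n f ?inner m'') (q + qc n f ?inner m'')"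
          using K m'' by (auto simp: f2 rb' put_apply less_Suc_eq)
      qed (auto simp: put_apply m1_def i)
      let ?m2 = "ev n f (For ''j'' ''r'' ?inner) m1"
      have "D ! i \<subseteq> {..<r}" using assms(2) True by (simp add: enc_def)
      then have c: "?m2 ''c'' 0 = of_bool (D ! i \<subseteq> ?Y)"
        using K e1 by (auto simp: subset_iff)
      have v: "?m2 ''v'' 0 = m' ''v'' 0" using K by (simp add: m1_def put_apply)
      have "ev n f ?p m' = (if ?m2 ''c'' 0 \<noteq> 0 then put ?m2 ''v'' 0 1 else ?m2)"
        using True i fr' assms(2) by (simp add: enc_def m1_def del: ev.simps(6))
      then show ?thesis using J c v True by (auto simp: put_apply less_Suc_eq)
    next
      case False
      then show ?thesis using J i fr' assms(2) by (auto simp: enc_def less_Suc_eq)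
    qed
  qed (auto simp: put_apply)
  moreover have "?m ''s'' 0 = s" using envD[OF assms(1)] by (simp add: put_apply)
  ultimately have "ev n f eval_prog m ''v'' 0 = of_bool (\<exists>d<s. d < length D \<and> D ! d \<subseteq> ?Y)"
    unfolding eval_prog_def ev.simps(2,4) aval.simps by simp
  moreover have "(\<exists>d<s. d < length D \<and> D ! d \<subseteq> ?Y) \<longleftrightarrow> (\<exists>T\<in>set D. T \<subseteq> ?Y)"
  proof -
    have "length D \<le> s" using assms(2) by (simp add: enc_def)
    then show ?thesis by (metis in_set_conv_nth order_less_le_trans)
  qed
  ultimately show ?thesis by simp
qed

lemma save_prog:
  assumes "env m" "enc D m" "length D < s" "nz (m ''T'') \<subseteq> {..<r}"
  shows "enc (D @ [nz (m ''T'')]) (ev n f save_prog m)"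
proof -
  let ?p = "Set ''D'' (Plus (Cell ''rb'' (V ''nd'')) (V ''j'')) (Cell ''T'' (V ''j''))"
  let ?off = "rb (length D)"
  have nd: "m ''nd'' 0 = length D" using assms(2) by (simp add: enc_def)
  have D: "ev n f (For ''j'' ''r'' ?p) m ''D'' = (\<lambda>j. if ?off \<le> j \<and> j < ?off + m ''r'' 0 then m ''T'' (j - ?off) else m ''D'' j)"
    by (rule For_fill) (auto simp: put_def nd envD[OF assms(1)])
  have "ev n f save_prog m ''D'' = (\<lambda>j. if ?off \<le> j \<and> j < ?off + r then m ''T'' (j - ?off) else m ''D'' j)"
    using D envD[OF assms(1)] by (simp add: save_prog_def put_row del: ev.simps(6))
  moreover have "ev n f save_prog m ''nd'' 0 = Suc (length D)"
    using nd by (simp add: save_prog_def put_apply ev_frame del: ev.simps(6))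
  \<comment> \<open>Rows of the table occupy disjoint segments, so the new row leaves the earlier
    ones intact.\<close>
  moreover have "\<not> ?off \<le> rb d + j" if "d < length D" "j < r" for d j
  proof -
    have "rb d + j < d * r + r" using rb[of d] that assms(3) by simp
    also have "\<dots> = Suc d * r" by simp
    also have "\<dots> \<le> length D * r" using that by (intro mult_right_mono) auto
    also have "\<dots> = ?off" using rb assms(3) by simp
    finally show ?thesis by simp
  qed
  ultimately show ?thesis
    using assms(2-4) unfolding enc_def by (auto simp: nth_append less_Suc_eq nz_def)
qed

end

lemma mods_add_prog [simp]:
  "mods add_prog = {''e'', ''j'', ''g'', ''mid'', ''i'', ''W'', ''q'', ''hi'', ''lo'', ''T'', ''b'', ''bad'', ''D'', ''nd''}"
  by (auto simp: add_prog_def)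

lemma mods_sample_prog [simp]:
  "mods sample_prog = {''Y'', ''ptr'', ''v'', ''d'', ''c'', ''e'', ''j'', ''g'', ''mid'', ''i'', ''W'', ''q'', ''hi'', ''lo'',
     ''T'', ''b'', ''bad'', ''D'', ''nd''}"
  by (auto simp: sample_prog_def)

lemma mods_learn_prog [simp]:
  "mods learn_prog = {''t'', ''Y'', ''ptr'', ''v'', ''d'', ''c'', ''e'', ''j'', ''g'', ''mid'', ''i'', ''W'', ''q'', ''hi'', ''lo'',
     ''T'', ''b'', ''bad'', ''D'', ''nd''}"
  by (auto simp: learn_prog_def)

lemma mods_dict_prog [simp]:
  "mods dict_prog = {''i'', ''W'', ''q0'', ''q1'', ''q2'', ''q3'', ''q4'', ''bad'', ''c''}"
  by (auto simp: dict_prog_def)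

lemma mods_term_prog [simp]:
  "mods term_prog = {''j'', ''i'', ''W'', ''q0'', ''q1'', ''q2'', ''q3'', ''q4'', ''bad'', ''c'', ''v''}"
  by (auto simp: term_prog_def)

lemma mods_round_prog [simp]:
  "mods round_prog = {''d'', ''j'', ''i'', ''W'', ''q0'', ''q1'', ''q2'', ''q3'', ''q4'', ''bad'', ''c'', ''v'', ''ptr''}"
  by (auto simp: round_prog_def)

lemma mods_row_prog [simp]:
  "mods row_prog = {''e'', ''px'', ''fx'', ''d'', ''j'', ''i'', ''W'', ''q0'', ''q1'', ''q2'', ''q3'', ''q4'', ''bad'', ''c'', ''v'', ''ptr''}"
  by (auto simp: row_prog_def)

lemma nz_row:
  assumes "\<And>j. a j = (if 0 \<le> j \<and> j < 0 + r then R (p + j) else a' j)" "nz a' \<subseteq> {..<r}"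
    "\<And>j. j < r \<Longrightarrow> R (p + j) = of_bool (y ! j)" "length y = r"
  shows "nz a = sel y"
  using assms by (auto simp: nz_def sel_def split: if_splits)

context machine
begin

text \<open>The queries for one new term: \<open>L\<close> steps of one evaluation and
  \<open>w\<close> halvings each, and a final evaluation.\<close>

definition learn_cost :: nat where
  "learn_cost = L * (1 + w) + 1"

definition learn_state :: "nat set list \<Rightarrow> bool \<Rightarrow> memory \<Rightarrow> bool" where
  "learn_state D bad m \<longleftrightarrow> enc D m \<and> (m ''bad'' 0 \<noteq> 0 \<longleftrightarrow> bad) \<and> nz (m ''T'') \<subseteq> {..<r} \<and> nz (m ''Y'') \<subseteq> {..<r}"

text \<open>An amortized count: the queries are charged to the term that they add, with
  \<open>length D * learn_cost\<close> as the potential.\<close>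

lemma add_prog:
  assumes "env m" "learn_state D bad m" "F (nz (m ''Y''))"
  defines "T \<equiv> find_term F L w r (nz (m ''Y''))"
  defines "res \<equiv> (if length D < s then (D @ [T], bad \<or> \<not> F T) else (D, True))"
  shows "learn_state (fst res) (snd res) (ev n f add_prog m) \<and>
    qc n f add_prog m + length D * learn_cost \<le> length (fst res) * learn_cost"
proof (cases "length D < s")
  case False
  have "m ''nd'' 0 = length D" using assms(2) by (simp add: learn_state_def enc_def)
  then have "ev n f add_prog m = put m ''bad'' 0 1" "qc n f add_prog m = 0"
    using False envD[OF assms(1)] by (simp_all add: add_prog_def)
  then show ?thesis
    using False assms(2) by (simp add: res_def learn_state_def enc_def put_row put_apply)
next
  case True
  have nd: "m ''nd'' 0 = length D" using assms(2) by (simp add: learn_state_def enc_def)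
  have TY: "nz (m ''T'') \<subseteq> {..<r}" "nz (m ''Y'') \<subseteq> {..<r}" "enc D m" "m ''bad'' 0 \<noteq> 0 \<longleftrightarrow> bad"
    using assms(2) by (simp_all add: learn_state_def)
  define m1 where "m1 = ev n f find_prog m"
  define m2 where "m2 = (if m1 ''q'' 0 \<noteq> 0 then m1 else put m1 ''bad'' 0 1)"
  note find = find_prog[OF assms(1) TY(1), folded m1_def T_def]
  have e1: "env m1" unfolding m1_def by (rule env_ev[OF assms(1)]) (simp add: env_vars_def)
  have e2: "env m2" unfolding m2_def using e1 env_put[OF e1] by (simp add: env_vars_def)
  have Ts: "T \<subseteq> {..<r}"
    unfolding T_def using find_term_subset(1)[of F "nz (m ''Y'')" r w L, OF assms(3) TY(2) rw] TY(2) by blast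
  have m1: "m1 ''Y'' = m ''Y''" "m1 ''nd'' = m ''nd''" "m1 ''D'' = m ''D''" "m1 ''bad'' = m ''bad''"
    by (simp_all add: m1_def ev_frame)
  have m2: "m2 ''T'' = m1 ''T''" "m2 ''Y'' = m ''Y''" "m2 ''nd'' = m ''nd''" "m2 ''D'' = m ''D''"
    by (simp_all add: m2_def put_row m1)
  have bad2: "m2 ''bad'' 0 \<noteq> 0 \<longleftrightarrow> bad \<or> \<not> F T"
  proof (cases "F T")
    case True
    then have "m2 = m1" unfolding m2_def find(2) by simp
    then show ?thesis using TY(4) m1(4) True by simp
  next
    case False
    then have "m2 = put m1 ''bad'' 0 1" unfolding m2_def find(2) by simp
    then have "m2 ''bad'' 0 = 1" by (simp add: put_apply)
    then show ?thesis using False by simp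
  qed
  have enc2: "enc D m2" by (rule enc_frame[OF TY(3)]) (simp_all add: m2)
  have enc: "enc (D @ [T]) (ev n f save_prog m2)"
    using save_prog[OF e2 enc2 True] find(1) Ts by (simp add: m2)
  have ev: "ev n f add_prog m = ev n f save_prog m2"
    using True nd envD[OF assms(1)] by (simp add: add_prog_def m2_def m1_def)
  have qc: "qc n f add_prog m = qc n f find_prog m"
    using True nd envD[OF assms(1)] by (simp add: add_prog_def)
  show ?thesis
    using enc True bad2 find(1,3) TY(2) Ts by (simp add: res_def ev qc learn_state_def ev_frame learn_cost_def m2)
qed

lemma sample_prog:
  assumes "env m" "learn_state D bad m" "length y = r"
    and y: "\<And>j. j < r \<Longrightarrow> R (m ''ptr'' 0 + j) = of_bool (y ! j)"
  defines "res \<equiv> learn_step F L w r s y (D, bad)"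
  shows "learn_state (fst res) (snd res) (ev n f sample_prog m) \<and> ev n f sample_prog m ''ptr'' 0 = m ''ptr'' 0 + r \<and>
    qc n f sample_prog m + length D * learn_cost \<le> 1 + length (fst res) * learn_cost"
proof -
  let ?fill = "For ''j'' ''r'' (Set ''Y'' (V ''j'') (Cell ''R'' (Plus (V ''ptr'') (V ''j''))))"
  define m1 where "m1 = ev n f ?fill m"
  define m2 where "m2 = put m1 ''ptr'' 0 (m1 ''ptr'' 0 + r)"
  define m3 where "m3 = ev n f clear_prog m2"
  define m4 where "m4 = put m3 ''mid'' 0 r"
  define m5 where "m5 = ev n f ask_blocks m4"
  define m6 where "m6 = ev n f eval_prog m5"
  have e1: "env m1" unfolding m1_def by (rule env_ev[OF assms(1)]) (simp add: env_vars_def)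
  have e2: "env m2" unfolding m2_def by (rule env_put[OF e1]) (simp add: env_vars_def)
  have e3: "env m3" unfolding m3_def by (rule env_ev[OF e2]) (simp add: env_vars_def)
  have e4: "env m4" unfolding m4_def by (rule env_put[OF e3]) (simp add: env_vars_def)
  have e5: "env m5" unfolding m5_def by (rule env_ev[OF e4]) (simp add: env_vars_def)
  have e6: "env m6" unfolding m6_def by (rule env_ev[OF e5]) (simp add: env_vars_def)
  have st: "enc D m" "m ''bad'' 0 \<noteq> 0 \<longleftrightarrow> bad" "nz (m ''T'') \<subseteq> {..<r}" "nz (m ''Y'') \<subseteq> {..<r}"
    using assms(2) by (simp_all add: learn_state_def)
  have fill: "m1 ''Y'' = (\<lambda>j. if 0 \<le> j \<and> j < 0 + r then R (m ''ptr'' 0 + j) else m ''Y'' j)"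
    unfolding m1_def using envD[OF assms(1)]
    by (subst For_fill[where off = 0 and g = "\<lambda>j. R (m ''ptr'' 0 + j)"]) (simp_all add: put_same fun_eq_iff)
  have Y: "nz (m1 ''Y'') = sel y"
    by (rule nz_row[where a' = "m ''Y''" and R = R and p = "m ''ptr'' 0" and r = r])
       (use fill st(4) y assms(3) in auto)
  have m1: "m1 ''ptr'' = m ''ptr''" "m1 ''T'' = m ''T''" "m1 ''nd'' = m ''nd''" "m1 ''D'' = m ''D''" "m1 ''bad'' = m ''bad''"
    by (simp_all add: m1_def ev_frame del: ev.simps)
  have m3: "m3 ''Y'' = m1 ''Y''" "m3 ''ptr'' 0 = m ''ptr'' 0 + r" "m3 ''nd'' = m ''nd''" "m3 ''D'' = m ''D''"
      "m3 ''bad'' = m ''bad''"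
    by (simp_all add: m3_def m2_def ev_frame put_row put_apply m1)
  have T3: "nz (m3 ''T'') = {}"
    unfolding m3_def by (rule clear_prog) (use st(3) envD[OF e2] in \<open>simp add: m2_def put_row m1\<close>)
  have m4: "m4 ''Y'' = m1 ''Y''" "m4 ''ptr'' 0 = m ''ptr'' 0 + r" "m4 ''nd'' = m ''nd''" "m4 ''D'' = m ''D''"
      "m4 ''bad'' = m ''bad''" "m4 ''T'' = m3 ''T''" "m4 ''mid'' 0 = r"
    by (simp_all add: m4_def put_row put_apply m3)
  have sel: "sel y \<subseteq> {..<r}" using assms(3) by (auto simp: sel_def)
  then have "sel y \<inter> {..<r} = sel y" by auto
  then have q5: "m5 ''q'' 0 = of_bool (F (sel y))"
    unfolding m5_def ask_env[OF e4] m4 T3 Y by simp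
  have m5: "m5 ''Y'' = m1 ''Y''" "m5 ''ptr'' 0 = m ''ptr'' 0 + r" "m5 ''nd'' = m ''nd''" "m5 ''D'' = m ''D''"
      "m5 ''bad'' = m ''bad''" "m5 ''T'' = m3 ''T''"
    by (simp_all add: m5_def ev_frame m4)
  have enc5: "enc D m5" by (rule enc_frame[OF st(1)]) (simp_all add: m5)
  have v6: "m6 ''v'' 0 = of_bool (\<exists>T\<in>set D. T \<subseteq> sel y)"
    unfolding m6_def using eval_prog[OF e5 enc5] sel by (simp add: m5 Y)
  have m6: "m6 ''Y'' = m1 ''Y''" "m6 ''ptr'' 0 = m ''ptr'' 0 + r" "m6 ''nd'' = m ''nd''" "m6 ''D'' = m ''D''"
      "m6 ''bad'' = m ''bad''" "m6 ''T'' = m3 ''T''" "m6 ''q'' = m5 ''q''"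
    by (simp_all add: m6_def ev_frame m5)
  have st6: "learn_state D bad m6"
    unfolding learn_state_def using st enc_frame[OF st(1), of m6] T3 sel by (simp add: m6 Y)
  have r2: "m2 ''r'' 0 = r" "m1 ''r'' 0 = r" "m3 ''r'' 0 = r" using envD e1 e2 e3 by auto
  have ev: "ev n f sample_prog m = (if F (sel y) \<and> \<not> (\<exists>T\<in>set D. T \<subseteq> sel y) then ev n f add_prog m6 else m6)"
    using r2 v6 q5 m6(7)
    by (simp add: sample_prog_def m1_def[symmetric] m2_def[symmetric] m3_def[symmetric] m4_def[symmetric]
        m5_def[symmetric] m6_def[symmetric] del: ev.simps(6))
  have qc1: "qc n f ?fill m = 0" by simp
  have qc: "qc n f sample_prog m = 1 + (if F (sel y) \<and> \<not> (\<exists>T\<in>set D. T \<subseteq> sel y) then qc n f add_prog m6 else 0)"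
    using r2 v6 q5 m6(7) qc1
    by (simp add: sample_prog_def m1_def[symmetric] m2_def[symmetric] m3_def[symmetric] m4_def[symmetric]
        m5_def[symmetric] m6_def[symmetric] del: ev.simps(6) qc.simps(6))
  show ?thesis
  proof (cases "F (sel y) \<and> \<not> (\<exists>T\<in>set D. T \<subseteq> sel y)")
    case True
    have Y6: "nz (m6 ''Y'') = sel y" by (simp add: m6 Y)
    have F6: "F (nz (m6 ''Y''))" using True Y6 by simp
    have res: "res = (if length D < s then (D @ [find_term F L w r (sel y)], bad \<or> \<not> F (find_term F L w r (sel y))) else (D, True))"
      using True by (simp add: res_def learn_step_def Let_def)
    have add: "learn_state (fst res) (snd res) (ev n f add_prog m6) \<and>
        qc n f add_prog m6 + length D * learn_cost \<le> length (fst res) * learn_cost"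
      using add_prog[OF e6 st6 F6] unfolding Y6 res by blast
    have ev': "ev n f sample_prog m = ev n f add_prog m6" and qc': "qc n f sample_prog m = 1 + qc n f add_prog m6"
      using True ev qc by auto
    have "ev n f add_prog m6 ''ptr'' 0 = m ''ptr'' 0 + r" using m6(2) by (simp add: ev_frame)
    with add show ?thesis unfolding ev' qc' by simp
  next
    case False
    then have "res = (D, bad)" by (auto simp: res_def learn_step_def)
    moreover have "ev n f sample_prog m = m6" "qc n f sample_prog m = 1" using False ev qc by auto
    ultimately show ?thesis using st6 m6(2) by simp
  qed
qed

text \<open>Each sample costs one query of its own; the potential contributes at most
  \<open>s\<close> times the cost of a term, whatever the number of samples.\<close>

lemma learn_prog:
  assumes "env m" "m ''m1'' 0 = length ys" "set ys \<subseteq> cube r" "enc [] m" "m ''bad'' 0 = 0"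
    "nz (m ''T'') = {}" "nz (m ''Y'') = {}"
    and ys: "\<And>i j. i < length ys \<Longrightarrow> j < r \<Longrightarrow> R (m ''ptr'' 0 + i * r + j) = of_bool (ys ! i ! j)"
    and D: "learn F L w r s ys = (D, bad)"
  shows "enc D (ev n f learn_prog m) \<and> (ev n f learn_prog m ''bad'' 0 \<noteq> 0 \<longleftrightarrow> bad) \<and>
    ev n f learn_prog m ''ptr'' 0 = m ''ptr'' 0 + length ys * r \<and>
    qc n f learn_prog m \<le> length ys + s * learn_cost"
proof -
  let ?J = "\<lambda>i m' q. \<exists>D bad. learn F L w r s (take i ys) = (D, bad) \<and> learn_state D bad m' \<and>
    m' ''ptr'' 0 = m ''ptr'' 0 + i * r \<and> q \<le> i + length D * learn_cost"
  have "?J (m ''m1'' 0) (ev n f learn_prog m) (qc n f learn_prog m)"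
    unfolding learn_prog_def
  proof (rule For_rule[where J = ?J])
    show "?J 0 m 0"
      using assms(4-7) by (intro exI[of _ "[]"] exI[of _ False]) (simp add: learn_def learn_state_def)
  next
    fix i m' and q :: nat
    assume i: "i < m ''m1'' 0" and fr: "\<And>y. y \<noteq> ''t'' \<Longrightarrow> y \<notin> mods sample_prog \<Longrightarrow> m' y = m y"
      and J: "?J i m' q"
    from J obtain D bad where D: "learn F L w r s (take i ys) = (D, bad)" "learn_state D bad m'"
      "m' ''ptr'' 0 = m ''ptr'' 0 + i * r" "q \<le> i + length D * learn_cost" by blast
    have i': "i < length ys" using i assms(2) by simp
    have e: "env m'" by (rule env_frame[OF assms(1)]) (auto simp: env_vars_def intro!: fr)
    have len: "length (ys ! i) = r" using assms(3) i' by (auto simp: in_cube[symmetric])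
    have take: "take (Suc i) ys = take i ys @ [ys ! i]" using i' by (rule take_Suc_conv_app_nth)
    obtain D' bad' where D': "learn_step F L w r s (ys ! i) (D, bad) = (D', bad')" by force
    have "learn F L w r s (take (Suc i) ys) = (D', bad')"
      unfolding take learn_snoc D(1) D' ..
    moreover have "learn_state D' bad' (ev n f sample_prog m') \<and> ev n f sample_prog m' ''ptr'' 0 = m' ''ptr'' 0 + r \<and>
        qc n f sample_prog m' + length D * learn_cost \<le> 1 + length D' * learn_cost"
      using sample_prog[OF e D(2) len] ys[OF i'] by (simp add: D(3) D')
    ultimately show "?J (Suc i) (ev n f sample_prog m') (q + qc n f sample_prog m')"
      using D(3,4) by auto
  next
    fix i m' q k
    assume "?J i m' q"
    then show "?J i (put m' ''t'' 0 k) q"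
      by (simp add: learn_state_def enc_def put_row put_apply)
  qed
  then have *: "learn_state D bad (ev n f learn_prog m)" "ev n f learn_prog m ''ptr'' 0 = m ''ptr'' 0 + length ys * r"
      "qc n f learn_prog m \<le> length ys + length D * learn_cost"
    using D assms(2) by simp_all
  have "length D * learn_cost \<le> s * learn_cost"
    using learn_size[OF assms(3) rw D] by (intro mult_right_mono) auto
  with *(3) have "qc n f learn_prog m \<le> length ys + s * learn_cost" by (rule order_trans[OF _ add_left_mono])
  with *(1,2) show ?thesis by (simp add: learn_state_def)
qed

end

section \<open>Testing on the machine\<close>

lemma qc_dict_prog [simp]: "qc n f dict_prog m = 5"
  unfolding dict_prog_def qc.simps qc_ask_literal if_cancel by simp

context machine
begin

definition dict_state :: "nat set list \<Rightarrow> nat \<Rightarrow> nat \<Rightarrow> nat \<Rightarrow> nat \<Rightarrow> memory \<Rightarrow> bool" where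
  "dict_state D d j px pt m \<longleftrightarrow> env m \<and> enc D m \<and> d < length D \<and> m ''d'' 0 = d \<and> m ''j'' 0 = j \<and>
     m ''px'' 0 = px \<and> m ''ptr'' 0 = pt"

lemma dict_state_ev:
  assumes "dict_state D d j px pt m" "mods p \<inter> (env_vars \<union> {''nd'', ''D'', ''d'', ''j'', ''px'', ''ptr''}) = {}"
  shows "dict_state D d j px pt (ev n f p m)"
proof -
  have "env (ev n f p m)" using assms by (intro env_ev) (auto simp: dict_state_def)
  moreover have "''nd'' \<notin> mods p" "''D'' \<notin> mods p" "''d'' \<notin> mods p" "''j'' \<notin> mods p" "''px'' \<notin> mods p" "''ptr'' \<notin> mods p"
    using assms(2) by auto
  ultimately show ?thesis
    using assms(1) by (simp add: dict_state_def ev_frame enc_def)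
qed

text \<open>While the query string is assembled, only the counter and \<open>W\<close> change, so
  \<open>z\<close> is evaluated in such memories only.\<close>

lemma ask_literal:
  assumes "dict_state D d j px pt m"
    and z: "\<And>m' i. i < n \<Longrightarrow> (\<And>y. y \<noteq> ''i'' \<Longrightarrow> y \<noteq> ''W'' \<Longrightarrow> m' y = m y) \<Longrightarrow> m' ''i'' 0 = i \<Longrightarrow>
      (aval m' z \<noteq> 0 \<longleftrightarrow> a ! i)"
  shows "ev n f (ask_literal x z) m x 0 = of_bool (literal n f h (D ! d) j a)"
proof -
  let ?p = "If (Eq (Cell ''h'' (V ''i'')) (V ''j'')) (Set ''W'' (V ''i'') z)
         (Set ''W'' (V ''i'') (Cell ''D'' (Plus (Cell ''rb'' (V ''d'')) (Cell ''h'' (V ''i'')))))"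
  have st: "env m" "enc D m" "d < length D" "m ''d'' 0 = d" "m ''j'' 0 = j"
    using assms(1) by (simp_all add: dict_state_def)
  let ?J = "\<lambda>i m' (q::nat). \<forall>i'<i. m' ''W'' i' \<noteq> 0 \<longleftrightarrow> (if h i' = j then a ! i' else h i' \<in> D ! d)"
  have "?J (m ''n'' 0) (ev n f (For ''i'' ''n'' ?p) m) (qc n f (For ''i'' ''n'' ?p) m)"
  proof (rule For_rule[where J = ?J])
    fix i m' and q :: nat
    assume i: "i < m ''n'' 0" and fr: "\<And>y. y \<noteq> ''i'' \<Longrightarrow> y \<notin> mods ?p \<Longrightarrow> m' y = m y" and mi: "m' ''i'' 0 = i"
      and J: "?J i m' q"
    have i': "i < n" using i envD[OF st(1)] by simp
    have zi: "aval m' z \<noteq> 0 \<longleftrightarrow> a ! i" by (rule z) (use i' mi in \<open>auto intro!: fr\<close>)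
    have fr': "m' ''h'' = h" "m' ''j'' 0 = j" "m' ''D'' = m ''D''" "m' ''rb'' = rb" "m' ''d'' 0 = d"
      using fr[of "''h''"] fr[of "''j''"] fr[of "''D''"] fr[of "''rb''"] fr[of "''d''"] envD[OF st(1)] st by simp_all
    have Dd: "m ''D'' (rb d + h i) \<noteq> 0 \<longleftrightarrow> h i \<in> D ! d"
      using st(2,3) h[OF i'] by (simp add: enc_def)
    have "ev n f ?p m' ''W'' = (m' ''W'')(i := (if h i = j then aval m' z else m ''D'' (rb d + h i)))"
      using mi fr' by (auto simp: put_same)
    then show "?J (Suc i) (ev n f ?p m') (q + qc n f ?p m')"
      using J zi Dd by (auto simp: less_Suc_eq)
  qed (auto simp: put_apply)
  then have eq: "map (\<lambda>j. ev n f (For ''i'' ''n'' ?p) m ''W'' j \<noteq> 0) [0..<n] =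
      map (\<lambda>i. if h i = j then a ! i else h i \<in> D ! d) [0..<n]"
    using envD[OF st(1)] by simp
  show ?thesis
    unfolding ask_literal_def literal_def ev.simps(3,4) eq by (simp add: put_apply)
qed

definition bits_at :: "nat \<Rightarrow> bool list \<Rightarrow> bool" where
  "bits_at p x \<longleftrightarrow> x \<in> cube n \<and> (\<forall>i<n. R (p + i) = of_bool (x ! i))"

lemma dict_prog:
  assumes st: "dict_state D d j px pt m"
    and bits: "bits_at px x" "bits_at pt c" "bits_at (pt + n) b"
  defines "\<phi> \<equiv> literal n f h (D ! d) j"
  shows "ev n f dict_prog m ''bad'' 0 = (if dict_ok \<phi> x c b then m ''bad'' 0 else 1) \<and>
    ev n f dict_prog m ''c'' 0 = (if \<phi> x then m ''c'' 0 else 0)"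
proof -
  let ?z1 = "Mod (Plus B_bit X_bit) (Num 2)"
  let ?z3 = "Mod (Plus B_bit (Num 1)) (Num 2)"
  let ?z4 = "Mod (Plus B_bit (Div (Plus X_bit C_bit) (Num 2))) (Num 2)"
  define m0 where "m0 = ev n f (ask_literal ''q0'' B_bit) m"
  define m1 where "m1 = ev n f (ask_literal ''q1'' ?z1) m0"
  define m2 where "m2 = ev n f (ask_literal ''q2'' X_bit) m1"
  define m3 where "m3 = ev n f (ask_literal ''q3'' ?z3) m2"
  define m4 where "m4 = ev n f (ask_literal ''q4'' ?z4) m3"
  have s0: "dict_state D d j px pt m0" unfolding m0_def by (rule dict_state_ev[OF st]) (simp add: env_vars_def)
  have s1: "dict_state D d j px pt m1" unfolding m1_def by (rule dict_state_ev[OF s0]) (simp add: env_vars_def)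
  have s2: "dict_state D d j px pt m2" unfolding m2_def by (rule dict_state_ev[OF s1]) (simp add: env_vars_def)
  have s3: "dict_state D d j px pt m3" unfolding m3_def by (rule dict_state_ev[OF s2]) (simp add: env_vars_def)
  have len: "length x = n" "length c = n" "length b = n" using bits by (auto simp: bits_at_def in_cube)
  have read: "aval m'' X_bit = of_bool (x ! i)" "aval m'' C_bit = of_bool (c ! i)" "aval m'' B_bit = of_bool (b ! i)"
    if "dict_state D d j px pt m'" "i < n" "\<And>y. y \<noteq> ''i'' \<Longrightarrow> y \<noteq> ''W'' \<Longrightarrow> m'' y = m' y" "m'' ''i'' 0 = i" for m' m'' i
  proof -
    have e: "env m'" "m' ''px'' 0 = px" "m' ''ptr'' 0 = pt" using that(1) by (simp_all add: dict_state_def)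
    have "m'' ''R'' = R" "m'' ''px'' 0 = px" "m'' ''ptr'' 0 = pt" "m'' ''n'' 0 = n"
      using that(3)[of "''R''"] that(3)[of "''px''"] that(3)[of "''ptr''"] that(3)[of "''n''"] e envD[OF e(1)] by simp_all
    then show "aval m'' X_bit = of_bool (x ! i)" "aval m'' C_bit = of_bool (c ! i)" "aval m'' B_bit = of_bool (b ! i)"
      using bits that(2,4) by (simp_all add: bits_at_def)
  qed
  have "m0 ''q0'' 0 = of_bool (\<phi> b)" unfolding m0_def \<phi>_def
    by (rule ask_literal[OF st]) (subst read(3)[OF st]; simp)
  moreover have "m1 ''q1'' 0 = of_bool (\<phi> (xr b x))" unfolding m1_def \<phi>_def
    by (rule ask_literal[OF s0]) (subst aval.simps(6), subst aval.simps(3), subst read(3)[OF s0], assumption+, subst read(1)[OF s0], assumption+, simp add: nth_xr len)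
  moreover have "m2 ''q2'' 0 = of_bool (\<phi> x)" unfolding m2_def \<phi>_def
    by (rule ask_literal[OF s1]) (subst read(1)[OF s1]; simp)
  moreover have "m3 ''q3'' 0 = of_bool (\<phi> (xr b (ones n)))" unfolding m3_def \<phi>_def
    by (rule ask_literal[OF s2]) (subst aval.simps(6), subst aval.simps(3), subst read(3)[OF s2], assumption+, simp add: nth_xr len)
  moreover have "m4 ''q4'' 0 = of_bool (\<phi> (xr b (an x c)))" unfolding m4_def \<phi>_def
    by (rule ask_literal[OF s3]) (subst aval.simps(6), subst aval.simps(3), subst aval.simps(5), subst aval.simps(3),
      subst read(3)[OF s3], assumption+, subst read(1)[OF s3], assumption+, subst read(2)[OF s3], assumption+, simp add: nth_xr nth_an len)
  moreover have "m4 ''q0'' = m0 ''q0''" "m4 ''q1'' = m1 ''q1''" "m4 ''q2'' = m2 ''q2''" "m4 ''q3'' = m3 ''q3''"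
    "m4 ''bad'' = m ''bad''" "m4 ''c'' = m ''c''"
    by (simp_all add: m4_def m3_def m2_def m1_def m0_def ev_frame)
  ultimately have q: "m4 ''q0'' 0 = of_bool (\<phi> b)" "m4 ''q1'' 0 = of_bool (\<phi> (xr b x))" "m4 ''q2'' 0 = of_bool (\<phi> x)"
    "m4 ''q3'' 0 = of_bool (\<phi> (xr b (ones n)))" "m4 ''q4'' 0 = of_bool (\<phi> (xr b (an x c)))"
    "m4 ''bad'' 0 = m ''bad'' 0" "m4 ''c'' 0 = m ''c'' 0"
    by simp_all
  let ?test = "BAnd (Eq (Mod (Plus (V ''q0'') (V ''q2'')) (Num 2)) (V ''q1''))
          (BAnd (BNot (Eq (V ''q0'') (V ''q3'')))
            (BNot (BAnd (Eq (V ''q0'') (V ''q1'')) (BNot (Eq (V ''q0'') (V ''q4''))))))"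
  have test: "bval m4 ?test \<longleftrightarrow> dict_ok \<phi> x c b"
    unfolding dict_ok_def len
    by (cases "\<phi> b"; cases "\<phi> x"; cases "\<phi> (xr b x)"; cases "\<phi> (xr b (ones n))"; cases "\<phi> (xr b (an x c))")
       (simp_all add: q)
  define m5 where "m5 = (if dict_ok \<phi> x c b then m4 else put m4 ''bad'' 0 1)"
  have ev: "ev n f dict_prog m = (if m5 ''q2'' 0 \<noteq> 0 then m5 else put m5 ''c'' 0 0)"
  proof -
    have "ev n f dict_prog m = ev n f (If (Nz (V ''q2'')) Nop (set0 ''c'' (Num 0))) (ev n f (If ?test Nop (set0 ''bad'' (Num 1))) m4)"
      unfolding dict_prog_def ev.simps(4) m4_def m3_def m2_def m1_def m0_def ..
    also have "ev n f (If ?test Nop (set0 ''bad'' (Num 1))) m4 = m5"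
      unfolding m5_def ev.simps(5) test by simp
    finally show ?thesis by simp
  qed
  have "m5 ''q2'' 0 = of_bool (\<phi> x)" "m5 ''bad'' 0 = (if dict_ok \<phi> x c b then m ''bad'' 0 else 1)" "m5 ''c'' 0 = m ''c'' 0"
    by (simp_all add: m5_def put_apply q)
  then show ?thesis by (simp add: ev put_apply)
qed

lemma term_prog:
  assumes st: "env m" "enc D m" "d < length D" "m ''d'' 0 = d" "m ''px'' 0 = px" "m ''ptr'' 0 = pt"
    and bits: "bits_at px x" "bits_at pt c" "bits_at (pt + n) b"
  shows "(ev n f term_prog m ''bad'' 0 \<noteq> 0 \<longleftrightarrow> m ''bad'' 0 \<noteq> 0 \<or> (\<exists>j\<in>D ! d. \<not> dict_ok (literal n f h (D ! d) j) x c b)) \<and>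
    ev n f term_prog m ''v'' 0 = (if \<forall>j\<in>D ! d. literal n f h (D ! d) j x then 1 else m ''v'' 0) \<and>
    qc n f term_prog m = 5 * card (D ! d)"
proof -
  let ?T = "D ! d"
  let ?\<phi> = "literal n f h ?T"
  let ?p = "If (Nz (Cell ''D'' (Plus (Cell ''rb'' (V ''d'')) (V ''j'')))) dict_prog Nop"
  define m1 where "m1 = put m ''c'' 0 1"
  have e1: "env m1" unfolding m1_def by (rule env_put[OF st(1)]) (simp add: env_vars_def)
  have m1: "m1 ''nd'' = m ''nd''" "m1 ''D'' = m ''D''" "m1 ''d'' = m ''d''" "m1 ''px'' = m ''px''" "m1 ''ptr'' = m ''ptr''"
     "m1 ''bad'' = m ''bad''" "m1 ''v'' = m ''v''" "m1 ''c'' 0 = 1"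
    by (simp_all add: m1_def put_row put_apply)
  have T: "?T \<subseteq> {..<r}" using st(2,3) by (simp add: enc_def)
  let ?J = "\<lambda>j m' q. (m' ''bad'' 0 \<noteq> 0 \<longleftrightarrow> m ''bad'' 0 \<noteq> 0 \<or> (\<exists>j'\<in>?T \<inter> {..<j}. \<not> dict_ok (?\<phi> j') x c b)) \<and>
    m' ''c'' 0 = of_bool (\<forall>j'\<in>?T \<inter> {..<j}. ?\<phi> j' x) \<and> q = 5 * card (?T \<inter> {..<j})"
  define m2 where "m2 = ev n f (For ''j'' ''r'' ?p) m1"
  have "?J (m1 ''r'' 0) m2 (qc n f (For ''j'' ''r'' ?p) m1)"
    unfolding m2_def
  proof (rule For_rule[where J = ?J])
    fix j m' and q :: nat
    assume j: "j < m1 ''r'' 0" and fr: "\<And>y. y \<noteq> ''j'' \<Longrightarrow> y \<notin> mods ?p \<Longrightarrow> m' y = m1 y" and mj: "m' ''j'' 0 = j"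
      and J: "?J j m' q"
    have j': "j < r" using j envD[OF e1] by simp
    have e: "env m'" by (rule env_frame[OF e1]) (auto simp: env_vars_def intro!: fr)
    have fr': "m' ''nd'' = m ''nd''" "m' ''D'' = m ''D''" "m' ''d'' 0 = d" "m' ''px'' 0 = px" "m' ''ptr'' 0 = pt"
      using fr[of "''nd''"] fr[of "''D''"] fr[of "''d''"] fr[of "''px''"] fr[of "''ptr''"] st m1 by simp_all
    have enc: "enc D m'" by (rule enc_frame[OF st(2)]) (simp_all add: fr')
    have ds: "dict_state D d j px pt m'" using e enc st(3) fr' mj by (simp add: dict_state_def)
    have Dd: "m' ''D'' (m' ''rb'' (m' ''d'' 0) + m' ''j'' 0) \<noteq> 0 \<longleftrightarrow> j \<in> ?T"
      using st(2,3) j' by (simp add: enc_def fr' envD[OF e] mj)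
    show "?J (Suc j) (ev n f ?p m') (q + qc n f ?p m')"
    proof (cases "j \<in> ?T")
      case True
      have ins: "?T \<inter> {..<Suc j} = insert j (?T \<inter> {..<j})" using True by (auto simp: less_Suc_eq)
      have "ev n f ?p m' = ev n f dict_prog m'" "qc n f ?p m' = 5" using Dd True by simp_all
      then show ?thesis using dict_prog[OF ds bits] J unfolding ins by auto
    next
      case False
      have ins: "?T \<inter> {..<Suc j} = ?T \<inter> {..<j}" using False by (auto simp: less_Suc_eq)
      have "ev n f ?p m' = m'" "qc n f ?p m' = 0" using Dd False by simp_all
      then show ?thesis using J unfolding ins by simp
    qed
  qed (auto simp: put_apply m1)
  moreover have "?T \<inter> {..<m1 ''r'' 0} = ?T" using T envD[OF e1] by auto
  ultimately have m2: "m2 ''bad'' 0 \<noteq> 0 \<longleftrightarrow> m ''bad'' 0 \<noteq> 0 \<or> (\<exists>j\<in>?T. \<not> dict_ok (?\<phi> j) x c b)"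
    "m2 ''c'' 0 = of_bool (\<forall>j\<in>?T. ?\<phi> j x)" "qc n f (For ''j'' ''r'' ?p) m1 = 5 * card ?T"
    by simp_all
  have v: "m2 ''v'' = m ''v''" unfolding m2_def by (subst ev_frame) (simp_all add: m1)
  have ev: "ev n f term_prog m = (if m2 ''c'' 0 \<noteq> 0 then put m2 ''v'' 0 1 else m2)"
    unfolding term_prog_def ev.simps(2,4) aval.simps m1_def[symmetric] m2_def[symmetric] by simp
  have qc: "qc n f term_prog m = qc n f (For ''j'' ''r'' ?p) m1"
    unfolding term_prog_def qc.simps(2,4,5) ev.simps(2) aval.simps m1_def[symmetric] by simp
  show ?thesis
    using m2 v unfolding ev qc by (simp add: put_apply)
qed

lemma round_prog:
  assumes st: "env m" "enc D m" "\<And>T. T \<in> set D \<Longrightarrow> card T \<le> L" "m ''px'' 0 = px" "m ''ptr'' 0 = pt" "m ''fx'' 0 = of_bool (f x)"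
    and bits: "bits_at px x" "bits_at pt c" "bits_at (pt + n) b"
  shows "(ev n f round_prog m ''bad'' 0 \<noteq> 0 \<longleftrightarrow> m ''bad'' 0 \<noteq> 0 \<or> \<not> round_ok n f h D x (c, b)) \<and>
    ev n f round_prog m ''ptr'' 0 = pt + 2 * n \<and> qc n f round_prog m \<le> s * (5 * L)"
proof -
  let ?p = "If (Less (V ''d'') (V ''nd'')) term_prog Nop"
  let ?bad = "\<lambda>d. \<exists>j\<in>D ! d. \<not> dict_ok (literal n f h (D ! d) j) x c b"
  let ?val = "\<lambda>d. \<forall>j\<in>D ! d. literal n f h (D ! d) j x"
  define m1 where "m1 = put m ''v'' 0 0"
  have e1: "env m1" unfolding m1_def by (rule env_put[OF st(1)]) (simp add: env_vars_def)
  have m1: "m1 ''nd'' = m ''nd''" "m1 ''D'' = m ''D''" "m1 ''px'' = m ''px''" "m1 ''ptr'' = m ''ptr''"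
     "m1 ''bad'' = m ''bad''" "m1 ''v'' 0 = 0" "m1 ''fx'' = m ''fx''"
    by (simp_all add: m1_def put_row put_apply)
  let ?J = "\<lambda>i m' q. (m' ''bad'' 0 \<noteq> 0 \<longleftrightarrow> m ''bad'' 0 \<noteq> 0 \<or> (\<exists>d<i. d < length D \<and> ?bad d)) \<and>
    m' ''v'' 0 = of_bool (\<exists>d<i. d < length D \<and> ?val d) \<and> q \<le> i * (5 * L)"
  define m2 where "m2 = ev n f (For ''d'' ''s'' ?p) m1"
  have J: "?J (m1 ''s'' 0) m2 (qc n f (For ''d'' ''s'' ?p) m1)"
    unfolding m2_def
  proof (rule For_rule[where J = ?J])
    fix i m' and q :: nat
    assume fr: "\<And>y. y \<noteq> ''d'' \<Longrightarrow> y \<notin> mods ?p \<Longrightarrow> m' y = m1 y" and md: "m' ''d'' 0 = i"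
      and J: "?J i m' q"
    have e: "env m'" by (rule env_frame[OF e1]) (auto simp: env_vars_def intro!: fr)
    have fr': "m' ''nd'' = m ''nd''" "m' ''D'' = m ''D''" "m' ''px'' 0 = px" "m' ''ptr'' 0 = pt"
      using fr[of "''nd''"] fr[of "''D''"] fr[of "''px''"] fr[of "''ptr''"] st m1 by simp_all
    have enc: "enc D m'" by (rule enc_frame[OF st(2)]) (simp_all add: fr')
    have nd: "m' ''nd'' 0 = length D" using enc by (simp add: enc_def)
    show "?J (Suc i) (ev n f ?p m') (q + qc n f ?p m')"
    proof (cases "i < length D")
      case True
      have p: "ev n f ?p m' = ev n f term_prog m'" "qc n f ?p m' = qc n f term_prog m'" using True md nd by simp_all
      have ex: "(\<exists>d<Suc i. d < length D \<and> P d) \<longleftrightarrow> (\<exists>d<i. d < length D \<and> P d) \<or> P i" for P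
        using True less_Suc_eq by blast
      note T = term_prog[OF e enc True md fr'(3,4) bits]
      have "card (D ! i) \<le> L" using st(3) True by simp
      then have "q + 5 * card (D ! i) \<le> Suc i * (5 * L)" using J by simp
      then show ?thesis using J T unfolding p ex by simp
    next
      case False
      then have p: "ev n f ?p m' = m'" "qc n f ?p m' = 0" using md nd by simp_all
      have ex: "(\<exists>d<Suc i. d < length D \<and> P d) \<longleftrightarrow> (\<exists>d<i. d < length D \<and> P d)" for P
        using False less_Suc_eq by blast
      show ?thesis using J unfolding p ex by simp
    qed
  qed (auto simp: put_apply m1)
  have len: "length D \<le> s" using st(2) by (simp add: enc_def)
  have ex: "(\<exists>d<s. d < length D \<and> P (D ! d)) \<longleftrightarrow> (\<exists>T\<in>set D. P T)" for P
    using len by (metis in_set_conv_nth order_less_le_trans)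
  have m2: "m2 ''bad'' 0 \<noteq> 0 \<longleftrightarrow> m ''bad'' 0 \<noteq> 0 \<or> (\<exists>T\<in>set D. \<exists>j\<in>T. \<not> dict_ok (literal n f h T j) x c b)"
    "m2 ''v'' 0 = of_bool (\<exists>T\<in>set D. \<forall>j\<in>T. literal n f h T j x)"
    "qc n f (For ''d'' ''s'' ?p) m1 \<le> s * (5 * L)"
    using J ex[of "\<lambda>T. \<exists>j\<in>T. \<not> dict_ok (literal n f h T j) x c b"] ex[of "\<lambda>T. \<forall>j\<in>T. literal n f h T j x"]
    unfolding envD(3)[OF e1] by simp_all
  have m2': "m2 ''fx'' = m ''fx''" "m2 ''ptr'' = m ''ptr''"
    unfolding m2_def by (subst ev_frame; simp add: m1)+
  have n2: "m2 ''n'' 0 = n"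
    using envD(1)[OF env_ev[OF e1, of "For ''d'' ''s'' ?p"]] by (simp add: m2_def env_vars_def)
  define m3 where "m3 = (if m2 ''v'' 0 = m2 ''fx'' 0 then m2 else put m2 ''bad'' 0 1)"
  have eq: "bval m2 (Eq (V ''v'') (V ''fx'')) \<longleftrightarrow> m2 ''v'' 0 = m2 ''fx'' 0" by auto
  have ev: "ev n f round_prog m = put m3 ''ptr'' 0 (m3 ''ptr'' 0 + m3 ''n'' 0 + m3 ''n'' 0)"
    unfolding round_prog_def ev.simps(2,4) aval.simps m1_def[symmetric] m2_def[symmetric] ev.simps(5) eq
    by (simp add: m3_def)
  have qc: "qc n f round_prog m = qc n f (For ''d'' ''s'' ?p) m1"
    unfolding round_prog_def qc.simps(2,4,5) ev.simps(2) aval.simps m1_def[symmetric] by simp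
  have m3: "m3 ''ptr'' 0 = pt" "m3 ''n'' 0 = n"
    using st(5) n2 by (simp_all add: m3_def put_apply m2')
  have bad3: "m3 ''bad'' 0 \<noteq> 0 \<longleftrightarrow> m ''bad'' 0 \<noteq> 0 \<or> \<not> round_ok n f h D x (c, b)"
  proof -
    let ?val = "\<exists>T\<in>set D. \<forall>j\<in>T. literal n f h T j x"
    have "m2 ''v'' 0 = m2 ''fx'' 0 \<longleftrightarrow> f x = ?val"
      unfolding m2(2) m2'(1) st(6) of_bool_eq_iff by blast
    then have "m3 = (if f x = ?val then m2 else put m2 ''bad'' 0 1)"
      unfolding m3_def by simp
    moreover have "put m2 ''bad'' 0 1 ''bad'' 0 = 1" by (simp add: put_apply)
    ultimately have "m3 ''bad'' 0 \<noteq> 0 \<longleftrightarrow> m2 ''bad'' 0 \<noteq> 0 \<or> \<not> f x = ?val"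
      by (cases "f x = ?val") simp_all
    then show ?thesis unfolding m2(1) round_ok_def fst_conv snd_conv by blast
  qed
  show ?thesis using bad3 m2(3) unfolding ev qc by (simp add: put_apply m3)
qed

end

section \<open>Layout of the coins in memory\<close>

definition stored :: "(nat \<Rightarrow> nat) \<Rightarrow> nat \<Rightarrow> bool list \<Rightarrow> bool" where
  "stored R p xs \<longleftrightarrow> (\<forall>i<length xs. R (p + i) = of_bool (xs ! i))"

lemma stored_append: "stored R p (xs @ ys) \<longleftrightarrow> stored R p xs \<and> stored R (p + length xs) ys"
proof
  assume *: "stored R p (xs @ ys)"
  have "R (p + i) = of_bool (xs ! i)" if "i < length xs" for i
    using *[unfolded stored_def, rule_format, of i] that by (simp add: nth_append)
  moreover have "R (p + length xs + i) = of_bool (ys ! i)" if "i < length ys" for i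
    using *[unfolded stored_def, rule_format, of "length xs + i"] that by (simp add: add.assoc)
  ultimately show "stored R p xs \<and> stored R (p + length xs) ys" by (simp add: stored_def)
next
  assume *: "stored R p xs \<and> stored R (p + length xs) ys"
  show "stored R p (xs @ ys)"
    unfolding stored_def
  proof (intro allI impI)
    fix i assume i: "i < length (xs @ ys)"
    show "R (p + i) = of_bool ((xs @ ys) ! i)"
    proof (cases "i < length xs")
      case True
      then show ?thesis using * by (simp add: stored_def nth_append)
    next
      case False
      then have "R (p + length xs + (i - length xs)) = of_bool (ys ! (i - length xs))"
        using conjunct2[OF *, unfolded stored_def, rule_format, of "i - length xs"] False i by simp
      then show ?thesis using False by (simp add: nth_append)
    qed
  qed
qed

lemma stored_concat:
  assumes "stored R p (concat xs)" "\<And>x. x \<in> set xs \<Longrightarrow> length x = r" "i < length xs"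
  shows "stored R (p + i * r) (xs ! i)"
  using assms
proof (induction xs arbitrary: p i)
  case (Cons x xs)
  show ?case
  proof (cases i)
    case 0
    then show ?thesis using Cons.prems by (simp add: stored_append)
  next
    case (Suc i')
    have "stored R (p + r) (concat xs)" using Cons.prems by (auto simp: stored_append)
    from Cons.IH[OF this, of i'] show ?thesis using Cons.prems Suc by (simp add: add.assoc)
  qed
qed simp

lemma length_concat_uniform: "(\<And>x. x \<in> set xs \<Longrightarrow> length x = r) \<Longrightarrow> length (concat xs) = length xs * r"
  by (induction xs) auto

definition flat_pair :: "bool list \<times> bool list \<Rightarrow> bool list" where
  "flat_pair cb = fst cb @ snd cb"

definition flat_row :: "bool list \<times> (bool list \<times> bool list) list \<Rightarrow> bool list" where
  "flat_row z = fst z @ concat (map flat_pair (snd z))"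

text \<open>The order in which the program consumes the bits in \<open>R\<close>.\<close>

definition flat :: "coins \<Rightarrow> bool list" where
  "flat = (\<lambda>(hs, ys, zs). concat hs @ concat ys @ concat (map flat_row zs))"

context machine
begin

lemma bits_at_stored: "x \<in> cube n \<Longrightarrow> stored R p x \<Longrightarrow> bits_at p x"
  by (simp add: bits_at_def stored_def in_cube)

definition row_shape :: "bool list \<times> (bool list \<times> bool list) list \<Rightarrow> bool" where
  "row_shape z \<longleftrightarrow> fst z \<in> cube n \<and> length (snd z) = L \<and> set (snd z) \<subseteq> cube n \<times> cube n"

lemma length_flat_pair: "cb \<in> cube n \<times> cube n \<Longrightarrow> length (flat_pair cb) = 2 * n"
  by (auto simp: flat_pair_def in_cube)

lemma length_flat_row: "row_shape z \<Longrightarrow> length (flat_row z) = n + L * (2 * n)"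
proof -
  assume z: "row_shape z"
  have "length (concat (map flat_pair (snd z))) = length (map flat_pair (snd z)) * (2 * n)"
  proof (rule length_concat_uniform)
    show "length x = 2 * n" if "x \<in> set (map flat_pair (snd z))" for x
      using that z length_flat_pair unfolding row_shape_def by auto
  qed
  then show ?thesis using z by (simp add: row_shape_def flat_row_def in_cube)
qed

lemma row_prog:
  assumes st: "env m" "enc D m" "\<And>T. T \<in> set D \<Longrightarrow> card T \<le> L"
    and z: "row_shape z" "stored R (m ''ptr'' 0) (flat_row z)"
  shows "(ev n f row_prog m ''bad'' 0 \<noteq> 0 \<longleftrightarrow> m ''bad'' 0 \<noteq> 0 \<or> \<not> row_ok n f h D z) \<and>
    ev n f row_prog m ''ptr'' 0 = m ''ptr'' 0 + (n + L * (2 * n)) \<and> qc n f row_prog m \<le> 1 + L * (s * (5 * L))"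
proof -
  obtain x cbs where zz: "z = (x, cbs)" by force
  define p where "p = m ''ptr'' 0"
  have x: "x \<in> cube n" "length cbs = L" "set cbs \<subseteq> cube n \<times> cube n" using z(1) by (auto simp: row_shape_def zz)
  have S: "stored R p x" "stored R (p + n) (concat (map flat_pair cbs))"
    using z(2) x(1) by (auto simp: flat_row_def zz stored_append in_cube p_def)
  have bx: "bits_at p x" using bits_at_stored x(1) S(1) by blast
  have bcb: "bits_at (p + n + k * (2 * n)) (fst (cbs ! k))" "bits_at (p + n + k * (2 * n) + n) (snd (cbs ! k))"
    if k: "k < L" for k
  proof -
    have cb: "cbs ! k \<in> cube n \<times> cube n" using x(2,3) k by (metis nth_mem subsetD)
    have "stored R (p + n + k * (2 * n)) (map flat_pair cbs ! k)"
      by (rule stored_concat[OF S(2)]) (use x k length_flat_pair in auto)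
    then have "stored R (p + n + k * (2 * n)) (fst (cbs ! k))" "stored R (p + n + k * (2 * n) + n) (snd (cbs ! k))"
      using k x(2) cb by (auto simp: flat_pair_def stored_append in_cube)
    then show "bits_at (p + n + k * (2 * n)) (fst (cbs ! k))" "bits_at (p + n + k * (2 * n) + n) (snd (cbs ! k))"
      using cb by (auto intro!: bits_at_stored)
  qed
  let ?fill = "For ''i'' ''n'' (Set ''W'' (V ''i'') (Cell ''R'' (Plus (V ''ptr'') (V ''i''))))"
  define m1 where "m1 = put m ''px'' 0 p"
  define m2 where "m2 = ev n f ?fill m1"
  define m3 where "m3 = ev n f (Ask ''fx'' (Num 0) ''W'') m2"
  define m4 where "m4 = put m3 ''ptr'' 0 (p + n)"
  have e1: "env m1" unfolding m1_def by (rule env_put[OF st(1)]) (simp add: env_vars_def)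
  have e2: "env m2" unfolding m2_def by (rule env_ev[OF e1]) (simp add: env_vars_def)
  have e3: "env m3" unfolding m3_def by (rule env_ev[OF e2]) (simp add: env_vars_def)
  have e4: "env m4" unfolding m4_def by (rule env_put[OF e3]) (simp add: env_vars_def)
  have m1: "m1 ''nd'' = m ''nd''" "m1 ''D'' = m ''D''" "m1 ''px'' 0 = p" "m1 ''ptr'' 0 = p" "m1 ''bad'' = m ''bad''"
    by (simp_all add: m1_def put_row put_apply p_def)
  have m2: "m2 ''nd'' = m ''nd''" "m2 ''D'' = m ''D''" "m2 ''px'' 0 = p" "m2 ''ptr'' 0 = p" "m2 ''bad'' = m ''bad''"
    unfolding m2_def by (subst ev_frame; simp add: m1)+
  have m3: "m3 ''nd'' = m ''nd''" "m3 ''D'' = m ''D''" "m3 ''px'' 0 = p" "m3 ''ptr'' 0 = p" "m3 ''bad'' = m ''bad''"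
    unfolding m3_def by (subst ev_frame; simp add: m2)+
  have W: "m2 ''W'' = (\<lambda>j. if 0 \<le> j \<and> j < 0 + m1 ''n'' 0 then R (p + (j - 0)) else m1 ''W'' j)"
    unfolding m2_def
    by (rule For_fill[where off = 0 and g = "\<lambda>j. R (p + j)"]) (use envD[OF e1] m1 in \<open>simp_all add: put_same\<close>)
  have "map (\<lambda>j. m2 ''W'' j \<noteq> 0) [0..<n] = x"
    using S(1) x(1) envD[OF e1] unfolding W by (auto simp: stored_def in_cube intro!: nth_equalityI)
  then have fx3: "m3 ''fx'' 0 = of_bool (f x)" by (simp add: m3_def put_apply)
  have m4: "m4 ''nd'' = m ''nd''" "m4 ''D'' = m ''D''" "m4 ''px'' 0 = p" "m4 ''ptr'' 0 = p + n" "m4 ''bad'' = m ''bad''"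
    "m4 ''fx'' 0 = of_bool (f x)"
    by (simp_all add: m4_def put_row put_apply m3 fx3)
  let ?J = "\<lambda>k m' q. (m' ''bad'' 0 \<noteq> 0 \<longleftrightarrow> m ''bad'' 0 \<noteq> 0 \<or> (\<exists>k'<k. \<not> round_ok n f h D x (cbs ! k'))) \<and>
    m' ''ptr'' 0 = p + n + k * (2 * n) \<and> q \<le> k * (s * (5 * L))"
  define m5 where "m5 = ev n f (For ''e'' ''L'' round_prog) m4"
  have J: "?J (m4 ''L'' 0) m5 (qc n f (For ''e'' ''L'' round_prog) m4)"
    unfolding m5_def
  proof (rule For_rule[where J = ?J])
    show "?J 0 m4 0" by (simp add: m4)
  next
    fix k m' and q :: nat
    assume k: "k < m4 ''L'' 0" and fr: "\<And>y. y \<noteq> ''e'' \<Longrightarrow> y \<notin> mods round_prog \<Longrightarrow> m' y = m4 y" and J: "?J k m' q"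
    have k': "k < L" using k envD[OF e4] by simp
    have e: "env m'" by (rule env_frame[OF e4]) (auto simp: env_vars_def intro!: fr)
    have fr': "m' ''nd'' = m ''nd''" "m' ''D'' = m ''D''" "m' ''px'' 0 = p" "m' ''fx'' 0 = of_bool (f x)"
      using fr[of "''nd''"] fr[of "''D''"] fr[of "''px''"] fr[of "''fx''"] m4 by simp_all
    have enc: "enc D m'" by (rule enc_frame[OF st(2)]) (simp_all add: fr')
    have ptr: "m' ''ptr'' 0 = p + n + k * (2 * n)" using J by blast
    have ex: "(\<exists>k'<Suc k. P k') \<longleftrightarrow> (\<exists>k'<k. P k') \<or> P k" for P by (auto simp: less_Suc_eq)
    note T = round_prog[OF e enc st(3) fr'(3) ptr fr'(4) bx bcb[OF k'], unfolded prod.collapse]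
    show "?J (Suc k) (ev n f round_prog m') (q + qc n f round_prog m')"
    proof (intro conjI)
      show "q + qc n f round_prog m' \<le> Suc k * (s * (5 * L))"
        using J T unfolding mult_Suc by linarith
    qed (use J T ex in simp_all)
  next
    fix k :: nat and m' :: memory and q a :: nat
    assume "?J k m' q"
    then show "?J k (put m' ''e'' 0 a) q" by (simp add: put_apply)
  qed
  have n3: "m3 ''ptr'' 0 + m3 ''n'' 0 = p + n" using m3 envD[OF e3] by simp
  have ev: "ev n f row_prog m = m5"
    unfolding row_prog_def ev.simps(2,4) aval.simps p_def[symmetric] m1_def[symmetric] m2_def[symmetric]
      m3_def[symmetric] n3 m4_def[symmetric] m5_def[symmetric] ..
  have qc0: "qc n f ?fill m1 = 0" by (rule qc_no_asks) simp
  have qc: "qc n f row_prog m = 1 + qc n f (For ''e'' ''L'' round_prog) m4"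
    unfolding row_prog_def qc.simps(2,3,4) ev.simps(2,4) aval.simps p_def[symmetric] m1_def[symmetric] m2_def[symmetric]
      m3_def[symmetric] n3 m4_def[symmetric] qc0 by simp
  have ok: "row_ok n f h D z \<longleftrightarrow> \<not> (\<exists>k'<L. \<not> round_ok n f h D x (cbs ! k'))"
    by (auto simp: row_ok_def zz x(2)[symmetric] all_set_conv_all_nth)
  show ?thesis
    using J unfolding ev qc ok p_def[symmetric] envD(4)[OF e4] by simp
qed

lemma test_prog:
  assumes st: "env m" "enc D m" "\<And>T. T \<in> set D \<Longrightarrow> card T \<le> L" "m ''m2'' 0 = length zs"
    and z: "\<And>z. z \<in> set zs \<Longrightarrow> row_shape z" "stored R (m ''ptr'' 0) (concat (map flat_row zs))"
  shows "(ev n f test_prog m ''bad'' 0 \<noteq> 0 \<longleftrightarrow> m ''bad'' 0 \<noteq> 0 \<or> \<not> (\<forall>z\<in>set zs. row_ok n f h D z)) \<and>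
    qc n f test_prog m \<le> length zs * (1 + L * (s * (5 * L)))"
proof -
  define p where "p = m ''ptr'' 0"
  let ?J = "\<lambda>t m' q. (m' ''bad'' 0 \<noteq> 0 \<longleftrightarrow> m ''bad'' 0 \<noteq> 0 \<or> (\<exists>t'<t. \<not> row_ok n f h D (zs ! t'))) \<and>
    m' ''ptr'' 0 = p + t * (n + L * (2 * n)) \<and> q \<le> t * (1 + L * (s * (5 * L)))"
  have J: "?J (m ''m2'' 0) (ev n f test_prog m) (qc n f test_prog m)"
    unfolding test_prog_def
  proof (rule For_rule[where J = ?J])
    show "?J 0 m 0" by (simp add: p_def)
  next
    fix t m' and q :: nat
    assume t: "t < m ''m2'' 0" and fr: "\<And>y. y \<noteq> ''t'' \<Longrightarrow> y \<notin> mods row_prog \<Longrightarrow> m' y = m y" and J: "?J t m' q"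
    have t': "t < length zs" using t st(4) by simp
    have e: "env m'" by (rule env_frame[OF st(1)]) (auto simp: env_vars_def intro!: fr)
    have fr': "m' ''nd'' = m ''nd''" "m' ''D'' = m ''D''"
      using fr[of "''nd''"] fr[of "''D''"] by simp_all
    have enc: "enc D m'" by (rule enc_frame[OF st(2)]) (simp_all add: fr')
    have ptr: "m' ''ptr'' 0 = p + t * (n + L * (2 * n))" using J by blast
    have "stored R (p + t * (n + L * (2 * n))) (map flat_row zs ! t)"
      by (rule stored_concat[OF z(2)[folded p_def]]) (use t' z(1) length_flat_row in auto)
    then have S: "stored R (m' ''ptr'' 0) (flat_row (zs ! t))" using t' ptr by simp
    have ex: "(\<exists>k'<Suc t. P k') \<longleftrightarrow> (\<exists>k'<t. P k') \<or> P t" for P by (auto simp: less_Suc_eq)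
    note T = row_prog[OF e enc st(3) z(1)[OF nth_mem[OF t']] S]
    show "?J (Suc t) (ev n f row_prog m') (q + qc n f row_prog m')"
    proof (intro conjI)
      show "q + qc n f row_prog m' \<le> Suc t * (1 + L * (s * (5 * L)))"
        using J T unfolding mult_Suc by linarith
      show "ev n f row_prog m' ''ptr'' 0 = p + Suc t * (n + L * (2 * n))"
        using T ptr unfolding mult_Suc by linarith
    qed (use J T ex in simp_all)
  next
    fix k :: nat and m' :: memory and q a :: nat
    assume "?J k m' q"
    then show "?J k (put m' ''t'' 0 a) q" by (simp add: put_apply)
  qed
  have ok: "(\<forall>z\<in>set zs. row_ok n f h D z) \<longleftrightarrow> \<not> (\<exists>t'<length zs. \<not> row_ok n f h D (zs ! t'))"
    by (auto simp: all_set_conv_all_nth)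
  show ?thesis using J unfolding ok st(4) by simp
qed

end

lemma mods_hash_prog [simp]: "mods hash_prog = {''i'', ''h'', ''b'', ''ptr''}"
  by (auto simp: hash_prog_def)

lemma qc_hash_prog [simp]: "qc n f hash_prog m = 0"
  by (rule qc_no_asks) (simp add: hash_prog_def)

lemma mods_rb_prog [simp]: "mods rb_prog = {''t'', ''rb''}"
  by (auto simp: rb_prog_def)

lemma qc_rb_prog [simp]: "qc n f rb_prog m = 0"
  by (rule qc_no_asks) (simp add: rb_prog_def)

lemma hash_prog:
  assumes "m ''n'' 0 = length hs" "m ''hb'' 0 = w" "m ''ptr'' 0 = 0" "set hs \<subseteq> cube w" "stored (m ''R'') 0 (concat hs)"
  shows "(\<forall>i<length hs. ev n f hash_prog m ''h'' i = hash hs i) \<and> ev n f hash_prog m ''ptr'' 0 = length hs * w"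
proof -
  let ?in = "Set ''h'' (V ''i'') (Plus (Plus (Cell ''h'' (V ''i'')) (Cell ''h'' (V ''i''))) (Cell ''R'' (V ''ptr''))) ;;
       set0 ''ptr'' (Plus (V ''ptr'') (Num 1))"
  let ?p = "Set ''h'' (V ''i'') (Num 0) ;; For ''b'' ''hb'' ?in"
  let ?J = "\<lambda>i m' (q::nat). (\<forall>i'<i. m' ''h'' i' = hash hs i') \<and> m' ''ptr'' 0 = i * w"
  have "?J (m ''n'' 0) (ev n f hash_prog m) (qc n f hash_prog m)"
    unfolding hash_prog_def
  proof (rule For_rule[where J = ?J])
    fix i m' and q :: nat
    assume i: "i < m ''n'' 0" and fr: "\<And>y. y \<noteq> ''i'' \<Longrightarrow> y \<notin> mods ?p \<Longrightarrow> m' y = m y" and mi: "m' ''i'' 0 = i" and J: "?J i m' q"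
    have i': "i < length hs" using i assms(1) by simp
    have len: "length (hs ! i) = w" using assms(4) i' by (auto simp: in_cube[symmetric])
    have S: "stored (m ''R'') (i * w) (hs ! i)"
      using stored_concat[OF assms(5), of w i] i' assms(4) by (auto simp: in_cube[symmetric])
    define m1 where "m1 = put m' ''h'' i 0"
    have m1: "m1 ''R'' = m ''R''" "m1 ''hb'' 0 = w" "m1 ''i'' 0 = i" "m1 ''ptr'' 0 = i * w" "m1 ''h'' i = 0"
      "\<And>i'. i' < i \<Longrightarrow> m1 ''h'' i' = hash hs i'"
      using fr[of "''R''"] fr[of "''hb''"] mi J assms(2) by (simp_all add: m1_def put_row put_apply)
    let ?K = "\<lambda>b m' (q::nat). (\<forall>i'<i. m' ''h'' i' = hash hs i') \<and> m' ''ptr'' 0 = i * w + b \<and> m' ''i'' 0 = i \<and>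
        m' ''h'' i = horner (take b (hs ! i))"
    have K: "?K (m1 ''hb'' 0) (ev n f (For ''b'' ''hb'' ?in) m1) (qc n f (For ''b'' ''hb'' ?in) m1)"
    proof (rule For_rule[where J = ?K])
      fix b m'' and q :: nat
      assume b: "b < m1 ''hb'' 0" and fr2: "\<And>y. y \<noteq> ''b'' \<Longrightarrow> y \<notin> mods ?in \<Longrightarrow> m'' y = m1 y" and K: "?K b m'' q"
      have b': "b < length (hs ! i)" using b m1 len by simp
      have R: "m'' ''R'' (i * w + b) = of_bool (hs ! i ! b)"
        using fr2[of "''R''"] m1(1) S b' by (simp add: stored_def)
      have "horner (take (Suc b) (hs ! i)) = 2 * horner (take b (hs ! i)) + of_bool (hs ! i ! b)"
        using b' by (simp add: take_Suc_conv_app_nth horner_snoc)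
      then show "?K (Suc b) (ev n f ?in m'') (q + qc n f ?in m'')"
        using K R by (simp add: put_apply)
    qed (auto simp: m1 put_apply horner_def)
    have ev: "ev n f ?p m' = ev n f (For ''b'' ''hb'' ?in) m1"
      unfolding ev.simps(2,4) aval.simps mi m1_def ..
    show "?J (Suc i) (ev n f ?p m') (q + qc n f ?p m')"
      using K len unfolding ev m1(2) by (auto simp: less_Suc_eq hash_def)
  qed (auto simp: put_apply assms)
  then show ?thesis using assms(1) by simp
qed

lemma rb_prog:
  assumes "m ''s'' 0 = s" "m ''r'' 0 = r" "m ''rb'' 0 = 0"
  shows "\<forall>d\<le>s. ev n f rb_prog m ''rb'' d = d * r"
proof -
  let ?p = "Set ''rb'' (Plus (V ''t'') (Num 1)) (Plus (Cell ''rb'' (V ''t'')) (V ''r''))"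
  let ?J = "\<lambda>i m' (q::nat). \<forall>d\<le>i. m' ''rb'' d = d * r"
  have "?J (m ''s'' 0) (ev n f rb_prog m) (qc n f rb_prog m)"
    unfolding rb_prog_def
  proof (rule For_rule[where J = ?J])
    fix i m' and q :: nat
    assume fr: "\<And>y. y \<noteq> ''t'' \<Longrightarrow> y \<notin> mods ?p \<Longrightarrow> m' y = m y" and mi: "m' ''t'' 0 = i" and J: "?J i m' q"
    show "?J (Suc i) (ev n f ?p m') (q + qc n f ?p m')"
      using fr[of "''r''"] mi J assms(2) by (auto simp: put_apply le_Suc_eq)
  qed (auto simp: put_apply assms)
  then show ?thesis using assms(1) by simp
qed

text \<open>The array computed by the program agrees with \<open>hash hs\<close> below
  \<open>n\<close> only, which is all that enters the queries to \<open>f\<close>.\<close>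

lemma map_hash_cong:
  assumes "\<And>i. i < n \<Longrightarrow> h i = h' i"
  shows "hashed n f h = hashed n f h'" "literal n f h = literal n f h'" "row_ok n f h = row_ok n f h'"
proof -
  show 1: "hashed n f h = hashed n f h'"
    using assms by (auto simp: hashed_def fun_eq_iff intro!: arg_cong[where f = f] map_cong)
  show 2: "literal n f h = literal n f h'"
    using assms by (auto simp: literal_def fun_eq_iff intro!: arg_cong[where f = f] map_cong)
  show "row_ok n f h = row_ok n f h'"
    by (simp add: row_ok_def[abs_def] round_ok_def[abs_def] 2)
qed

definition start :: "nat \<Rightarrow> nat \<Rightarrow> nat \<Rightarrow> coins \<Rightarrow> memory \<Rightarrow> bool" where
  "start n s l = (\<lambda>(hs, ys, zs) m.
     m ''n'' 0 = n \<and> m ''s'' 0 = s \<and> m ''L'' 0 = 2 * l + 18 \<and> m ''hb'' 0 = 4 * l + 13 \<and>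
     m ''r'' 0 = 2 ^ (4 * l + 13) \<and> m ''m1'' 0 = length ys \<and> m ''m2'' 0 = length zs \<and>
     m ''ptr'' 0 = 0 \<and> m ''nd'' 0 = 0 \<and> m ''bad'' 0 = 0 \<and> m ''out'' 0 = 0 \<and> m ''rb'' 0 = 0 \<and>
     nz (m ''T'') = {} \<and> nz (m ''Y'') = {} \<and> stored (m ''R'') 0 (flat (hs, ys, zs)))"

lemma main_prog:
  assumes c: "(hs, ys, zs) \<in> set_pmf (coins_pmf n s k l)" and start: "start n s l (hs, ys, zs) m"
  shows "(ev n f main_prog m ''out'' 0 \<noteq> 0 \<longleftrightarrow> accepts n f s l (hs, ys, zs)) \<and>
    qc n f main_prog m \<le> 19200 * (s * k) + s * ((2 * l + 18) * (1 + (4 * l + 13)) + 1) +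
      200 * k * (1 + (2 * l + 18) * (s * (5 * (2 * l + 18))))"
proof -
  define L where "L = 2 * l + 18"
  define w where "w = 4 * l + 13"
  define r where "r = (2::nat) ^ w"
  have hs: "length hs = n" "set hs \<subseteq> cube w" and ys: "length ys = 19200 * (s * k)" "set ys \<subseteq> cube r"
    and zs: "length zs = 200 * k" "\<And>z. z \<in> set zs \<Longrightarrow> z \<in> set_pmf (row_pmf n L)"
    using c by (auto simp: coins_pmf_def set_replicate_pmf L_def w_def r_def)
  define m1 where "m1 = ev n f hash_prog m"
  define m2 where "m2 = ev n f rb_prog m1"
  define m3 where "m3 = ev n f learn_prog m2"
  define m4 where "m4 = ev n f test_prog m3"
  note st = start[unfolded start_def prod.case, folded L_def w_def, folded r_def]
  have stR: "stored (m ''R'') 0 (concat hs)" "stored (m ''R'') (n * w) (concat ys)"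
    "stored (m ''R'') (n * w + length ys * r) (concat (map flat_row zs))"
  proof -
    have "length (concat hs) = length hs * w"
      by (rule length_concat_uniform) (use hs(2) in \<open>auto simp: in_cube[symmetric]\<close>)
    moreover have "length (concat ys) = length ys * r"
      by (rule length_concat_uniform) (use ys(2) in \<open>auto simp: in_cube[symmetric]\<close>)
    moreover note hs(1)
    moreover have "stored (m ''R'') 0 (concat hs @ concat ys @ concat (map flat_row zs))"
      using st by (simp add: flat_def)
    ultimately show "stored (m ''R'') 0 (concat hs)" "stored (m ''R'') (n * w) (concat ys)"
      "stored (m ''R'') (n * w + length ys * r) (concat (map flat_row zs))"
      unfolding stored_append by simp_all
  qed
  have H: "\<And>i. i < n \<Longrightarrow> m1 ''h'' i = hash hs i" "m1 ''ptr'' 0 = n * w"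
    using hash_prog[of m hs w n f] st hs stR(1) by (auto simp: m1_def)
  have m1: "m1 ''n'' = m ''n''" "m1 ''s'' = m ''s''" "m1 ''L'' = m ''L''" "m1 ''hb'' = m ''hb''" "m1 ''r'' = m ''r''"
    "m1 ''m1'' = m ''m1''" "m1 ''m2'' = m ''m2''" "m1 ''nd'' = m ''nd''" "m1 ''bad'' = m ''bad''" "m1 ''out'' = m ''out''"
    "m1 ''rb'' = m ''rb''" "m1 ''T'' = m ''T''" "m1 ''Y'' = m ''Y''" "m1 ''R'' = m ''R''"
    unfolding m1_def by (subst ev_frame; simp)+
  have m2: "m2 ''n'' = m ''n''" "m2 ''s'' = m ''s''" "m2 ''L'' = m ''L''" "m2 ''hb'' = m ''hb''" "m2 ''r'' = m ''r''"
    "m2 ''m1'' = m ''m1''" "m2 ''m2'' = m ''m2''" "m2 ''nd'' = m ''nd''" "m2 ''bad'' = m ''bad''" "m2 ''out'' = m ''out''"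
    "m2 ''T'' = m ''T''" "m2 ''Y'' = m ''Y''" "m2 ''R'' = m ''R''" "m2 ''h'' = m1 ''h''" "m2 ''ptr'' = m1 ''ptr''"
    unfolding m2_def by (subst ev_frame; simp add: m1)+
  have rb: "\<forall>d\<le>s. m2 ''rb'' d = d * r"
    unfolding m2_def by (rule rb_prog) (use m1 st in simp_all)
  define h where "h = m2 ''h''"
  have h_hash: "h i = hash hs i" if "i < n" for i using H(1)[OF that] m2 by (simp add: h_def)
  have h_less: "h i < r" if "i < n" for i
  proof -
    have "hs ! i \<in> cube w" using hs that by (metis nth_mem subsetD)
    then show ?thesis using horner_less[of "hs ! i"] h_hash[OF that] by (simp add: hash_def r_def in_cube)
  qed
  interpret machine n r s L w f h "m ''R''" "m2 ''rb''"
    by unfold_locales (use h_less rb r_def in auto)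
  have e2: "env m2" unfolding env_def using st by (simp add: m2 h_def)
  have shape: "row_shape z" if "z \<in> set zs" for z
    using zs(2)[OF that] by (auto simp: row_shape_def row_pmf_def set_replicate_pmf)
  obtain D bad where D: "learn (hashed n f h) L w r s ys = (D, bad)" by force
  have size: "card T \<le> L" if "T \<in> set D" for T
    using learn_size[OF ys(2) rw D] that by blast
  have learn: "enc D m3" "m3 ''bad'' 0 \<noteq> 0 \<longleftrightarrow> bad" "m3 ''ptr'' 0 = n * w + length ys * r"
    "qc n f learn_prog m2 \<le> length ys + s * learn_cost"
  proof -
    have R: "m ''R'' (m2 ''ptr'' 0 + i * r + j) = of_bool (ys ! i ! j)" if "i < length ys" "j < r" for i j
    proof -
      have "stored (m ''R'') (n * w + i * r) (ys ! i)"
        by (rule stored_concat[OF stR(2)]) (use ys(2) that in \<open>auto simp: in_cube[symmetric]\<close>)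
      moreover have "length (ys ! i) = r" using ys(2) that by (auto simp: in_cube[symmetric])
      ultimately show ?thesis using that H(2) m2 by (simp add: stored_def)
    qed
    have "enc [] m2" using st by (simp add: enc_def m2)
    from learn_prog[OF e2 _ ys(2) this _ _ _ R D]
    show "enc D m3" "m3 ''bad'' 0 \<noteq> 0 \<longleftrightarrow> bad" "m3 ''ptr'' 0 = n * w + length ys * r"
      "qc n f learn_prog m2 \<le> length ys + s * learn_cost"
      using st H(2) by (simp_all add: m2 m3_def)
  qed
  have e3: "env m3" unfolding m3_def by (rule env_ev[OF e2]) (simp add: env_vars_def)
  have m3: "m3 ''m2'' = m ''m2''" "m3 ''out'' = m ''out''"
    unfolding m3_def by (subst ev_frame; simp add: m2)+
  have test: "m4 ''bad'' 0 \<noteq> 0 \<longleftrightarrow> bad \<or> \<not> (\<forall>z\<in>set zs. row_ok n f h D z)"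
    "qc n f test_prog m3 \<le> length zs * (1 + L * (s * (5 * L)))"
    using test_prog[OF e3 learn(1) size, of zs] st m3 shape learn stR(3) by (auto simp: m4_def)
  have m4: "m4 ''out'' = m ''out''"
    unfolding m4_def by (subst ev_frame; simp add: m3 test_prog_def)
  have ev: "ev n f main_prog m = (if m4 ''bad'' 0 \<noteq> 0 then m4 else put m4 ''out'' 0 1)"
    unfolding main_prog_def ev.simps(4) m1_def[symmetric] m2_def[symmetric] m3_def[symmetric] m4_def[symmetric]
    by simp
  have qc: "qc n f main_prog m = qc n f learn_prog m2 + qc n f test_prog m3"
    unfolding main_prog_def qc.simps(1,2,4,5) if_cancel m1_def[symmetric] m2_def[symmetric] m3_def[symmetric]
    by simp
  have hashed_eq: "hashed n f (hash hs) = hashed n f h"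
    by (rule map_hash_cong(1)) (simp add: h_hash)
  have row_eq: "row_ok n f (hash hs) = row_ok n f h"
    by (rule map_hash_cong(3)) (simp add: h_hash)
  have acc: "accepts n f s l (hs, ys, zs) \<longleftrightarrow> \<not> bad \<and> (\<forall>z\<in>set zs. row_ok n f h D z)"
    unfolding accepts_def prod.case L_def[symmetric] w_def[symmetric] r_def[symmetric] hashed_eq row_eq D ..
  have "ev n f main_prog m ''out'' 0 \<noteq> 0 \<longleftrightarrow> \<not> (m4 ''bad'' 0 \<noteq> 0)"
    unfolding ev using st m4 by (simp add: put_apply)
  then have "ev n f main_prog m ''out'' 0 \<noteq> 0 \<longleftrightarrow> accepts n f s l (hs, ys, zs)"
    unfolding acc test(1) by blast
  moreover have "qc n f main_prog m \<le> (length ys + s * learn_cost) + length zs * (1 + L * (s * (5 * L)))"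
    unfolding qc using learn(4) test(2) by linarith
  ultimately show ?thesis
    unfolding ys(1) zs(1) learn_cost_def L_def[symmetric] w_def[symmetric] by simp
qed

section \<open>Random bits and parameters\<close>

abbreviation coin :: "bool pmf" where
  "coin \<equiv> bernoulli_pmf (1 / 2)"

lemma replicate_coin: "replicate_pmf n coin = U n"
proof (induction n)
  case 0
  have "cube 0 = {[]}" by (auto simp: cube_def)
  then show ?case by (simp add: pmf_of_set_singleton)
next
  case (Suc n)
  have "pair_pmf coin (U n) = pmf_of_set (UNIV \<times> cube n)"
  proof (rule pmf_eqI)
    fix z :: "bool \<times> bool list"
    show "pmf (pair_pmf coin (U n)) z = pmf (pmf_of_set (UNIV \<times> cube n)) z"
      by (cases z) (auto simp: pmf_pair bernoulli_pmf_half_conv_pmf_of_set indicator_def card_cartesian_product)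
  qed
  moreover have "bij_betw (\<lambda>(x, xs). x # xs) (UNIV \<times> cube n) (cube (Suc n))"
    by (rule bij_betw_byWitness[where f' = "\<lambda>xs. (hd xs, tl xs)"]) (auto simp: cube_def length_Suc_conv)
  ultimately show ?case
    unfolding replicate_pmf_Suc_pair Suc by (simp add: map_pmf_of_set_bij_betw)
qed

lemma map_append_pair:
  "map_pmf (\<lambda>(x, y). x @ y) (pair_pmf (replicate_pmf a p) (replicate_pmf b p)) = replicate_pmf (a + b) p"
  by (simp add: replicate_pmf_distrib pair_pmf_def map_pmf_def bind_assoc_pmf bind_return_pmf)

lemma map_append_pair_map:
  assumes "map_pmf g A = replicate_pmf a p" "map_pmf h B = replicate_pmf b p"
  shows "map_pmf (\<lambda>(x, y). g x @ h y) (pair_pmf A B) = replicate_pmf (a + b) p"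
proof -
  have "map_pmf (\<lambda>(x, y). x @ y) (map_pmf (\<lambda>(x, y). (g x, h y)) (pair_pmf A B)) = replicate_pmf (a + b) p"
    unfolding map_pair assms map_append_pair ..
  then show ?thesis by (simp add: map_pmf_comp case_prod_beta')
qed

lemma map_concat_replicate:
  assumes "map_pmf g M = replicate_pmf r p"
  shows "map_pmf (\<lambda>xs. concat (map g xs)) (replicate_pmf m M) = replicate_pmf (m * r) p"
proof (induction m)
  case 0
  show ?case by simp
next
  case (Suc m)
  have "map_pmf (\<lambda>xs. concat (map g xs)) (replicate_pmf (Suc m) M) =
      map_pmf (\<lambda>(x, xs). g x @ concat (map g xs)) (pair_pmf M (replicate_pmf m M))"
    unfolding replicate_pmf_Suc_pair by (simp add: map_pmf_comp case_prod_beta')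
  also have "\<dots> = replicate_pmf (r + m * r) p"
    by (rule map_append_pair_map[OF assms Suc])
  finally show ?case by simp
qed

text \<open>Flattening turns the structured coins into independent fair bits, so the bits written by
  \<open>flips\<close> can be read as a draw from \<open>coins_pmf\<close>.\<close>

lemma map_flat_coins:
  "map_pmf flat (coins_pmf n s k l) =
    replicate_pmf (n * (4 * l + 13) + (19200 * (s * k) * 2 ^ (4 * l + 13) + 200 * k * (n + (2 * l + 18) * (n + n)))) coin"
proof -
  have id: "map_pmf (\<lambda>x. x) (U a) = replicate_pmf a coin" for a by (simp add: replicate_coin)
  have pair: "map_pmf flat_pair (pair_pmf (U n) (U n)) = replicate_pmf (n + n) coin"
    using map_append_pair_map[OF id id, of n n] by (simp add: flat_pair_def[abs_def] case_prod_beta')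
  have row: "map_pmf flat_row (row_pmf n K) = replicate_pmf (n + K * (n + n)) coin" for K
    using map_append_pair_map[OF id map_concat_replicate[OF pair], of n K]
    by (simp add: flat_row_def[abs_def] row_pmf_def case_prod_beta')
  have "map_pmf (\<lambda>(hs, z). concat (map (\<lambda>x. x) hs) @ (case z of (ys, zs) \<Rightarrow> concat (map (\<lambda>x. x) ys) @ concat (map flat_row zs)))
      (coins_pmf n s k l) =
    replicate_pmf (n * (4 * l + 13) + (19200 * (s * k) * 2 ^ (4 * l + 13) + 200 * k * (n + (2 * l + 18) * (n + n)))) coin"
    unfolding coins_pmf_def
    by (intro map_append_pair_map map_concat_replicate id row)
  then show ?thesis by (simp add: flat_def case_prod_beta')
qed

definition flips :: com where
  "flips = Seq (Assign ''i'' (Num 0) (Num 0))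
     (While (Less (V ''i'') (V ''N'')) (Seq (Flip ''R'' (V ''i'')) (Assign ''i'' (Num 0) (Plus (V ''i'') (Num 1)))))"

text \<open>The effect of the loop in \<open>flips\<close> for given outcomes of the coins, counter
  included.\<close>

primrec fill_bits :: "memory \<Rightarrow> bool list \<Rightarrow> memory" where
  "fill_bits m [] = m"
| "fill_bits m (b # bs) = fill_bits (put (put m ''R'' (m ''i'' 0) (of_bool b)) ''i'' 0 (m ''i'' 0 + 1)) bs"

lemma fill_bits_frame: "y \<noteq> ''i'' \<Longrightarrow> y \<noteq> ''R'' \<Longrightarrow> fill_bits m bs y = m y"
  by (induction bs arbitrary: m) (simp_all add: put_row)

lemma fill_bits_stored:
  "stored (fill_bits m bs ''R'') (m ''i'' 0) bs \<and> (\<forall>j<m ''i'' 0. fill_bits m bs ''R'' j = m ''R'' j)"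
proof (induction bs arbitrary: m)
  case Nil
  then show ?case by (simp add: stored_def)
next
  case (Cons b bs)
  let ?m = "put (put m ''R'' (m ''i'' 0) (of_bool b)) ''i'' 0 (m ''i'' 0 + 1)"
  have i1: "?m ''i'' 0 = m ''i'' 0 + 1" by (simp add: put_apply)
  have i2: "?m ''R'' = (m ''R'')(m ''i'' 0 := of_bool b)"
    by (subst put_row, simp, rule put_same)
  have IH: "stored (fill_bits ?m bs ''R'') (m ''i'' 0 + 1) bs"
    "\<forall>j<m ''i'' 0 + 1. fill_bits ?m bs ''R'' j = ((m ''R'')(m ''i'' 0 := of_bool b)) j"
    using Cons.IH[of ?m] unfolding i1 i2 by blast+
  have "stored (fill_bits ?m bs ''R'') (m ''i'' 0) ([b] @ bs)"
    unfolding stored_append using IH by (simp add: stored_def)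
  then show ?case using IH(2) by simp
qed

lemma exec_flip_loop:
  assumes "mem \<tau> ''i'' 0 + d = mem \<tau> ''N'' 0"
  shows "exec n f (While (Less (V ''i'') (V ''N'')) (Seq (Flip ''R'' (V ''i'')) (Assign ''i'' (Num 0) (Plus (V ''i'') (Num 1))))) \<tau>
    (map_pmf (\<lambda>\<omega>. advance (fill_bits (mem \<tau>) \<omega>) (1 + 3 * d) 0 \<tau>) (replicate_pmf d coin))"
  using assms
proof (induction d arbitrary: \<tau>)
  case 0
  then have "\<not> bval (mem \<tau>) (Less (V ''i'') (V ''N''))" by simp
  from exec.WhileFalse[OF this] show ?case by (simp add: tick_advance)
next
  case (Suc d)
  let ?b = "Less (V ''i'') (V ''N'')"
  let ?A = "Assign ''i'' (Num 0) (Plus (V ''i'') (Num 1))"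
  let ?c = "Seq (Flip ''R'' (V ''i'')) ?A"
  let ?i = "mem \<tau> ''i'' 0"
  have b: "bval (mem \<tau>) ?b" using Suc.prems by simp
  let ?g = "\<lambda>b. advance (put (mem \<tau>) ''R'' ?i (of_bool b)) 2 0 \<tau>"
  let ?h = "\<lambda>b. advance (put (put (mem \<tau>) ''R'' ?i (of_bool b)) ''i'' 0 (?i + 1)) 3 0 \<tau>"
  have flip: "exec n f (Flip ''R'' (V ''i'')) (tick 1 \<tau>) (map_pmf ?g coin)"
    using exec.Flip[of n f "''R''" "V ''i''" "tick 1 \<tau>"] by (simp add: advance_intros numeral_2_eq_2)
  let ?K = "\<lambda>\<sigma>'. return_pmf (tick 1 (store ''i'' (Num 0) (aval (mem \<sigma>') (Plus (V ''i'') (Num 1))) \<sigma>'))"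
  have "exec n f ?c (tick 1 \<tau>) (bind_pmf (map_pmf ?g coin) ?K)"
    by (rule exec.Seq[OF flip]) (rule exec.Assign)
  also have "bind_pmf (map_pmf ?g coin) ?K = map_pmf ?h coin"
    unfolding bind_map_pmf by (simp add: map_pmf_def advance_intros put_apply numeral_3_eq_3 numeral_2_eq_2)
  finally have body: "exec n f ?c (tick 1 \<tau>) (map_pmf ?h coin)" .
  let ?K' = "\<lambda>\<sigma>'. map_pmf (\<lambda>\<omega>. advance (fill_bits (mem \<sigma>') \<omega>) (1 + 3 * d) 0 \<sigma>') (replicate_pmf d coin)"
  have "exec n f (While ?b ?c) \<tau> (bind_pmf (map_pmf ?h coin) ?K')"
  proof (rule exec.WhileTrue[OF b body])
    fix \<sigma>' assume "\<sigma>' \<in> set_pmf (map_pmf ?h coin)"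
    then have "mem \<sigma>' ''i'' 0 + d = mem \<sigma>' ''N'' 0" using Suc.prems by (auto simp: put_apply)
    then show "exec n f (While ?b ?c) \<sigma>' (?K' \<sigma>')" by (rule Suc.IH)
  qed
  also have "bind_pmf (map_pmf ?h coin) ?K' =
      map_pmf (\<lambda>\<omega>. advance (fill_bits (mem \<tau>) \<omega>) (1 + 3 * Suc d) 0 \<tau>) (replicate_pmf (Suc d) coin)"
    unfolding bind_map_pmf by (simp add: map_pmf_def bind_assoc_pmf bind_return_pmf add.commute)
  finally show ?case .
qed

lemma exec_flips:
  "exec n f flips \<tau> (map_pmf (\<lambda>\<omega>. advance (fill_bits (put (mem \<tau>) ''i'' 0 0) \<omega>) (2 + 3 * mem \<tau> ''N'' 0) 0 \<tau>)
     (replicate_pmf (mem \<tau> ''N'' 0) coin))"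
proof -
  let ?\<tau> = "advance (put (mem \<tau>) ''i'' 0 0) 1 0 \<tau>"
  have 1: "exec n f (Assign ''i'' (Num 0) (Num 0)) \<tau> (return_pmf ?\<tau>)"
    using exec.Assign[of n f "''i''" "Num 0" "Num 0" \<tau>] by (simp add: advance_intros)
  have "mem ?\<tau> ''i'' 0 + mem \<tau> ''N'' 0 = mem ?\<tau> ''N'' 0" by (simp add: put_apply)
  from exec_Seq_det[OF 1 exec_flip_loop[OF this]] show ?thesis by (simp add: flips_def)
qed

text \<open>The parameters are computed by three programs because \<open>exec_compile\<close>
  forbids a program to assign its own loop bounds. The value \<open>u\<close> of the first bounds
  loops of the second, and \<open>m1\<close>, \<open>m2\<close>, \<open>L\<close> and
  \<open>hb\<close> bound loops of the third.\<close>

definition params1 :: prog where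
  "params1 =
     For ''i'' ''s'' (set0 ''u'' (Plus (V ''u'') (V ''inv_eps''))) ;;
     For ''i'' ''inv_eps'' (set0 ''m2'' (Plus (V ''m2'') (Num 200)))"

definition log_prog :: prog where
  "log_prog = For ''i'' ''u'' (If (Less (V ''p'') (V ''u''))
     (set0 ''p'' (Plus (V ''p'') (V ''p'')) ;; set0 ''l'' (Plus (V ''l'') (Num 1))) Nop)"

definition params2 :: prog where
  "params2 =
     set0 ''p'' (Num 1) ;; log_prog ;;
     For ''i'' ''u'' (set0 ''m1'' (Plus (V ''m1'') (Num 19200))) ;;
     set0 ''L'' (Plus (Plus (V ''l'') (V ''l'')) (Num 18)) ;;
     set0 ''hb'' (Plus (Plus (Plus (V ''l'') (V ''l'')) (Plus (V ''l'') (V ''l''))) (Num 13)) ;;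
     set0 ''r'' (Num 1)"

definition pow_prog :: prog where
  "pow_prog = For ''i'' ''hb'' (set0 ''r'' (Plus (V ''r'') (V ''r'')))"

definition row_bits_prog :: prog where
  "row_bits_prog =
     set0 ''N'' (Plus (V ''N'') (V ''n'')) ;;
     For ''j'' ''L'' (set0 ''N'' (Plus (V ''N'') (Plus (V ''n'') (V ''n''))))"

definition params3 :: prog where
  "params3 =
     pow_prog ;;
     For ''i'' ''n'' (set0 ''N'' (Plus (V ''N'') (V ''hb''))) ;;
     For ''i'' ''m1'' (set0 ''N'' (Plus (V ''N'') (V ''r''))) ;;
     For ''i'' ''m2'' row_bits_prog"

lemma For_add:
  assumes "\<And>m'. (\<And>y. y \<noteq> x \<Longrightarrow> y \<noteq> a \<Longrightarrow> m' y = m y) \<Longrightarrow> aval m' e = c" "x \<noteq> a"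
  shows "ev n f (For x v (set0 a (Plus (V a) e))) m a 0 = m a 0 + m v 0 * c"
proof (rule For_rule[where J = "\<lambda>i m' q. m' a 0 = m a 0 + i * c"])
  fix i m' and q :: nat
  assume fr: "\<And>y. y \<noteq> x \<Longrightarrow> y \<notin> mods (set0 a (Plus (V a) e)) \<Longrightarrow> m' y = m y" and J: "m' a 0 = m a 0 + i * c"
  have "aval m' e = c" using fr by (intro assms(1)) simp
  then show "ev n f (set0 a (Plus (V a) e)) m' a 0 = m a 0 + Suc i * c" using J by (simp add: put_apply)
qed (use assms(2) in \<open>auto simp: put_apply\<close>)

lemma mods_log_prog [simp]: "mods log_prog = {''i'', ''p'', ''l''}"
  by (auto simp: log_prog_def)

lemma mods_pow_prog [simp]: "mods pow_prog = {''i'', ''r''}"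
  by (auto simp: pow_prog_def)

lemma mods_row_bits_prog [simp]: "mods row_bits_prog = {''j'', ''N''}"
  by (auto simp: row_bits_prog_def)

text \<open>Either \<open>p\<close> has reached \<open>u\<close> or every iteration so far has
  doubled it; \<open>u\<close> iterations suffice because \<open>u < 2 ^ u\<close>. The last
  conjunct makes \<open>l\<close> least, so that for positive \<open>u\<close> the power
  \<open>2 ^ l\<close> is at most \<open>2 * u\<close>.\<close>

lemma log_prog:
  fixes n :: nat and f :: "bool list \<Rightarrow> bool"
  assumes "m ''p'' 0 = 1" "m ''l'' 0 = 0" "m ''u'' 0 = u"
  defines "l \<equiv> ev n f log_prog m ''l'' 0"
  shows "u \<le> 2 ^ l \<and> (l = 0 \<or> 2 ^ (l - 1) < u)"
proof -
  let ?J = "\<lambda>i m' (q::nat). m' ''p'' 0 = 2 ^ m' ''l'' 0 \<and> (m' ''l'' 0 = 0 \<or> 2 ^ (m' ''l'' 0 - 1) < u) \<and>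
    (u \<le> m' ''p'' 0 \<or> m' ''l'' 0 = i)"
  let ?p = "If (Less (V ''p'') (V ''u''))
     (set0 ''p'' (Plus (V ''p'') (V ''p'')) ;; set0 ''l'' (Plus (V ''l'') (Num 1))) Nop"
  have "?J (m ''u'' 0) (ev n f log_prog m) (qc n f log_prog m)"
    unfolding log_prog_def
  proof (rule For_rule[where J = ?J])
    fix i m' and q :: nat
    assume fr: "\<And>y. y \<noteq> ''i'' \<Longrightarrow> y \<notin> mods ?p \<Longrightarrow> m' y = m y" and J: "?J i m' q"
    have "m' ''u'' 0 = u" using fr[of "''u''"] assms by simp
    then show "?J (Suc i) (ev n f ?p m') (q + qc n f ?p m')"
      using J by (auto simp: put_apply)
  qed (auto simp: put_apply assms)
  then show ?thesis using less_exp[of u] assms(3) by (auto simp: l_def)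
qed

lemma pow_prog:
  assumes "m ''r'' 0 = 1"
  shows "ev n f pow_prog m ''r'' 0 = 2 ^ m ''hb'' 0"
  unfolding pow_prog_def
  by (rule For_rule[where J = "\<lambda>i m' q. m' ''r'' 0 = 2 ^ i"]) (auto simp: put_apply assms)

lemma row_bits_prog:
  "ev n f row_bits_prog m ''N'' 0 = m ''N'' 0 + (m ''n'' 0 + m ''L'' 0 * (m ''n'' 0 + m ''n'' 0))"
proof -
  let ?m = "put m ''N'' 0 (m ''N'' 0 + m ''n'' 0)"
  have "ev n f (For ''j'' ''L'' (set0 ''N'' (Plus (V ''N'') (Plus (V ''n'') (V ''n''))))) ?m ''N'' 0 =
      ?m ''N'' 0 + ?m ''L'' 0 * (m ''n'' 0 + m ''n'' 0)"
    by (rule For_add) (simp_all add: put_apply)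
  then show ?thesis by (simp add: row_bits_prog_def put_apply del: ev.simps(6))
qed

lemma params1:
  assumes "m ''u'' 0 = 0" "m ''m2'' 0 = 0"
  shows "ev n f params1 m ''u'' 0 = m ''s'' 0 * m ''inv_eps'' 0" "ev n f params1 m ''m2'' 0 = 200 * m ''inv_eps'' 0"
proof -
  let ?p = "For ''i'' ''s'' (set0 ''u'' (Plus (V ''u'') (V ''inv_eps'')))"
  let ?p' = "For ''i'' ''inv_eps'' (set0 ''m2'' (Plus (V ''m2'') (Num 200)))"
  define m1 where "m1 = ev n f ?p m"
  have u: "m1 ''u'' 0 = m ''u'' 0 + m ''s'' 0 * m ''inv_eps'' 0"
    unfolding m1_def by (rule For_add) simp_all
  have fr: "m1 ''m2'' = m ''m2''" "m1 ''inv_eps'' = m ''inv_eps''"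
    unfolding m1_def by (subst ev_frame; simp)+
  have m2: "ev n f ?p' m1 ''m2'' 0 = m1 ''m2'' 0 + m1 ''inv_eps'' 0 * 200"
    by (rule For_add) simp_all
  have fu: "ev n f ?p' m1 ''u'' = m1 ''u''" by (rule ev_frame) simp
  have ev: "ev n f params1 m = ev n f ?p' m1" unfolding params1_def ev.simps(4) m1_def ..
  show "ev n f params1 m ''u'' 0 = m ''s'' 0 * m ''inv_eps'' 0" "ev n f params1 m ''m2'' 0 = 200 * m ''inv_eps'' 0"
    unfolding ev fu m2 using u fr assms by simp_all
qed

lemma params2:
  assumes "m ''l'' 0 = 0" "m ''m1'' 0 = 0"
  shows "\<exists>l. m ''u'' 0 \<le> 2 ^ l \<and> (l = 0 \<or> 2 ^ (l - 1) < m ''u'' 0) \<and>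
    ev n f params2 m ''m1'' 0 = 19200 * m ''u'' 0 \<and> ev n f params2 m ''L'' 0 = 2 * l + 18 \<and>
    ev n f params2 m ''hb'' 0 = 4 * l + 13 \<and> ev n f params2 m ''r'' 0 = 1"
proof -
  let ?p = "For ''i'' ''u'' (set0 ''m1'' (Plus (V ''m1'') (Num 19200)))"
  define m1 where "m1 = put m ''p'' 0 1"
  define m2 where "m2 = ev n f log_prog m1"
  define m3 where "m3 = ev n f ?p m2"
  define l where "l = m2 ''l'' 0"
  have m1: "m1 ''p'' 0 = 1" "m1 ''l'' 0 = 0" "m1 ''u'' 0 = m ''u'' 0" "m1 ''m1'' 0 = 0"
    using assms by (simp_all add: m1_def put_apply)
  have l: "m ''u'' 0 \<le> 2 ^ l \<and> (l = 0 \<or> 2 ^ (l - 1) < m ''u'' 0)"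
    unfolding l_def m2_def by (rule log_prog) (use m1 in simp_all)
  have m2: "m2 ''u'' 0 = m ''u'' 0" "m2 ''m1'' 0 = 0"
    unfolding m2_def by (subst ev_frame; simp add: m1)+
  have "m3 ''m1'' 0 = m2 ''m1'' 0 + m2 ''u'' 0 * 19200"
    unfolding m3_def by (rule For_add) simp_all
  then have m3: "m3 ''m1'' 0 = 19200 * m ''u'' 0" using m2 by simp
  have l3: "m3 ''l'' 0 = l"
    unfolding m3_def l_def by (subst ev_frame; simp)
  have ev: "ev n f params2 m = put (put (put m3 ''L'' 0 (m3 ''l'' 0 + m3 ''l'' 0 + 18)) ''hb'' 0
      (m3 ''l'' 0 + m3 ''l'' 0 + (m3 ''l'' 0 + m3 ''l'' 0) + 13)) ''r'' 0 1"
    unfolding params2_def ev.simps(2,4) aval.simps m1_def[symmetric] m2_def[symmetric] m3_def[symmetric]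
    by (simp add: put_apply)
  show ?thesis using l m3 by (intro exI[of _ l]) (simp add: ev put_apply l3)
qed

lemma params3:
  assumes "m ''N'' 0 = 0" "m ''r'' 0 = 1"
  shows "ev n f params3 m ''r'' 0 = 2 ^ m ''hb'' 0"
    "ev n f params3 m ''N'' 0 = m ''n'' 0 * m ''hb'' 0 + (m ''m1'' 0 * 2 ^ m ''hb'' 0 +
       m ''m2'' 0 * (m ''n'' 0 + m ''L'' 0 * (m ''n'' 0 + m ''n'' 0)))"
proof -
  let ?p = "For ''i'' ''n'' (set0 ''N'' (Plus (V ''N'') (V ''hb'')))"
  let ?p' = "For ''i'' ''m1'' (set0 ''N'' (Plus (V ''N'') (V ''r'')))"
  define m1 where "m1 = ev n f pow_prog m"
  define m2 where "m2 = ev n f ?p m1"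
  define m3 where "m3 = ev n f ?p' m2"
  define m4 where "m4 = ev n f (For ''i'' ''m2'' row_bits_prog) m3"
  have ev: "ev n f params3 m = m4" unfolding params3_def ev.simps(4) m1_def m2_def m3_def m4_def ..
  have m1: "m1 ''N'' = m ''N''" "m1 ''n'' = m ''n''" "m1 ''hb'' = m ''hb''" "m1 ''m1'' = m ''m1''" "m1 ''m2'' = m ''m2''"
    "m1 ''L'' = m ''L''"
    unfolding m1_def by (subst ev_frame; simp)+
  have r1: "m1 ''r'' 0 = 2 ^ m ''hb'' 0" unfolding m1_def by (rule pow_prog) (rule assms(2))
  have m2: "m2 ''r'' = m1 ''r''" "m2 ''n'' = m ''n''" "m2 ''m1'' = m ''m1''" "m2 ''m2'' = m ''m2''" "m2 ''L'' = m ''L''"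
    unfolding m2_def by (subst ev_frame; simp add: m1)+
  have N2: "m2 ''N'' 0 = m1 ''N'' 0 + m1 ''n'' 0 * m1 ''hb'' 0"
    unfolding m2_def by (rule For_add) simp_all
  have m3: "m3 ''r'' = m1 ''r''" "m3 ''n'' = m ''n''" "m3 ''m2'' = m ''m2''" "m3 ''L'' = m ''L''"
    unfolding m3_def by (subst ev_frame; simp add: m2)+
  have N3: "m3 ''N'' 0 = m2 ''N'' 0 + m2 ''m1'' 0 * m2 ''r'' 0"
    unfolding m3_def by (rule For_add) simp_all
  have r4: "m4 ''r'' = m1 ''r''"
    unfolding m4_def by (subst ev_frame; simp add: m3)
  let ?c = "m ''n'' 0 + m ''L'' 0 * (m ''n'' 0 + m ''n'' 0)"
  have N4: "m4 ''N'' 0 = m3 ''N'' 0 + m3 ''m2'' 0 * ?c"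
    unfolding m4_def
  proof (rule For_rule[where J = "\<lambda>i m' q. m' ''N'' 0 = m3 ''N'' 0 + i * ?c"])
    fix i m' and q :: nat
    assume fr: "\<And>y. y \<noteq> ''i'' \<Longrightarrow> y \<notin> mods row_bits_prog \<Longrightarrow> m' y = m3 y" and J: "m' ''N'' 0 = m3 ''N'' 0 + i * ?c"
    have "m' ''n'' = m ''n''" "m' ''L'' = m ''L''" using fr[of "''n''"] fr[of "''L''"] m3 by simp_all
    then show "ev n f row_bits_prog m' ''N'' 0 = m3 ''N'' 0 + Suc i * ?c"
      using J unfolding row_bits_prog by simp
  qed (auto simp: put_apply)
  show "ev n f params3 m ''r'' 0 = 2 ^ m ''hb'' 0" unfolding ev r4 r1 ..
  show "ev n f params3 m ''N'' 0 = m ''n'' 0 * m ''hb'' 0 + (m ''m1'' 0 * 2 ^ m ''hb'' 0 + m ''m2'' 0 * ?c)"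
    unfolding ev N4 N3 N2 using assms r1 by (simp add: m1 m2 m3)
qed

section \<open>The main theorem\<close>

definition tester :: com where
  "tester = Cond (Less (V ''inv_eps'') (Num 2)) (Assign ''out'' (Num 0) (Num 1))
     (Seq (compile params1) (Seq (compile params2) (Seq (compile params3) (Seq flips (compile main_prog)))))"

lemma wf_params: "wf_prog params1" "wf_prog params2" "wf_prog params3"
  by (simp_all add: params1_def params2_def params3_def log_prog_def pow_prog_def row_bits_prog_def)

lemma bounds_params:
  "bounds params1 = {''s'', ''inv_eps''}" "bounds params2 = {''u''}"
  "bounds params3 = {''hb'', ''n'', ''m1'', ''m2'', ''L''}"
  by (auto simp: params1_def params2_def params3_def log_prog_def pow_prog_def row_bits_prog_def)

lemma mods_params [simp]:
  "mods params1 = {''i'', ''u'', ''m2''}" "mods params2 = {''i'', ''p'', ''l'', ''m1'', ''L'', ''hb'', ''r''}"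
  "mods params3 = {''i'', ''j'', ''r'', ''N''}"
  by (auto simp: params1_def params2_def params3_def log_prog_def pow_prog_def row_bits_prog_def)

lemma qc_params [simp]: "qc n f params1 m = 0" "qc n f params2 m = 0" "qc n f params3 m = 0"
  by (rule qc_no_asks; simp add: params1_def params2_def params3_def log_prog_def pow_prog_def row_bits_prog_def)+

text \<open>With \<open>G = n + s + k\<close>, the bounds \<open>2 ^ l \<le> 2 * (s * k)\<close> and
  \<open>s * k \<le> G ^ 2\<close> limit the number of blocks, \<open>8192 * (2 ^ l) ^ 4\<close>, to
  \<open>8192 * 16 * G ^ 8\<close>. This also bounds the other parameters.\<close>

definition size_bound :: "nat \<Rightarrow> nat" where
  "size_bound G = 131072 * G ^ 8"

lemma parameter_bounds:
  fixes n s k l :: nat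
  assumes "1 \<le> s" "1 \<le> k" "l = 0 \<or> 2 ^ (l - 1) < s * k"
  defines "Z \<equiv> size_bound (n + s + k)"
  shows "n \<le> Z" "s \<le> Z" "k \<le> Z" "s * k \<le> Z" "2 * l + 18 \<le> Z" "4 * l + 13 \<le> Z" "2 ^ (4 * l + 13) \<le> Z"
    "19200 * (s * k) \<le> Z" "200 * k \<le> Z"
proof -
  define G where "G = n + s + k"
  have G1: "1 \<le> G" "n \<le> G" "s \<le> G" "k \<le> G" using assms by (auto simp: G_def)
  have u: "s * k \<le> G ^ 2" using G1 by (simp add: power2_eq_square mult_mono)
  have "1 \<le> s * k" using assms(1,2) by (simp add: Suc_le_eq)
  then have p: "2 ^ l \<le> 2 * (s * k)"
    using assms(3) by (cases l) auto
  then have p2: "2 ^ l \<le> 2 * G ^ 2" using u by linarith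
  have lp: "l + 1 \<le> 2 ^ l" by (rule Suc_le_two_power)
  have pw: "G ^ i \<le> G ^ 8" if "i \<le> 8" for i using that G1(1) by (intro power_increasing) auto
  have GZ: "c * G ^ i \<le> Z" if "i \<le> 8" "c \<le> 131072" for c i
    unfolding Z_def size_bound_def G_def[symmetric] using that pw by (intro mult_mono) auto
  have g1: "G \<le> G ^ 2" using G1(1) by (simp add: power2_eq_square)
  show "n \<le> Z" "s \<le> Z" "k \<le> Z" "200 * k \<le> Z" using GZ[of 1 200] G1 by simp_all
  show "s * k \<le> Z" "19200 * (s * k) \<le> Z" using GZ[of 2 19200] u by linarith+
  have "4 * l + 18 \<le> 30 * G ^ 2"
    using lp p2 g1 G1(1) by linarith
  then show "2 * l + 18 \<le> Z" "4 * l + 13 \<le> Z" using GZ[of 2 30] by linarith+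
  have "(2::nat) ^ (4 * l + 13) = 8192 * (2 ^ l) ^ 4" by (simp add: power_add power_mult[symmetric] mult.commute)
  also have "\<dots> \<le> 8192 * (2 * G ^ 2) ^ 4" using p2 by (intro mult_left_mono power_mono) auto
  also have "\<dots> = 131072 * G ^ 8" by (simp add: power_mult_distrib power_mult[symmetric])
  finally show "2 ^ (4 * l + 13) \<le> Z" by (simp add: Z_def size_bound_def G_def)
qed

text \<open>Replace \<open>2 * l + 18\<close> by \<open>18 * (l + 1)\<close> and
  \<open>4 * l + 14\<close> by \<open>14 * (l + 1)\<close>. The coefficients 19200, 253, 200 and
  324000 then add up to less than 400000.\<close>

lemma query_bound:
  fixes s k l :: nat
  assumes "1 \<le> s" "1 \<le> k"
  shows "19200 * (s * k) + s * ((2 * l + 18) * (1 + (4 * l + 13)) + 1) +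
      200 * k * (1 + (2 * l + 18) * (s * (5 * (2 * l + 18)))) \<le> 400000 * (s * k) * (l + 1) ^ 2"
proof -
  define a where "a = (l + 1) ^ 2"
  have a: "1 \<le> a" by (simp add: a_def)
  have sq: "(x * y) * (z * y) = x * z * y ^ 2" for x y z :: nat by (simp add: power2_eq_square)
  have L: "(2 * l + 18) * (2 * l + 18) \<le> 324 * a"
  proof -
    have "(2 * l + 18) * (2 * l + 18) \<le> (18 * (l + 1)) * (18 * (l + 1))" by (intro mult_mono) auto
    also have "\<dots> = 324 * a" unfolding a_def sq by simp
    finally show ?thesis .
  qed
  have c: "(2 * l + 18) * (1 + (4 * l + 13)) + 1 \<le> 253 * a"
  proof -
    have "(2 * l + 18) * (1 + (4 * l + 13)) \<le> (18 * (l + 1)) * (14 * (l + 1))" by (intro mult_mono) auto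
    also have "\<dots> = 252 * a" unfolding a_def sq by simp
    finally show ?thesis using a by linarith
  qed
  have ua: "s * k * 1 \<le> s * k * a" by (rule mult_left_mono[OF a]) simp
  have "s * ((2 * l + 18) * (1 + (4 * l + 13)) + 1) \<le> s * (253 * a)" by (rule mult_left_mono[OF c]) simp
  also have "\<dots> \<le> s * k * (253 * a)" using assms(2) by (intro mult_right_mono) auto
  finally have 1: "s * ((2 * l + 18) * (1 + (4 * l + 13)) + 1) \<le> 253 * (s * k * a)" by simp
  have "200 * k * (1 + (2 * l + 18) * (s * (5 * (2 * l + 18)))) = 200 * k + 1000 * (s * k) * ((2 * l + 18) * (2 * l + 18))"
    by (simp add: algebra_simps)
  also have "\<dots> \<le> 200 * (s * k) + 1000 * (s * k) * (324 * a)"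
    using L assms(1) by (intro add_mono mult_left_mono) auto
  finally have 2: "200 * k * (1 + (2 * l + 18) * (s * (5 * (2 * l + 18)))) \<le> 200 * (s * k) + 324000 * (s * k * a)"
    by simp
  have "400000 * (s * k) * a = 400000 * (s * k * a)" by simp
  then show ?thesis using 1 2 ua unfolding a_def[symmetric] by linarith
qed

lemma mem_init: "mem (init n s \<epsilon>) x i =
    (if i = 0 then if x = ''n'' then n else if x = ''s'' then s else if x = ''inv_eps'' then nat \<lceil>1 / \<epsilon>\<rceil> else 0 else 0)"
  by (simp add: init_def)

text \<open>All randomness enters through \<open>flips\<close>, so the final state is a function
  \<open>g\<close> of the coins. The composite of the four programs in the time bound merely adds up
  their times.\<close>

lemma tester_run:
  fixes n s :: nat and \<epsilon> :: real
  defines "k \<equiv> nat \<lceil>1 / \<epsilon>\<rceil>"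
  defines "Z \<equiv> size_bound (n + s + k)"
  assumes "1 \<le> s" "2 \<le> k"
  obtains l g where "s * k \<le> 2 ^ l" "l = 0 \<or> 2 ^ (l - 1) < s * k"
    "exec n f tester (init n s \<epsilon>) (map_pmf g (coins_pmf n s k l))"
    "\<And>c. c \<in> set_pmf (coins_pmf n s k l) \<Longrightarrow> (mem (g c) ''out'' 0 \<noteq> 0 \<longleftrightarrow> accepts n f s l c) \<and>
       queries (g c) \<le> 400000 * (s * k) * (l + 1) ^ 2 \<and>
       steps (g c) \<le> 3 + 15 * Z ^ 3 + time Z (params1 ;; params2 ;; params3 ;; main_prog)"
proof -
  let ?\<sigma>0 = "init n s \<epsilon>"
  define \<sigma>1 where "\<sigma>1 = tick 1 ?\<sigma>0"
  define m0 where "m0 = mem ?\<sigma>0"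
  define m1 where "m1 = ev n f params1 m0"
  define m2 where "m2 = ev n f params2 m1"
  define m3 where "m3 = ev n f params3 m2"
  have m0: "m0 ''n'' 0 = n" "m0 ''s'' 0 = s" "m0 ''inv_eps'' 0 = k"
    "\<And>x i. x \<noteq> ''n'' \<Longrightarrow> x \<noteq> ''s'' \<Longrightarrow> x \<noteq> ''inv_eps'' \<Longrightarrow> m0 x i = 0"
    by (simp_all add: m0_def mem_init k_def)
  have m1: "m1 ''u'' 0 = s * k" "m1 ''m2'' 0 = 200 * k"
    using params1[of m0 n f] by (simp_all add: m0 m1_def)
  have m1f: "m1 x = m0 x" if "x \<noteq> ''i''" "x \<noteq> ''u''" "x \<noteq> ''m2''" for x
    unfolding m1_def using that by (intro ev_frame) simp
  have "\<exists>l. s * k \<le> 2 ^ l \<and> (l = 0 \<or> 2 ^ (l - 1) < s * k) \<and> m2 ''m1'' 0 = 19200 * (s * k) \<and>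
      m2 ''L'' 0 = 2 * l + 18 \<and> m2 ''hb'' 0 = 4 * l + 13 \<and> m2 ''r'' 0 = 1"
    unfolding m2_def m1(1)[symmetric] by (rule params2) (simp_all add: m1f m0)
  then obtain l where l: "s * k \<le> 2 ^ l" "l = 0 \<or> 2 ^ (l - 1) < s * k" and
    m2: "m2 ''m1'' 0 = 19200 * (s * k)" "m2 ''L'' 0 = 2 * l + 18" "m2 ''hb'' 0 = 4 * l + 13" "m2 ''r'' 0 = 1"
    by blast
  have m2f: "m2 x = m1 x" if "x \<notin> {''i'', ''p'', ''l'', ''m1'', ''L'', ''hb'', ''r''}" for x
    unfolding m2_def using that by (intro ev_frame) simp
  have m3f: "m3 x = m2 x" if "x \<notin> {''i'', ''j'', ''r'', ''N''}" for x
    unfolding m3_def using that by (intro ev_frame) simp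
  define N where "N = n * (4 * l + 13) + (19200 * (s * k) * 2 ^ (4 * l + 13) + 200 * k * (n + (2 * l + 18) * (n + n)))"
  have m3: "m3 ''r'' 0 = 2 ^ (4 * l + 13)" "m3 ''N'' 0 = N"
    using params3[of m2 n f] by (simp_all add: m3_def[symmetric] m2 m2f m1f m0 m1 N_def)
  note b = parameter_bounds[of s k l n, folded Z_def]
  have b: "n \<le> Z" "s \<le> Z" "k \<le> Z" "s * k \<le> Z" "2 * l + 18 \<le> Z" "4 * l + 13 \<le> Z" "2 ^ (4 * l + 13) \<le> Z"
    "19200 * (s * k) \<le> Z" "200 * k \<le> Z"
    using b assms(3,4) l(2) by auto
  have Z1: "1 \<le> Z" using b(2) assms(3) by linarith
  \<comment> \<open>Each of the \<open>N\<close> flips takes three steps, hence the summand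
    \<open>15 * Z ^ 3\<close> in the time bound.\<close>
  have NZ: "N \<le> 5 * Z ^ 3"
  proof -
    have sq: "Z * Z \<le> Z ^ 3" using Z1 by (simp add: power3_eq_cube)
    have "n * (4 * l + 13) \<le> Z * Z" "19200 * (s * k) * 2 ^ (4 * l + 13) \<le> Z * Z"
      using b by (intro mult_mono; simp)+
    moreover have "200 * k * (n + (2 * l + 18) * (n + n)) \<le> Z * (Z + Z * (Z + Z))"
      using b by (intro mult_mono add_mono) simp_all
    moreover have "Z * (Z + Z * (Z + Z)) = Z * Z + 2 * Z ^ 3" by (simp add: algebra_simps power3_eq_cube)
    ultimately show ?thesis unfolding N_def using sq by linarith
  qed
  have "\<exists>t\<le>time Z params1. exec n f (compile params1) \<sigma>1 (return_pmf (advance (ev n f params1 (mem \<sigma>1)) t (qc n f params1 (mem \<sigma>1)) \<sigma>1))"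
  proof (rule exec_compile)
    have "mem \<sigma>1 = m0" by (simp add: \<sigma>1_def tick_advance m0_def)
    then show "mem \<sigma>1 v 0 \<le> Z" if "v \<in> bounds params1" for v
      using that b(2,3) m0(2,3) unfolding bounds_params by auto
  qed (use wf_params b(1) in \<open>simp_all add: bounds_params\<close>)
  then obtain t1 where t1: "t1 \<le> time Z params1" "exec n f (compile params1) \<sigma>1 (return_pmf (advance m1 t1 0 \<sigma>1))" (is "exec _ _ _ _ (return_pmf ?\<tau>1)")
    by (auto simp: m1_def m0_def \<sigma>1_def tick_advance)
  have "\<exists>t\<le>time Z params2. exec n f (compile params2) ?\<tau>1 (return_pmf (advance (ev n f params2 (mem ?\<tau>1)) t (qc n f params2 (mem ?\<tau>1)) ?\<tau>1))"
  proof (rule exec_compile)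
    show "mem ?\<tau>1 v 0 \<le> Z" if "v \<in> bounds params2" for v
      using that b(4) m1(1) unfolding bounds_params by simp
  qed (use wf_params b(1) in \<open>simp_all add: bounds_params\<close>)
  then obtain t2 where t2: "t2 \<le> time Z params2" "exec n f (compile params2) ?\<tau>1 (return_pmf (advance m2 (t1 + t2) 0 \<sigma>1))" (is "exec _ _ _ _ (return_pmf ?\<tau>2)")
    by (auto simp: m2_def)
  have "\<exists>t\<le>time Z params3. exec n f (compile params3) ?\<tau>2 (return_pmf (advance (ev n f params3 (mem ?\<tau>2)) t (qc n f params3 (mem ?\<tau>2)) ?\<tau>2))"
  proof (rule exec_compile)
    have "m2 ''n'' 0 = n" "m2 ''m2'' 0 = 200 * k" using m2f[of "''n''"] m2f[of "''m2''"] m1f[of "''n''"] m0(1) m1(2) by simp_all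
    then show "mem ?\<tau>2 v 0 \<le> Z" if "v \<in> bounds params3" for v
      using that b m2(1-3) unfolding bounds_params advance_simps by fastforce
  qed (use wf_params b(1) in \<open>simp_all add: bounds_params\<close>)
  then obtain t3 where t3: "t3 \<le> time Z params3" "exec n f (compile params3) ?\<tau>2 (return_pmf (advance m3 (t1 + t2 + t3) 0 \<sigma>1))" (is "exec _ _ _ _ (return_pmf ?\<tau>3)")
    by (auto simp: m3_def)
  define m4 where "m4 \<omega> = fill_bits (put m3 ''i'' 0 0) \<omega>" for \<omega>
  define \<tau>4 where "\<tau>4 \<omega> = advance (m4 \<omega>) (t1 + t2 + t3 + (2 + 3 * N)) 0 \<sigma>1" for \<omega>
  have flips: "exec n f flips ?\<tau>3 (map_pmf \<tau>4 (replicate_pmf N coin))"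
    using exec_flips[of n f ?\<tau>3] by (simp add: m3 \<tau>4_def[abs_def] m4_def)
  have m4f: "m4 \<omega> x = m3 x" if "x \<noteq> ''i''" "x \<noteq> ''R''" for \<omega> x
    unfolding m4_def using that by (simp add: fill_bits_frame put_row)
  have m4v: "m4 \<omega> ''n'' 0 = n" "m4 \<omega> ''s'' 0 = s" "m4 \<omega> ''hb'' 0 = 4 * l + 13" "m4 \<omega> ''L'' 0 = 2 * l + 18"
    "m4 \<omega> ''r'' 0 = 2 ^ (4 * l + 13)" "m4 \<omega> ''m1'' 0 = 19200 * (s * k)" "m4 \<omega> ''m2'' 0 = 200 * k" for \<omega>
    by (simp_all add: m4f m3 m3f m2 m2f m1 m1f m0)
  have m4z: "m4 \<omega> x = (\<lambda>_. 0)" if "x \<in> {''ptr'', ''nd'', ''bad'', ''out'', ''rb'', ''T'', ''Y''}" for \<omega> x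
    using that by (auto simp: m4f m3f m2f m1f m0 fun_eq_iff)
  have stR: "stored (m4 \<omega> ''R'') 0 \<omega>" for \<omega>
    using fill_bits_stored[of "put m3 ''i'' 0 0" \<omega>] unfolding m4_def by (simp add: put_apply)
  have "\<exists>t\<le>time Z main_prog. exec n f (compile main_prog) \<tau> (return_pmf (advance (ev n f main_prog (mem \<tau>)) t (qc n f main_prog (mem \<tau>)) \<tau>))"
    if \<tau>: "\<tau> \<in> range \<tau>4" for \<tau>
  proof (rule exec_compile)
    fix v assume "v \<in> bounds main_prog"
    with bounds_main_prog have v: "v \<in> {''n'', ''hb'', ''s'', ''r'', ''L'', ''m1'', ''m2''}" by (rule subsetD)
    obtain \<omega> where "\<tau> = \<tau>4 \<omega>" using \<tau> by (rule rangeE)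
    then have mem: "mem \<tau> = m4 \<omega>" by (simp add: \<tau>4_def)
    show "mem \<tau> v 0 \<le> Z" unfolding mem
      by (rule insertE[OF v], simp only: m4v b, elim insertE emptyE; simp only: m4v b)
  qed (use wf_main_prog mods_main_prog b(1) in simp_all)
  then obtain T where T: "\<And>\<tau>. \<tau> \<in> range \<tau>4 \<Longrightarrow> T \<tau> \<le> time Z main_prog"
    "\<And>\<tau>. \<tau> \<in> range \<tau>4 \<Longrightarrow> exec n f (compile main_prog) \<tau> (return_pmf (advance (ev n f main_prog (mem \<tau>)) (T \<tau>) (qc n f main_prog (mem \<tau>)) \<tau>))"
    by metis
  define fin where "fin \<tau> = advance (ev n f main_prog (mem \<tau>)) (T \<tau>) (qc n f main_prog (mem \<tau>)) \<tau>" for \<tau>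
  define g where "g c = fin (\<tau>4 (flat c))" for c
  have "exec n f (Seq flips (compile main_prog)) ?\<tau>3 (bind_pmf (map_pmf \<tau>4 (replicate_pmf N coin)) (\<lambda>\<tau>. return_pmf (fin \<tau>)))"
    by (rule exec.Seq[OF flips]) (use T(2) in \<open>auto simp: fin_def\<close>)
  also have "bind_pmf (map_pmf \<tau>4 (replicate_pmf N coin)) (\<lambda>\<tau>. return_pmf (fin \<tau>)) = map_pmf fin (map_pmf \<tau>4 (map_pmf flat (coins_pmf n s k l)))"
    unfolding map_flat_coins N_def by (simp add: map_pmf_def)
  also have "\<dots> = map_pmf g (coins_pmf n s k l)"
    by (simp add: map_pmf_comp g_def[abs_def])
  finally have main: "exec n f (Seq flips (compile main_prog)) ?\<tau>3 (map_pmf g (coins_pmf n s k l))" .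
  have ex: "exec n f tester ?\<sigma>0 (map_pmf g (coins_pmf n s k l))"
    unfolding tester_def
  proof (rule exec.CondFalse)
    show "\<not> bval (mem ?\<sigma>0) (Less (V ''inv_eps'') (Num 2))"
      using assms(4) m0(3) by (simp add: m0_def)
    show "exec n f (Seq (compile params1) (Seq (compile params2) (Seq (compile params3) (Seq flips (compile main_prog))))) (tick 1 ?\<sigma>0)
        (map_pmf g (coins_pmf n s k l))"
      unfolding \<sigma>1_def[symmetric]
      by (rule exec_Seq_det[OF t1(2) exec_Seq_det[OF t2(2) exec_Seq_det[OF t3(2) main]]])
  qed
  have "(mem (g c) ''out'' 0 \<noteq> 0 \<longleftrightarrow> accepts n f s l c) \<and> queries (g c) \<le> 400000 * (s * k) * (l + 1) ^ 2 \<and>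
       steps (g c) \<le> 3 + 15 * Z ^ 3 + time Z (params1 ;; params2 ;; params3 ;; main_prog)"
    if c: "c \<in> set_pmf (coins_pmf n s k l)" for c
  proof -
    obtain hs ys zs where cc: "c = (hs, ys, zs)" by (cases c) auto
    have len: "length ys = 19200 * (s * k)" "length zs = 200 * k"
      using c by (auto simp: cc coins_pmf_def set_replicate_pmf)
    have "start n s l c (m4 (flat c))"
      unfolding start_def cc prod.case using stR[of "flat (hs, ys, zs)"] len
      by (simp add: m4v m4z nz_def)
    note M = main_prog[where f = f, OF c[unfolded cc] this[unfolded cc], folded cc]
    have "mem (g c) ''out'' 0 \<noteq> 0 \<longleftrightarrow> accepts n f s l c"
      using conjunct1[OF M] by (simp add: g_def fin_def \<tau>4_def)
    moreover have "1 \<le> k" using assms(4) by simp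
    then have "qc n f main_prog (m4 (flat c)) \<le> 400000 * (s * k) * (l + 1) ^ 2"
      by (rule order_trans[OF conjunct2[OF M] query_bound[OF assms(3)]])
    moreover have "queries (g c) = qc n f main_prog (m4 (flat c))"
      by (simp add: g_def fin_def \<tau>4_def \<sigma>1_def tick_advance init_def)
    moreover have "steps (g c) = 1 + (t1 + t2 + t3 + (2 + 3 * N)) + T (\<tau>4 (flat c))"
      by (simp add: g_def fin_def \<tau>4_def \<sigma>1_def tick_advance init_def)
    moreover have "T (\<tau>4 (flat c)) \<le> time Z main_prog" by (rule T(1)) simp
    ultimately show ?thesis using t1(1) t2(1) t3(1) NZ by simp
  qed
  from that[OF l ex this] show ?thesis .
qed

text \<open>The distances to the two constants add up to one, so they cannot both be at least 1. The
  constant true takes one term, the empty one, hence \<open>1 \<le> s\<close>.\<close>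

lemma trivial_distance:
  assumes "1 \<le> s" "1 \<le> \<epsilon>"
  shows "\<not> eps_far n \<epsilon> f (monotone_dnf n s)"
proof
  assume far: "eps_far n \<epsilon> f (monotone_dnf n s)"
  have const: "(\<lambda>_. False) \<in> monotone_dnf n s" "(\<lambda>_. True) \<in> monotone_dnf n s"
  proof -
    show "(\<lambda>_. False) \<in> monotone_dnf n s"
      unfolding monotone_dnf_def by (intro CollectI exI[of _ "{}"]) (simp add: dnf_val_def)
    show "(\<lambda>_. True) \<in> monotone_dnf n s"
      unfolding monotone_dnf_def using assms(1) by (intro CollectI exI[of _ "{{}}"]) (simp add: dnf_val_def)
  qed
  have "\<epsilon> \<le> Pr (U n) f"
    using bspec[OF far[unfolded eps_far_def] const(1)] by simp
  moreover have "\<epsilon> \<le> Pr (U n) (\<lambda>x. \<not> f x)"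
    using bspec[OF far[unfolded eps_far_def] const(2)] by simp
  ultimately show False using Pr_not[of "U n" f] assms(2) by simp
qed

text \<open>\<open>2 \<le> k\<close> forces \<open>1 < 1 / \<epsilon>\<close>, so rounding up at
  most doubles it. The summand 2 inside the logarithm \<open>lg\<close> keeps it at least 1, whence
  \<open>l + 1 \<le> 3 + lg \<le> 4 * lg\<close>; the constant is 400000 times 2 times 16.\<close>

lemma parameter_estimates:
  fixes s l :: nat and \<epsilon> :: real
  defines "k \<equiv> nat \<lceil>1 / \<epsilon>\<rceil>"
  assumes s: "1 \<le> s" and \<epsilon>: "0 < \<epsilon>" and k: "2 \<le> k" and l: "l = 0 \<or> 2 ^ (l - 1) < s * k"
  shows "1 / \<epsilon> \<le> real k" "real k \<le> 2 / \<epsilon>"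
    "real (400000 * (s * k) * (l + 1) ^ 2) \<le> 12800000 * (real s / \<epsilon>) * (log 2 (real s / \<epsilon> + 2)) ^ 2"
proof -
  have pos: "0 < 1 / \<epsilon>" using \<epsilon> by simp
  have kc: "real k = of_int \<lceil>1 / \<epsilon>\<rceil>" using pos by (simp add: k_def)
  show 1: "1 / \<epsilon> \<le> real k" unfolding kc by (rule le_of_int_ceiling)
  have "1 < 1 / \<epsilon>"
  proof (rule ccontr)
    assume "\<not> 1 < 1 / \<epsilon>"
    then have "\<lceil>1 / \<epsilon>\<rceil> \<le> 1" unfolding ceiling_le_iff by simp
    then have "k \<le> nat 1" unfolding k_def by (rule nat_mono)
    then show False using k by simp
  qed
  moreover have "real k < 1 / \<epsilon> + 1" unfolding kc using ceiling_correct[of "1 / \<epsilon>"] by linarith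
  moreover have "2 / \<epsilon> = 1 / \<epsilon> + 1 / \<epsilon>" by simp
  ultimately show 2: "real k \<le> 2 / \<epsilon>" by linarith
  define q where "q = real s / \<epsilon>"
  define lg where "lg = log 2 (q + 2)"
  have q: "0 < q" using s \<epsilon> by (simp add: q_def)
  have u: "real (s * k) \<le> 2 * q"
    using mult_left_mono[OF 2, of "real s"] by (simp add: q_def field_simps)
  have lg1: "1 \<le> lg" unfolding lg_def using q by (simp add: le_log_iff)
  have "real l + 1 \<le> 4 * lg"
  proof (cases "l = 0")
    case False
    then have "(2::nat) ^ (l - 1) < s * k" using l by blast
    then have "real (2 ^ (l - 1)) < real (s * k)" by (simp only: of_nat_less_iff)
    then have "2 ^ (l - 1) \<le> 2 * (q + 2)" using u q by simp
    then have "real (l - 1) \<le> log 2 (2 * (q + 2))"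
      using q by (simp add: le_log_iff powr_realpow)
    also have "\<dots> = 1 + lg" unfolding lg_def by (subst log_mult_pos) (use q in auto)
    finally show ?thesis using False lg1 by simp
  qed (use lg1 in simp)
  then have "(real l + 1) ^ 2 \<le> (4 * lg) ^ 2" by (intro power_mono) auto
  then have "real (s * k) * (real l + 1) ^ 2 \<le> (2 * q) * (4 * lg) ^ 2"
    using u q by (intro mult_mono) auto
  then have "400000 * (real (s * k) * (real l + 1) ^ 2) \<le> 400000 * ((2 * q) * (4 * lg) ^ 2)"
    by (rule mult_left_mono) simp
  then show "real (400000 * (s * k) * (l + 1) ^ 2) \<le> 12800000 * (real s / \<epsilon>) * (log 2 (real s / \<epsilon> + 2)) ^ 2"
    unfolding q_def[symmetric] lg_def[symmetric] by (simp add: power_mult_distrib add.commute)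
qed

text \<open>The conjunct \<open>2 \<le> c\<close> pays for the two steps taken when \<epsilon> \<ge>
  1. The constant 67108864 is 2^18 times 2^8: \<open>Z + 1\<close> is at most
  \<open>2 ^ 18 * G ^ 8\<close> for \<open>G = n + s + k\<close>, and \<open>G\<close> is at most
  twice the sum in the statement.\<close>

lemma time_estimate:
  "\<exists>(c :: real) (d :: nat). 2 \<le> c \<and> (\<forall>n s \<epsilon>. 1 \<le> s \<longrightarrow> 0 < \<epsilon> \<longrightarrow> real (nat \<lceil>1 / \<epsilon>\<rceil>) \<le> 2 / \<epsilon> \<longrightarrow>
     (let Z = size_bound (n + s + nat \<lceil>1 / \<epsilon>\<rceil>) in
      real (3 + 15 * Z ^ 3 + time Z (params1 ;; params2 ;; params3 ;; main_prog)) \<le> c * (real n + real s + 1 / \<epsilon>) ^ d))"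
proof -
  obtain C d where C: "\<And>Z. time Z (params1 ;; params2 ;; params3 ;; main_prog) \<le> C * (Z + 1) ^ d"
    using time_polynomial by blast
  define c where "c = real (18 + C) * 67108864 ^ (3 + d)"
  have "real (3 + 15 * Z ^ 3 + time Z (params1 ;; params2 ;; params3 ;; main_prog)) \<le> c * (real n + real s + 1 / \<epsilon>) ^ (8 * (3 + d))"
    if s: "1 \<le> s" and \<epsilon>: "0 < \<epsilon>" and k: "real (nat \<lceil>1 / \<epsilon>\<rceil>) \<le> 2 / \<epsilon>" and Z: "Z = size_bound (n + s + nat \<lceil>1 / \<epsilon>\<rceil>)"
    for n s Z and \<epsilon> :: real
  proof -
    let ?G = "n + s + nat \<lceil>1 / \<epsilon>\<rceil>"
    let ?H = "real n + real s + 1 / \<epsilon>"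
    have G: "real ?G \<le> 2 * ?H" using k by simp
    have G1: "1 \<le> ?G" using s by simp
    have "1 \<le> ?G ^ 8" by (rule one_le_power[OF G1])
    then have Z1: "Z + 1 \<le> 262144 * ?G ^ 8" unfolding Z size_bound_def by linarith
    have ZZ: "(Z + 1) ^ i \<le> (Z + 1) ^ (3 + d)" if "i \<le> 3 + d" for i
      using that by (intro power_increasing) auto
    have "Z ^ 3 \<le> (Z + 1) ^ 3" by (rule power_mono) auto
    also have "\<dots> \<le> (Z + 1) ^ (3 + d)" by (rule ZZ) simp
    finally have a: "Z ^ 3 \<le> (Z + 1) ^ (3 + d)" .
    have b: "1 \<le> (Z + 1) ^ (3 + d)" by simp
    have "C * (Z + 1) ^ d \<le> C * (Z + 1) ^ (3 + d)" using ZZ[of d] by (intro mult_left_mono) auto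
    then have "3 + 15 * Z ^ 3 + time Z (params1 ;; params2 ;; params3 ;; main_prog) \<le> (18 + C) * (Z + 1) ^ (3 + d)"
      using a b C[of Z] unfolding add_mult_distrib by linarith
    also have "\<dots> \<le> (18 + C) * (262144 * ?G ^ 8) ^ (3 + d)"
      using Z1 by (intro mult_left_mono power_mono) auto
    finally have "real (3 + 15 * Z ^ 3 + time Z (params1 ;; params2 ;; params3 ;; main_prog)) \<le>
        real ((18 + C) * (262144 * ?G ^ 8) ^ (3 + d))"
      by (simp only: of_nat_le_iff)
    also have "\<dots> = real (18 + C) * (262144 * real ?G ^ 8) ^ (3 + d)"
      by (simp only: of_nat_mult of_nat_power of_nat_numeral)
    also have "\<dots> \<le> real (18 + C) * (262144 * (2 * ?H) ^ 8) ^ (3 + d)"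
      using G by (intro mult_left_mono power_mono) auto
    also have "262144 * (2 * ?H) ^ 8 = 67108864 * ?H ^ 8"
      unfolding power_mult_distrib by simp
    also have "real (18 + C) * (67108864 * ?H ^ 8) ^ (3 + d) = c * ?H ^ (8 * (3 + d))"
      by (simp only: c_def power_mult_distrib power_mult mult.assoc)
    finally show ?thesis .
  qed
  moreover have "2 \<le> c"
  proof -
    have "2 * 1 \<le> real (18 + C) * 67108864 ^ (3 + d)"
      by (intro mult_mono one_le_power) auto
    then show ?thesis by (simp add: c_def)
  qed
  ultimately show ?thesis unfolding Let_def by blast
qed

theorem theorem16:
  shows "\<exists>(P :: com) (c :: real) (d :: nat) (c' :: real) (d' :: nat).
    \<forall>(n :: nat) (s :: nat) (\<epsilon> :: real). s \<ge> 1 \<longrightarrow> \<epsilon> > 0 \<longrightarrow>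
      two_sided_tester P n s \<epsilon> (monotone_dnf n s)
        (c * (real n + real s + 1 / \<epsilon>) ^ d)
        (c' * (real s / \<epsilon>) * (log 2 (real s / \<epsilon> + 2)) ^ d')"
proof -
  obtain c :: real and d where c: "2 \<le> c" and time: "\<And>n s \<epsilon>. 1 \<le> s \<Longrightarrow> 0 < \<epsilon> \<Longrightarrow> real (nat \<lceil>1 / \<epsilon>\<rceil>) \<le> 2 / \<epsilon> \<Longrightarrow>
     real (3 + 15 * (size_bound (n + s + nat \<lceil>1 / \<epsilon>\<rceil>)) ^ 3 +
       time (size_bound (n + s + nat \<lceil>1 / \<epsilon>\<rceil>)) (params1 ;; params2 ;; params3 ;; main_prog)) \<le>
     c * (real n + real s + 1 / \<epsilon>) ^ d"
    using time_estimate unfolding Let_def by blast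
  have "two_sided_tester tester n s \<epsilon> (monotone_dnf n s) (c * (real n + real s + 1 / \<epsilon>) ^ d)
      (12800000 * (real s / \<epsilon>) * (log 2 (real s / \<epsilon> + 2)) ^ 2)" if s: "1 \<le> s" and \<epsilon>: "0 < \<epsilon>" for n s \<epsilon>
    unfolding two_sided_tester_def
  proof
    fix f
    let ?C = "monotone_dnf n s"
    let ?t = "c * (real n + real s + 1 / \<epsilon>) ^ d"
    let ?q = "12800000 * (real s / \<epsilon>) * (log 2 (real s / \<epsilon> + 2)) ^ 2"
    define k where "k = nat \<lceil>1 / \<epsilon>\<rceil>"
    show "\<exists>\<mu>. exec n f tester (init n s \<epsilon>) \<mu> \<and>
        (f \<in> ?C \<longrightarrow> measure_pmf.prob \<mu> accepting \<ge> 2 / 3) \<and>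
        (eps_far n \<epsilon> f ?C \<longrightarrow> measure_pmf.prob \<mu> (- accepting) \<ge> 2 / 3) \<and>
        (\<forall>\<sigma>\<in>set_pmf \<mu>. real (steps \<sigma>) \<le> ?t \<and> real (queries \<sigma>) \<le> ?q)"
    proof (cases "2 \<le> k")
      \<comment> \<open>Here \<epsilon> \<ge> 1, no function is far from the class, and acceptance
        is correct for every \<open>f\<close>.\<close>
      case False
      let ?\<sigma> = "tick 1 (store ''out'' (Num 0) (aval (mem (tick 1 (init n s \<epsilon>))) (Num 1)) (tick 1 (init n s \<epsilon>)))"
      have "exec n f tester (init n s \<epsilon>) (return_pmf ?\<sigma>)"
        unfolding tester_def
        by (rule exec.CondTrue[OF _ exec.Assign]) (use False in \<open>simp add: mem_init k_def\<close>)
      moreover have "?\<sigma> \<in> accepting" "steps ?\<sigma> = 2" "queries ?\<sigma> = 0"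
        by (simp_all add: accepting_def advance_intros put_apply) (simp_all add: init_def)
      moreover have "\<not> eps_far n \<epsilon> f ?C"
      proof (rule trivial_distance[OF s])
        have "\<lceil>1 / \<epsilon>\<rceil> \<le> 1" using False unfolding k_def by linarith
        then have "1 / \<epsilon> \<le> 1" unfolding ceiling_le_iff by simp
        then show "1 \<le> \<epsilon>" using \<epsilon> by (simp add: field_simps)
      qed
      moreover have "2 * 1 \<le> c * (real n + real s + 1 / \<epsilon>) ^ d"
        using c s \<epsilon> by (intro mult_mono one_le_power) (auto intro: add_increasing2 add_increasing)
      moreover have "0 \<le> ?q" using \<epsilon> by (intro mult_nonneg_nonneg) auto
      ultimately show ?thesis
        by (intro exI[of _ "return_pmf ?\<sigma>"]) (simp add: measure_return indicator_def)
    next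
      case True
      obtain l g where l: "s * k \<le> 2 ^ l" "l = 0 \<or> 2 ^ (l - 1) < s * k"
        and ex: "exec n f tester (init n s \<epsilon>) (map_pmf g (coins_pmf n s k l))"
        and g: "\<And>c. c \<in> set_pmf (coins_pmf n s k l) \<Longrightarrow> (mem (g c) ''out'' 0 \<noteq> 0 \<longleftrightarrow> accepts n f s l c) \<and>
           queries (g c) \<le> 400000 * (s * k) * (l + 1) ^ 2 \<and>
           steps (g c) \<le> 3 + 15 * (size_bound (n + s + k)) ^ 3 +
             time (size_bound (n + s + k)) (params1 ;; params2 ;; params3 ;; main_prog)"
        using tester_run[of s \<epsilon> n f] s True unfolding k_def by blast
      note est = parameter_estimates[OF s \<epsilon>, folded k_def, OF True l(2)]
      have k1: "1 \<le> k" using True by simp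
      let ?\<mu> = "map_pmf g (coins_pmf n s k l)"
      have "f \<in> ?C \<longrightarrow> measure_pmf.prob ?\<mu> accepting \<ge> 2 / 3"
      proof
        assume f: "f \<in> ?C"
        have "2 / 3 \<le> Pr (coins_pmf n s k l) (accepts n f s l)"
          using accepts_complete[OF f s k1 l(1)] unfolding Pr_not by simp
        also have "\<dots> \<le> Pr (coins_pmf n s k l) (\<lambda>c. g c \<in> accepting)"
          by (rule Pr_mono) (use g in \<open>auto simp: accepting_def\<close>)
        finally show "2 / 3 \<le> measure_pmf.prob ?\<mu> accepting" by (simp add: vimage_def)
      qed
      moreover have "eps_far n \<epsilon> f ?C \<longrightarrow> measure_pmf.prob ?\<mu> (- accepting) \<ge> 2 / 3"
      proof
        assume far: "eps_far n \<epsilon> f ?C"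
        have "2 / 3 \<le> Pr (coins_pmf n s k l) (\<lambda>c. \<not> accepts n f s l c)"
          using accepts_sound[OF far est(1) \<epsilon> k1 l(1)] unfolding Pr_not by simp
        also have "\<dots> \<le> Pr (coins_pmf n s k l) (\<lambda>c. g c \<in> - accepting)"
          by (rule Pr_mono) (use g in \<open>auto simp: accepting_def\<close>)
        finally show "2 / 3 \<le> measure_pmf.prob ?\<mu> (- accepting)" by (simp add: vimage_def)
      qed
      moreover have "real (steps \<sigma>) \<le> ?t \<and> real (queries \<sigma>) \<le> ?q" if "\<sigma> \<in> set_pmf ?\<mu>" for \<sigma>
      proof -
        from that obtain c' where c': "c' \<in> set_pmf (coins_pmf n s k l)" "\<sigma> = g c'" by auto
        have "real (queries \<sigma>) \<le> real (400000 * (s * k) * (l + 1) ^ 2)"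
          using g[OF c'(1)] c'(2) by (simp only: of_nat_le_iff)
        moreover have "real (steps \<sigma>) \<le> real (3 + 15 * (size_bound (n + s + k)) ^ 3 +
             time (size_bound (n + s + k)) (params1 ;; params2 ;; params3 ;; main_prog))"
          using g[OF c'(1)] c'(2) by (simp only: of_nat_le_iff)
        ultimately show ?thesis
          using est(3) time[OF s \<epsilon>, of n, folded k_def, OF est(2)] by linarith
      qed
      ultimately show ?thesis using ex by blast
    qed
  qed
  then show ?thesis by blast
qed

end
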